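(* Let $\alpha>0$ and assume the following. (i) $h$ and $h^n$ ($n\ge1$) are continuously differentiable; $\langle\theta-\theta^*,h(\theta)\rangle>0$ for $\theta\ne\theta^*$ and $\langle\theta-\theta^{*,n},h^n(\theta)\rangle>0$ for $\theta\neq\theta^{*,n}$; $h^n\to h$ and $Dh^n\to Dh$ locally uniformly on $\mathbb{R}^d$; $Dh(\theta^* )$ is non-singular; and for all $\theta\in\mathbb{R}^d$ the limit $\mathcal{E}(h,\alpha,\theta):=\lim_{n}n^{\alpha}(h^n(\theta)-h(\theta))$ exists. (ii) $h$ is twice continuously differentiable in a neighborhood of $\theta^*$; all eigenvalues of $Dh(\theta^* )$ have strictly positive real parts; $\theta\mapsto\mathbb{E}[H(\theta,U)H(\theta,U)^T]$ is continuous on $\mathbb{R}^d$; there is $\varepsilon>0$ such that $\theta\mapsto\mathbb{E}[|H(\theta,U)|^{2+\varepsilon}]$ is locally bounded on $\mathbb{R}^d$; and $\mathbb{E}[H(\theta^*,U)H(\theta^*,U)^T]$ is positive definite. (iii) There exists $b\in(0,1]$ such that $\sup_{n\ge1,\ \theta\ne\theta'}\mathbb{E}[|H(\theta,U^n)-H(\theta',U^n)|^2]/|\theta-\theta'|^{2b}<+\infty$. (iv) There exists $\eta>0$ such that for all $R>0$, $\sup_{|\theta|\le R,\,n\ge1}\mathbb{E}[|H(\theta,U^n)|^{2+\eta}]<+\infty$; and $\theta\mapsto\mathbb{E}[H(\theta,U^n)H(\theta,U^n)^T]$ converges locally uniformly, as $n\to\infty$, to $\theta\mapsto\mathbb{E}[H(\theta,U)H(\theta,U)^T]$.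 (v) There exists $\underline{\lambda}>0$ such that for all $n\ge1$ and $\theta\in\mathbb{R}^d$, $\langle\theta-\theta^{*,n},h^n(\theta)\rangle\ge\underline{\lambda}|\theta-\theta^{*,n}|^2$. (vi) Each $h^n$ is twice continuously differentiable and $Dh^n$ is Lipschitz continuous uniformly in $n$. (vii) $\gamma_p=\gamma(p)$, $p\ge1$, where $\gamma$ is a positive function on $[0,+\infty)$ decreasing to zero that varies regularly with exponent $(-a)$, $a\in(1/2,1)$. Define the empirical means $\bar\theta^n_p=\frac{\theta^n_0+\theta^n_1+\cdots+\theta^n_p}{p+1}$. Then, as $n\to+\infty$, $$n^{\alpha}\big(\bar\theta^n_{n^{2\alpha}}-\theta^*\big)\Longrightarrow-\big(Dh(\theta^* )\big)^{-1}\mathcal{E}(h,\alpha,\theta^* )+\mathcal{N}\Big(0,\;Dh(\theta^* )^{-1}\,\mathbb{E}[H(\theta^*,U)H(\theta^*,U)^T]\,(Dh(\theta^* )^{-1})^T\Big).$$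
   Context: Let $H:\mathbb{R}^d\times\mathbb{R}^q\to\mathbb{R}^d$ be Borel, $U$ and $U^n$ ($n\ge1$) be $\mathbb{R}^q$-valued random vectors, $h(\theta)=\mathbb{E}[H(\theta,U)]$, $h^n(\theta)=\mathbb{E}[H(\theta,U^n)]$; $\theta^*$ is the unique zero of $h$ and $\theta^{*,n}$ the unique zero of $h^n$. For each $n\ge1$ the scheme is $$\theta^n_{p+1}=\theta^n_p-\gamma_{p+1}H(\theta^n_p,(U^n)^{p+1}),\quad p\ge0,$$ where $((U^n)^p)_{p\ge1}$ is i.i.d. with the law of $U^n$ and $\theta^n_0$ is independent of $((U^n)^p)_{p\ge1}$ with $\sup_{n\ge1}\mathbb{E}[|\theta^n_0|^2]<+\infty$. $\gamma$ varies regularly with exponent $(-a)$ means $\lim_{t\to+\infty}\gamma(tx)/\gamma(t)=x^{-a}$ for every $x>0$. A non-integer number of steps is understood as its integer part. $\Longrightarrow$ is convergence in law; $c+\mathcal{N}(0,\Sigma)$ is the Gaussian law with mean $c$ and covariance $\Sigma$. *)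

theory Defs
  imports "HOL-Probability.Probability"
begin

definition C1_on :: "('a::real_normed_vector \<Rightarrow> 'b::real_normed_vector) \<Rightarrow> 'a set \<Rightarrow> bool" where
  "C1_on f S \<longleftrightarrow>
    (\<exists>f'. (\<forall>x\<in>S. (f has_derivative blinfun_apply (f' x)) (at x)) \<and> continuous_on S f')"

definition C2_on :: "('a::real_normed_vector \<Rightarrow> 'b::real_normed_vector) \<Rightarrow> 'a set \<Rightarrow> bool" where
  "C2_on f S \<longleftrightarrow>
    (\<exists>f'. (\<forall>x\<in>S. (f has_derivative blinfun_apply (f' x)) (at x)) \<and> C1_on f' S)"

definition locally_uniform_limit ::
    "(nat \<Rightarrow> 'a::topological_space \<Rightarrow> 'b::metric_space) \<Rightarrow> ('a \<Rightarrow> 'b) \<Rightarrow> bool" where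
  "locally_uniform_limit f g \<longleftrightarrow>
    (\<forall>x. \<exists>S. open S \<and> x \<in> S \<and> uniform_limit S f g sequentially)"

definition locally_bounded :: "('a::topological_space \<Rightarrow> ennreal) \<Rightarrow> bool" where
  "locally_bounded f \<longleftrightarrow>
    (\<forall>x. \<exists>S C. open S \<and> x \<in> S \<and> (\<forall>y\<in>S. f y \<le> ennreal C))"

text \<open>Complex eigenvalues of a real matrix.\<close>

definition complex_eigenvalue :: "real^'d^'d \<Rightarrow> complex \<Rightarrow> bool" where
  "complex_eigenvalue A z \<longleftrightarrow>
    (\<exists>v :: complex^'d. v \<noteq> 0 \<and> map_matrix complex_of_real A *v v = z *s v)"

definition positive_definite :: "real^'d^'d \<Rightarrow> bool" where
  "positive_definite A \<longleftrightarrow> transpose A = A \<and> (\<forall>v. v \<noteq> 0 \<longrightarrow> 0 < v \<bullet> (A *v v))"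

text \<open>The matrix \<open>v v\<^sup>T\<close>.\<close>

definition outer :: "real^'d \<Rightarrow> real^'d^'d" where
  "outer v = (\<chi> i j. v $ i * v $ j)"

definition mean_field ::
    "'w measure \<Rightarrow> (real^'d \<Rightarrow> real^'q \<Rightarrow> real^'d) \<Rightarrow> ('w \<Rightarrow> real^'q) \<Rightarrow> real^'d \<Rightarrow> real^'d" where
  "mean_field M H V \<theta> = (\<integral>\<omega>. H \<theta> (V \<omega>) \<partial>M)"

definition second_moment ::
    "'w measure \<Rightarrow> (real^'d \<Rightarrow> real^'q \<Rightarrow> real^'d) \<Rightarrow> ('w \<Rightarrow> real^'q) \<Rightarrow> real^'d \<Rightarrow> real^'d^'d" where
  "second_moment M H V \<theta> = (\<integral>\<omega>. outer (H \<theta> (V \<omega>)) \<partial>M)"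

text \<open>The absolute moment of order \<open>r\<close>, with values in \<open>[0, \<infinity>]\<close>, so that an upper bound
  includes the finiteness of the expectation.\<close>

definition abs_moment ::
    "'w measure \<Rightarrow> (real^'d \<Rightarrow> real^'q \<Rightarrow> real^'d) \<Rightarrow> ('w \<Rightarrow> real^'q) \<Rightarrow> real \<Rightarrow> real^'d \<Rightarrow> ennreal" where
  "abs_moment M H V r \<theta> = (\<integral>\<^sup>+\<omega>. ennreal (norm (H \<theta> (V \<omega>)) powr r) \<partial>M)"

definition scaled_error ::
    "(nat \<Rightarrow> real^'d \<Rightarrow> real^'d) \<Rightarrow> (real^'d \<Rightarrow> real^'d) \<Rightarrow> real \<Rightarrow> real^'d \<Rightarrow> nat \<Rightarrow> real^'d" where
  "scaled_error hn h \<alpha> \<theta> n = (real n powr \<alpha>) *\<^sub>R (hn n \<theta> - h \<theta>)"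

text \<open>The library predicate \<open>indep_var\<close> requires both variables to have the same codomain type.
  This is its definition without that restriction.\<close>

definition indep_rv ::
    "'w measure \<Rightarrow> 'a measure \<Rightarrow> ('w \<Rightarrow> 'a) \<Rightarrow> 'b measure \<Rightarrow> ('w \<Rightarrow> 'b) \<Rightarrow> bool" where
  "indep_rv M A X B Y \<longleftrightarrow> X \<in> measurable M A \<and> Y \<in> measurable M B \<and>
    prob_space.indep_set M {X -` S \<inter> space M | S. S \<in> sets A} {Y -` S \<inter> space M | S. S \<in> sets B}"

definition regularly_varying :: "(real \<Rightarrow> real) \<Rightarrow> real \<Rightarrow> bool" where
  "regularly_varying g \<rho> \<longleftrightarrow> (\<forall>x>0. ((\<lambda>t. g (t * x) / g t) \<longlongrightarrow> x powr \<rho>) at_top)"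

definition empirical_mean :: "(nat \<Rightarrow> 'w \<Rightarrow> real^'d) \<Rightarrow> nat \<Rightarrow> 'w \<Rightarrow> real^'d" where
  "empirical_mean X p \<omega> = (1 / real (p + 1)) *\<^sub>R (\<Sum>k=0..p. X k \<omega>)"

text \<open>The nondegenerate Gaussian law with mean \<open>c\<close> and covariance \<open>\<Sigma>\<close>, given by its Lebesgue
  density; it is the Gaussian law only for positive definite \<open>\<Sigma>\<close>.\<close>

definition gaussian :: "real^'d \<Rightarrow> real^'d^'d \<Rightarrow> (real^'d) measure" where
  "gaussian c \<Sigma> = density lborel (\<lambda>x. ennreal
     (exp (- ((x - c) \<bullet> (matrix_inv \<Sigma> *v (x - c))) / 2) / sqrt ((2 * pi) ^ CARD('d) * det \<Sigma>)))"

definition weakly_converges :: "(nat \<Rightarrow> 'a::topological_space measure) \<Rightarrow> 'a measure \<Rightarrow> bool" where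
  "weakly_converges \<mu> \<nu> \<longleftrightarrow>
    (\<forall>f :: 'a \<Rightarrow> real. continuous_on UNIV f \<and> bounded (range f) \<longrightarrow>
      (\<lambda>n. \<integral>x. f x \<partial>\<mu> n) \<longlonglongrightarrow> (\<integral>x. f x \<partial>\<nu>))"

definition converges_in_law ::
    "'w measure \<Rightarrow> (nat \<Rightarrow> 'w \<Rightarrow> 'a::topological_space) \<Rightarrow> 'a measure \<Rightarrow> bool" where
  "converges_in_law M X \<nu> \<longleftrightarrow> weakly_converges (\<lambda>n. distr M borel (X n)) \<nu>"

end

theory Submission
  imports Defs "HOL-Real_Asymp.Real_Asymp"
begin

text \<open>Write \<open>e\<^sub>p = \<theta>\<^sub>p - \<theta>*\<^sub>n\<close> in row \<open>n\<close>. Strong monotonicity and the Hoelder bound on \<open>H\<close> in mean square give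
  \<open>E|e\<^sub>p|^2 \<le> A (p + 1) powr (-s)\<close> for some \<open>s > 1/2\<close>, uniformly in \<open>n\<close>. Linearizing \<open>h\<^sub>n\<close> at its zero
  turns the recursion into
  \<open>J\<^sub>n e\<^sub>p + H(\<theta>*\<^sub>n, V\<^sub>p\<^sub>+\<^sub>1) = (e\<^sub>p - e\<^sub>p\<^sub>+\<^sub>1) / \<gamma>\<^sub>p\<^sub>+\<^sub>1 - r\<^sub>p - \<Delta>\<^sub>p\<^sub>+\<^sub>1\<close>
  with a quadratic remainder \<open>r\<^sub>p\<close> and a martingale difference \<open>\<Delta>\<^sub>p\<^sub>+\<^sub>1\<close> of variance \<open>O(E|e\<^sub>p|^(2b))\<close>. Summed
  over \<open>m\<close> steps and divided by \<open>sqrt m\<close>, the right-hand side tends to \<open>0\<close> in mean: the first term by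
  summation by parts, which only uses that \<open>\<gamma>\<close> is monotone with polynomial bounds. Hence the scaled
  averages behave like \<open>- Dh(\<theta>*)\<^sup>-\<^sup>1\<close> times a normalized sum of an i.i.d. row, whose characteristic
  function converges. The shift \<open>n powr \<alpha> * (\<theta>*\<^sub>n - \<theta>*)\<close> produces the mean of the limit law.\<close>

text \<open>Row n is observed after about n powr (2\<alpha>) steps, so only bounds with constants
  common to all rows survive the limit. The decay of the mean square error is therefore proved for
  one numerical sequence, \<open>msq_bound\<close>, that majorizes every row. Since \<gamma> need
  not be a power, it is squeezed between powers with exponents s < a < a' close to a. Both ends of
  the range of a enter: a > 1/2 allows s > 1/2, so that the summed quadratic remainders are o(sqrt
  m), and a < 1 allows a' - s/2 < 1/2, so that the telescoped term, of order m powr (a' - s/2), is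
  o(sqrt m) as well. Linearizing at the zero of \<open>hn n\<close> and not at
  \<open>\<theta>s\<close> makes the noise exactly centred; the price is a Jacobian that moves with
  n and is replaced by its limit only at the end. Limit laws are identified by characteristic
  functions. As the target Gaussian is given by a density, its characteristic function comes from a
  linear change of variables, and weak convergence in several dimensions from Gaussian
  smoothing.\<close>

section \<open>Step sizes and recursive inequalities\<close>

text \<open>A weak form of Potter's bounds. Only the ratio at x = 2 is used: beyond some threshold,
  doubling the argument multiplies \<open>g\<close> by a factor between \<open>2 powr (- a')\<close>
  and \<open>2 powr (- s)\<close>. Iterated doubling carries the bounds from an initial interval,
  where monotonicity gives them, to the whole half-line.\<close>

lemma regularly_varying_powr_bounds:
  fixes g :: "real \<Rightarrow> real"
  assumes pos: "\<And>t. 0 \<le> t \<Longrightarrow> 0 < g t"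
    and dec: "\<And>s t. 0 \<le> s \<Longrightarrow> s \<le> t \<Longrightarrow> g t \<le> g s"
    and rv: "regularly_varying g (- a)"
    and s: "0 < s" "s < a" and a': "a < a'"
  shows "\<exists>c>0. \<exists>C. \<forall>t\<ge>1. c * t powr (- a') \<le> g t \<and> g t \<le> C * t powr (- s)"
proof -
  have lim: "((\<lambda>t. g (t * 2) / g t) \<longlongrightarrow> 2 powr (- a)) at_top"
    using rv unfolding regularly_varying_def by auto
  have "2 powr (- a') < (2::real) powr (- a)" "(2::real) powr (- a) < 2 powr (- s)"
    using s a' by auto
  from order_tendstoD(1)[OF lim this(1)] order_tendstoD(2)[OF lim this(2)]
  have "eventually (\<lambda>t. 2 powr (- a') < g (t * 2) / g t \<and> g (t * 2) / g t < 2 powr (- s)) at_top"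
    by (rule eventually_conj)
  then obtain T0 where T0: "\<And>t. t \<ge> T0 \<Longrightarrow> 2 powr (- a') < g (t * 2) / g t \<and> g (t * 2) / g t < 2 powr (- s)"
    unfolding eventually_at_top_linorder by auto
  define T where "T = max 1 T0"
  have T1: "1 \<le> T" by (simp add: T_def)
  have dbl: "2 powr (- a') * g (t/2) \<le> g t \<and> g t \<le> 2 powr (- s) * g (t/2)" if "t \<ge> 2 * T" for t
  proof -
    have "t/2 \<ge> T0" "t/2 \<ge> 0" using that T1 by (auto simp: T_def)
    with T0[of "t/2"] pos[of "t/2"] show ?thesis by (auto simp: field_simps)
  qed
  \<comment> \<open>On [1, 2T] the value \<open>g (2 * T)\<close> is the minimum of \<open>g\<close>
    and \<open>t powr (- a')\<close> is at most 1; the factor \<open>(2 * T) powr s\<close> makes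
    \<open>C * t powr (- s)\<close> at least \<open>g 0\<close> there. Both bounds thus hold on the
    base interval.\<close>
  define c where "c = g (2 * T)"
  define C where "C = g 0 * (2 * T) powr s"
  have c0: "c > 0" using pos T1 by (simp add: c_def)
  have main: "c * t powr (- a') \<le> g t \<and> g t \<le> C * t powr (- s)"
    if "1 \<le> t" "t \<le> 2 * T * 2 ^ n" for n t
    using that
  proof (induction n arbitrary: t)
    case 0
    have "t powr (- a') \<le> 1" using 0 s a' by (simp add: powr_le_one_le powr_minus_divide ge_one_powr_ge_zero)
    then have "c * t powr (- a') \<le> c" using c0 by simp
    also have "c \<le> g t" unfolding c_def using 0 by (intro dec) auto
    finally have 1: "c * t powr (- a') \<le> g t" .
    have "g t \<le> g 0" using 0 by (intro dec) auto
    moreover have "1 \<le> (2 * T) powr s * t powr (- s)"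
      using 0 s T1 by (simp add: powr_minus_divide powr_mono2)
    ultimately have "g t \<le> C * t powr (- s)"
      unfolding C_def using pos[of 0]
      by (metis mult.assoc mult.right_neutral mult_left_mono order.trans less_imp_le order_refl)
    with 1 show ?case by simp
  next
    case (Suc n)
    show ?case
    proof (cases "t \<le> 2 * T * 2 ^ n")
      case True then show ?thesis using Suc by auto
    next
      case False
      have "2 * T * 1 \<le> 2 * T * 2 ^ n" using T1 by (intro mult_left_mono) auto
      with False have t: "t \<ge> 2 * T" by auto
      have "1 \<le> t/2" "t/2 \<le> 2 * T * 2 ^ n" using t T1 Suc.prems by auto
      from Suc.IH[OF this] have IH: "c * (t/2) powr (- a') \<le> g (t/2)" "g (t/2) \<le> C * (t/2) powr (- s)" by auto
      have e: "2 powr r * (t/2) powr r = t powr r" for r using t T1 by (simp flip: powr_mult)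
      have "c * t powr (- a') = 2 powr (- a') * (c * (t/2) powr (- a'))"
        by (simp add: e[symmetric])
      also have "\<dots> \<le> g t" using IH(1) dbl[OF t]
        by (meson mult_left_mono order_trans powr_ge_zero)
      finally have 1: "c * t powr (- a') \<le> g t" .
      have "g t \<le> 2 powr (- s) * (C * (t/2) powr (- s))" using IH(2) dbl[OF t]
        by (meson mult_left_mono order_trans powr_ge_zero)
      also have "\<dots> = C * t powr (- s)" by (simp add: e[symmetric])
      finally show ?thesis using 1 by simp
    qed
  qed
  have "c * t powr (- a') \<le> g t \<and> g t \<le> C * t powr (- s)" if "t \<ge> 1" for t
  proof -
    obtain n where "t < 2 ^ n" using real_arch_pow[of 2 t] by auto
    moreover have "1 * 2 ^ n \<le> 2 * T * (2 ^ n :: real)" using T1 by (intro mult_right_mono) auto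
    ultimately have "t \<le> 2 * T * 2 ^ n" by linarith
    then show ?thesis using main[of t n] that by blast
  qed
  with c0 show ?thesis by blast
qed

text \<open>Bernoulli-type inequality: exp u is at least 1 + u for u = - s ln (1 + 1/x), and ln (1 +
  1/x) is at most 1/x. In one step a candidate bound x powr (- s) thus loses at most the fraction
  s/x of itself.\<close>

lemma powr_minus_Suc_lower:
  fixes x s :: real
  assumes "x > 0" "s \<ge> 0"
  shows "x powr (- s) * (1 - s / x) \<le> (x + 1) powr (- s)"
proof -
  have "1 - s / x \<le> 1 + (- s) * ln (1 + 1/x)"
    using assms ln_add_one_self_le_self[of "1/x"] mult_left_mono[of "ln (1 + 1/x)" "1/x" s] by simp
  also have "\<dots> \<le> (1 + 1/x) powr (- s)"
  proof -
    have "1 + 1/x \<noteq> 0" using assms by (smt (verit) divide_pos_pos)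
    then show ?thesis using exp_ge_add_one_self[of "- s * ln (1 + 1/x)"] by (simp add: powr_def)
  qed
  finally have "x powr (- s) * (1 - s/x) \<le> x powr (- s) * (1 + 1/x) powr (- s)"
    by (intro mult_left_mono) auto
  also have "\<dots> = (x * (1 + 1/x)) powr (- s)"
    by (rule powr_mult[symmetric])
  also have "x * (1 + 1/x) = x + 1" using assms by (simp add: field_simps)
  finally show ?thesis .
qed

text \<open>The sequence \<open>A * (real p + 1) powr (- s)\<close> is eventually a supersolution.
  For small steps the contraction is at least 3/2 l g once the term K g^2 is absorbed; the source
  takes back l g, because one of its two factors g is already of order (p + 1) powr (- s). The
  remaining l g / 2 beats the relative decrease s / (p + 1) of the power, since g is at least of
  order p powr (- a') with a' < 1.\<close>

lemma powr_decay_of_recursion: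
  fixes w g :: "nat \<Rightarrow> real"
  assumes rec: "\<And>p. w (Suc p) \<le> (1 - 2 * l * g (Suc p) + K * (g (Suc p))\<^sup>2) * w p + K * (g (Suc p))\<^sup>2"
    and w0: "\<And>p. 0 \<le> w p" and l: "l > 0" and K: "K \<ge> 0"
    and lo: "\<And>p. p \<ge> 1 \<Longrightarrow> c * real p powr (- a') \<le> g p"
    and hi: "\<And>p. p \<ge> 1 \<Longrightarrow> g p \<le> C * real p powr (- s)"
    and c: "c > 0" and s: "0 < s" and a': "a' < 1"
  shows "\<exists>A. \<forall>p. w p \<le> A * (real p + 1) powr (- s)"
proof -
  have gpos: "g (Suc p) > 0" for p
    using lo[of "Suc p"] c by (smt (verit) mult_pos_pos of_nat_0_less_iff powr_gt_zero le_add1 plus_1_eq_Suc zero_less_Suc)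
  have C: "C > 0" using hi[of 1] gpos[of 0] by simp
  have up: "(\<lambda>p. C * real (Suc p) powr (- s)) \<longlonglongrightarrow> 0" using s by real_asymp
  have g0: "(\<lambda>p. g (Suc p)) \<longlonglongrightarrow> 0"
    by (rule tendsto_sandwich[OF _ _ tendsto_const up]) (use gpos hi in \<open>auto intro!: always_eventually simp: less_imp_le simp del: of_nat_Suc\<close>)
  have 1: "eventually (\<lambda>p. K * g (Suc p) < l / 2) sequentially"
    by (rule order_tendstoD(2)[where y=0]) (use l in \<open>auto intro!: tendsto_eq_intros g0\<close>)
  have 2: "eventually (\<lambda>p. 3/2 * l * g (Suc p) < 1) sequentially"
    by (rule order_tendstoD(2)[where y=0]) (use l in \<open>auto intro!: tendsto_eq_intros g0\<close>)
  have "(\<lambda>p. s / real (Suc p) * real (Suc p) powr a') \<longlonglongrightarrow> 0" using a' by real_asymp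
  then have 3: "eventually (\<lambda>p. s / real (Suc p) * real (Suc p) powr a' < l / 2 * c) sequentially"
    using l c by (intro order_tendstoD(2)[where y=0]) auto
  \<comment> \<open>From \<open>P\<close> on, the quadratic part of the coefficient is absorbed, the
    remaining coefficient stays nonnegative so that the induction hypothesis may be multiplied by
    it, and s/x is at most l g / 2.\<close>
  obtain P where P: "\<And>p. p \<ge> P \<Longrightarrow> K * g (Suc p) < l / 2 \<and> 3/2 * l * g (Suc p) < 1 \<and>
      s / real (Suc p) * real (Suc p) powr a' < l / 2 * c"
    using eventually_conj[OF 1 eventually_conj[OF 2 3]] unfolding eventually_sequentially by auto
  \<comment> \<open>The first entry starts the induction at \<open>P\<close>; the second is what
    \<open>K * C \<le> l * A\<close> asks for.\<close>
  define A where "A = max (w P * (real P + 1) powr s) (K * C / l)"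
  have A: "A \<ge> 0" "K * C \<le> l * A" 
  proof -
    have "0 \<le> K * C / l" using K C l by simp
    moreover have "K * C / l \<le> A" by (simp add: A_def)
    ultimately show "A \<ge> 0" "K * C \<le> l * A" using l by (linarith, simp add: divide_le_eq mult.commute)
  qed
  have tail: "w p \<le> A * (real p + 1) powr (- s)" if "p \<ge> P" for p
    using that
  proof (induction p rule: dec_induct)
    case base
    have "w P = (w P * (real P + 1) powr s) * (real P + 1) powr (- s)"
      by (simp add: mult.assoc flip: powr_add)
    also have "\<dots> \<le> A * (real P + 1) powr (- s)" by (intro mult_right_mono) (auto simp: A_def)
    finally show ?case .
  next
    case (step p)
    let ?g = "g (Suc p)" and ?x = "real p + 1"
    note Pp = P[OF step.hyps(1)]
    have sg: "s / ?x \<le> l / 2 * ?g"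
    proof -
      have "s / ?x = (s / real (Suc p) * real (Suc p) powr a') * real (Suc p) powr (- a')"
        by (simp add: powr_minus add.commute)
      also have "\<dots> \<le> (l / 2 * c) * real (Suc p) powr (- a')"
        using Pp by (intro mult_right_mono) auto
      also have "\<dots> \<le> l / 2 * ?g" using lo[of "Suc p"] l by simp
      finally show ?thesis .
    qed
    have "K * ?g * ?g \<le> l/2 * ?g" using Pp gpos[of p] by (intro mult_right_mono) auto
    then have co: "1 - 2 * l * ?g + K * ?g\<^sup>2 \<le> 1 - 3/2 * l * ?g" by (simp add: power2_eq_square algebra_simps)
    have "K * ?g\<^sup>2 = ?g * (K * ?g)" by (simp add: power2_eq_square)
    also have "\<dots> \<le> ?g * (K * (C * ?x powr (- s)))"
      using hi[of "Suc p"] gpos[of p] K by (intro mult_left_mono) (auto simp: add.commute)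
    also have "\<dots> = ?g * ?x powr (- s) * (K * C)" by simp
    also have "\<dots> \<le> ?g * ?x powr (- s) * (l * A)" using A gpos[of p] by (intro mult_left_mono) auto
    finally have Kg: "K * ?g\<^sup>2 \<le> l * ?g * (A * ?x powr (- s))" by (simp add: mult_ac)
    have "w (Suc p) \<le> (1 - 2 * l * ?g + K * ?g\<^sup>2) * w p + K * ?g\<^sup>2" by (rule rec)
    also have "\<dots> \<le> (1 - 3/2 * l * ?g) * w p + K * ?g\<^sup>2"
      using co w0[of p] by (intro add_mono mult_right_mono) auto
    also have "\<dots> \<le> (1 - 3/2 * l * ?g) * (A * ?x powr (- s)) + l * ?g * (A * ?x powr (- s))"
      using Pp step.IH Kg by (intro add_mono mult_left_mono) auto
    also have "\<dots> = (1 - l / 2 * ?g) * (A * ?x powr (- s))" by (simp add: algebra_simps)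
    also have "\<dots> \<le> (1 - s / ?x) * (A * ?x powr (- s))"
      using sg A by (intro mult_right_mono) auto
    also have "\<dots> = A * (?x powr (- s) * (1 - s / ?x))" by simp
    also have "\<dots> \<le> A * (?x + 1) powr (- s)"
      using A s by (intro mult_left_mono powr_minus_Suc_lower) auto
    finally show ?case by (simp add: add.commute)
  qed
  \<comment> \<open>The finitely many terms before \<open>P\<close> are absorbed by adding all of
    them, rescaled, to the constant.\<close>
  define B where "B = A + (\<Sum>p<P. w p * (real p + 1) powr s)"
  have "w p \<le> B * (real p + 1) powr (- s)" for p
  proof (cases "p < P")
    case True
    have "w p * (real p + 1) powr s \<le> (\<Sum>p<P. w p * (real p + 1) powr s)"
      using True w0 by (intro member_le_sum) auto
    then have "w p * (real p + 1) powr s \<le> B" using A by (simp add: B_def)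
    then have "(w p * (real p + 1) powr s) * (real p + 1) powr (- s) \<le> B * (real p + 1) powr (- s)"
      by (intro mult_right_mono) auto
    then show ?thesis by (simp add: mult.assoc flip: powr_add)
  next
    case False
    have "A \<le> B" unfolding B_def using w0 by (auto intro!: sum_nonneg)
    then have "A * (real p + 1) powr (- s) \<le> B * (real p + 1) powr (- s)" by (intro mult_right_mono) auto
    then show ?thesis using tail[of p] False by linarith
  qed
  then show ?thesis by blast
qed

section \<open>Sums of powers and summation by parts\<close>

lemma sum_powr_minus_le:
  fixes \<tau> :: real
  assumes \<tau>: "0 < \<tau>" "\<tau> < 1"
  shows "(\<Sum>p<m. (real p + 1) powr (- \<tau>)) \<le> real m powr (1 - \<tau>) / (1 - \<tau>)"
proof (induction m)
  case (Suc m)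
  \<comment> \<open>Comparison with the integral of x powr (- \<tau>) over [m, m + 1], by the mean
    value theorem; m = 0 is treated apart because the antiderivative is not differentiable at
    0.\<close>
  have "real m powr (1 - \<tau>) / (1 - \<tau>) + (real m + 1) powr (- \<tau>) \<le> (real m + 1) powr (1 - \<tau>) / (1 - \<tau>)"
  proof (cases "m = 0")
    case True then show ?thesis using \<tau> by (auto simp: field_simps)
  next
    case False
    have "\<exists>z. real m < z \<and> z < real m + 1 \<and> (real m + 1) powr (1 - \<tau>) / (1 - \<tau>) - real m powr (1 - \<tau>) / (1 - \<tau>)
        = (real m + 1 - real m) * z powr (- \<tau>)"
    proof (rule MVT2)
      fix x assume "real m \<le> x" "x \<le> real m + 1"
      then show "((\<lambda>x. x powr (1 - \<tau>) / (1 - \<tau>)) has_real_derivative x powr (- \<tau>)) (at x)"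
        using False \<tau> by (auto intro!: derivative_eq_intros)
    qed auto
    then obtain z where z: "real m < z" "z < real m + 1"
      "(real m + 1) powr (1 - \<tau>) / (1 - \<tau>) - real m powr (1 - \<tau>) / (1 - \<tau>) = z powr (- \<tau>)" by auto
    have "(real m + 1) powr (- \<tau>) \<le> z powr (- \<tau>)" using z \<tau> False by (intro powr_mono2') auto
    then show ?thesis using z by auto
  qed
  with Suc show ?case by (simp add: add.commute)
qed simp

lemma sum_powr_over_sqrt_tendsto_0:
  fixes \<sigma> :: real
  assumes "1/2 < \<sigma>"
  shows "(\<lambda>m. (\<Sum>p<m. (real p + 1) powr (- \<sigma>)) / sqrt (real m)) \<longlonglongrightarrow> 0"
proof -
  \<comment> \<open>The cap 3/4 brings the exponent below 1, where the integral bound applies, and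
    keeps it above 1/2; lowering the exponent only enlarges the sum.\<close>
  define \<tau> where "\<tau> = min \<sigma> (3/4)"
  have \<tau>: "1/2 < \<tau>" "\<tau> < 1" "\<tau> \<le> \<sigma>" using assms by (auto simp: \<tau>_def)
  have up: "(\<lambda>m. real m powr (1 - \<tau>) / (1 - \<tau>) / sqrt (real m)) \<longlonglongrightarrow> 0" using \<tau> by real_asymp
  have le: "(\<Sum>p<m. (real p + 1) powr (- \<sigma>)) \<le> real m powr (1 - \<tau>) / (1 - \<tau>)" for m
    by (rule order_trans[OF sum_mono sum_powr_minus_le]) (use \<tau> in \<open>auto intro!: powr_mono\<close>)
  show ?thesis
    by (rule tendsto_sandwich[OF _ _ tendsto_const up])
      (intro always_eventually allI divide_nonneg_nonneg sum_nonneg divide_right_mono le; simp)+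
qed

lemma mean_powr_tendsto_0:
  fixes \<sigma> :: real
  assumes "0 < \<sigma>"
  shows "(\<lambda>m. (\<Sum>p<m. (real p + 1) powr (- \<sigma>)) / real m) \<longlonglongrightarrow> 0"
proof -
  define \<tau> where "\<tau> = min \<sigma> (3/4)"
  have \<tau>: "0 < \<tau>" "\<tau> < 1" "\<tau> \<le> \<sigma>" using assms by (auto simp: \<tau>_def)
  have up: "(\<lambda>m. real m powr (1 - \<tau>) / (1 - \<tau>) / real m) \<longlonglongrightarrow> 0" using \<tau> by real_asymp
  have le: "(\<Sum>p<m. (real p + 1) powr (- \<sigma>)) \<le> real m powr (1 - \<tau>) / (1 - \<tau>)" for m
    by (rule order_trans[OF sum_mono sum_powr_minus_le]) (use \<tau> in \<open>auto intro!: powr_mono\<close>)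
  show ?thesis
    by (rule tendsto_sandwich[OF _ _ tendsto_const up])
      (intro always_eventually allI divide_nonneg_nonneg sum_nonneg divide_right_mono le; simp)+
qed

text \<open>Abel summation. It serves twice: forwards on the error vectors in
  \<open>linearization_L1\<close>, and backwards on a scalar majorant in the next lemma.\<close>

lemma sum_by_parts_steps:
  fixes e :: "nat \<Rightarrow> 'a::real_vector" and \<beta> :: "nat \<Rightarrow> real"
  shows "(\<Sum>p<Suc m. \<beta> (Suc p) *\<^sub>R (e p - e (Suc p))) =
    \<beta> 1 *\<^sub>R e 0 - \<beta> (Suc m) *\<^sub>R e (Suc m) + (\<Sum>p<m. (\<beta> (Suc (Suc p)) - \<beta> (Suc p)) *\<^sub>R e (Suc p))"
  by (induction m) (simp_all add: algebra_simps)

text \<open>This is the bound left by Abel summation once all signs are made positive. Undoing the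
  summation moves the differences from 1/g, whose increments are uncontrolled, back onto the
  explicit power \<open>v\<close>, whose increments are of order p powr (- q - 1). So a lower bound
  on \<open>g\<close> is enough, and \<open>a' - q < 1/2\<close> is what both the last term and the
  sum ask for.\<close>

lemma step_weighted_decay_tendsto_0:
  fixes g :: "nat \<Rightarrow> real"
  assumes lo: "\<And>p. p \<ge> 1 \<Longrightarrow> c * real p powr (- a') \<le> g p"
    and c: "c > 0" and q: "0 < q" "a' - q < 1/2"
  defines "v \<equiv> \<lambda>p. (real p + 1) powr (- q)"
  shows "(\<lambda>m. (v 0 / g 1 + v (Suc m) / g (Suc m) +
     (\<Sum>p<m. (1 / g (Suc (Suc p)) - 1 / g (Suc p)) * v (Suc p))) / sqrt (real (Suc m))) \<longlonglongrightarrow> 0"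
    (is "(\<lambda>m. ?\<tau> m / _) \<longlonglongrightarrow> 0")
proof -
  have gi: "1 / g (Suc p) \<le> (real p + 1) powr a' / c" "0 < 1 / g (Suc p)" for p
  proof -
    have "0 < c * real (Suc p) powr (- a')" using c by auto
    moreover note lo[of "Suc p"]
    ultimately have *: "0 < c * real (Suc p) powr (- a')" "c * real (Suc p) powr (- a') \<le> g (Suc p)" by auto
    then show g: "0 < 1 / g (Suc p)" by auto
    have "1 / g (Suc p) \<le> 1 / (c * real (Suc p) powr (- a'))"
      using * by (intro divide_left_mono) auto
    then show "1 / g (Suc p) \<le> (real p + 1) powr a' / c"
      by (simp add: powr_minus divide_simps add.commute)
  qed
  have "v 0 / g 1 - v (Suc m) / g (Suc m) + (\<Sum>p<m. (1 / g (Suc (Suc p)) - 1 / g (Suc p)) * v (Suc p))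
     = (\<Sum>p<Suc m. (1 / g (Suc p)) * (v p - v (Suc p)))" for m
    using sum_by_parts_steps[of "\<lambda>p. 1 / g p" v m] by simp
  \<comment> \<open>The boundary term at \<open>Suc m\<close> has a minus sign in Abel summation but
    a plus sign in the bound; hence the factor 2.\<close>
  then have eq: "?\<tau> m = 2 * (v (Suc m) / g (Suc m)) + (\<Sum>p<Suc m. (1 / g (Suc p)) * (v p - v (Suc p)))" for m
    by (smt (verit))
  have dv: "0 \<le> v p - v (Suc p)" "v p - v (Suc p) \<le> q * (real p + 1) powr (- q - 1)" for p
  proof -
    show "0 \<le> v p - v (Suc p)" unfolding v_def using q by (auto intro!: powr_mono2')
    have "v p - v (Suc p) \<le> (real p + 1) powr (- q) * (q / (real p + 1))"
      using powr_minus_Suc_lower[of "real p + 1" q] q unfolding v_def by (auto simp: algebra_simps)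
    also have "\<dots> = q * (real p + 1) powr (- q - 1)" by (simp add: powr_diff)
    finally show "v p - v (Suc p) \<le> q * (real p + 1) powr (- q - 1)" .
  qed
  have summand: "(1 / g (Suc p)) * (v p - v (Suc p)) \<le> q / c * (real p + 1) powr (- (1 + q - a'))" for p
  proof -
    have "(1 / g (Suc p)) * (v p - v (Suc p)) \<le> ((real p + 1) powr a' / c) * (q * (real p + 1) powr (- q - 1))"
      using gi dv c by (intro mult_mono) auto
    also have "\<dots> = q / c * ((real p + 1) powr a' * (real p + 1) powr (- q - 1))" by simp
    also have "(real p + 1) powr a' * (real p + 1) powr (- q - 1) = (real p + 1) powr (a' + (- q - 1))"
      by (rule powr_add[symmetric])
    also have "a' + (- q - 1) = - (1 + q - a')" by simp
    finally show ?thesis .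
  qed
  have last: "v (Suc m) / g (Suc m) \<le> (real m + 1) powr (a' - q) / c" for m
  proof -
    have "v (Suc m) / g (Suc m) = v (Suc m) * (1 / g (Suc m))" by simp
    also have "\<dots> \<le> (real m + 1) powr (- q) * ((real m + 1) powr a' / c)"
      using gi[of m] q unfolding v_def by (intro mult_mono) (auto intro!: powr_mono2')
    also have "\<dots> = (real m + 1) powr (a' - q) / c" by (simp add: powr_diff powr_minus_divide)
    finally show ?thesis .
  qed
  have up1: "(\<lambda>m. 2 * ((real m + 1) powr (a' - q) / c) / sqrt (real (Suc m))) \<longlonglongrightarrow> 0"
    using q c by real_asymp
  have up2: "(\<lambda>m. q / c * ((\<Sum>p<Suc m. (real p + 1) powr (- (1 + q - a'))) / sqrt (real (Suc m)))) \<longlonglongrightarrow> 0"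
    using LIMSEQ_Suc[OF sum_powr_over_sqrt_tendsto_0[of "1 + q - a'"]] q by (intro tendsto_mult_right_zero) auto
  have up: "(\<lambda>m. 2 * ((real m + 1) powr (a' - q) / c) / sqrt (real (Suc m)) +
      q / c * ((\<Sum>p<Suc m. (real p + 1) powr (- (1 + q - a'))) / sqrt (real (Suc m)))) \<longlonglongrightarrow> 0"
    using tendsto_add[OF up1 up2] by simp
  have ub: "?\<tau> m / sqrt (real (Suc m)) \<le> 2 * ((real m + 1) powr (a' - q) / c) / sqrt (real (Suc m)) +
      q / c * ((\<Sum>p<Suc m. (real p + 1) powr (- (1 + q - a'))) / sqrt (real (Suc m)))" for m
  proof -
    have "?\<tau> m \<le> 2 * ((real m + 1) powr (a' - q) / c) + q / c * (\<Sum>p<Suc m. (real p + 1) powr (- (1 + q - a')))"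
      unfolding eq sum_distrib_left by (intro add_mono sum_mono summand mult_left_mono last) auto
    then have "?\<tau> m / sqrt (real (Suc m)) \<le> (2 * ((real m + 1) powr (a' - q) / c) + q / c * (\<Sum>p<Suc m. (real p + 1) powr (- (1 + q - a')))) / sqrt (real (Suc m))"
      by (rule divide_right_mono) auto
    then show ?thesis by (simp only: add_divide_distrib times_divide_eq_right)
  qed
  have lb: "0 \<le> ?\<tau> m / sqrt (real (Suc m))" for m
  proof -
    have "0 \<le> v (Suc m) / g (Suc m)" using gi(2)[of m] unfolding v_def by (simp add: zero_less_divide_iff)
    moreover have "0 \<le> (\<Sum>p<Suc m. (1 / g (Suc p)) * (v p - v (Suc p)))"
      using gi dv by (intro sum_nonneg mult_nonneg_nonneg) (auto simp: less_imp_le)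
    ultimately show ?thesis unfolding eq by (intro divide_nonneg_nonneg add_nonneg_nonneg) auto
  qed
  show ?thesis
    by (rule tendsto_sandwich[OF _ _ tendsto_const up]) (use ub lb in \<open>auto intro!: always_eventually\<close>)
qed

section \<open>Gaussian measures and the continuity theorem for characteristic functions\<close>

definition gauss_density :: "'a::euclidean_space \<Rightarrow> real" where
  "gauss_density x = exp (- (norm x)\<^sup>2 / 2) / sqrt (2 * pi) ^ DIM('a)"

definition std_gauss :: "'a::euclidean_space measure" where
  "std_gauss = density lborel (\<lambda>x. ennreal (gauss_density x))"

lemma gauss_density_prod:
  "gauss_density (x::'a::euclidean_space) = (\<Prod>b\<in>Basis. std_normal_density (x \<bullet> b))"
proof -
  have "(norm x)\<^sup>2 = (\<Sum>b\<in>Basis. (x \<bullet> b)\<^sup>2)"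
    by (simp only: norm_eq_sqrt_inner euclidean_inner[of x x])
      (simp add: power2_eq_square sum_nonneg)
  then have "exp (- (norm x)\<^sup>2 / 2) = (\<Prod>b\<in>Basis. exp (- (x \<bullet> b)\<^sup>2 / 2))"
    by (simp add: exp_sum[symmetric] sum_negf sum_divide_distrib)
  then show ?thesis
    by (simp add: gauss_density_def std_normal_density_def prod.distrib prod_dividef)
qed

lemma gauss_density_measurable [measurable]: "gauss_density \<in> borel_measurable borel"
  unfolding gauss_density_def[abs_def] by measurable

lemma gauss_density_nonneg: "0 \<le> gauss_density x"
  by (simp add: gauss_density_def)

lemma gauss_density_le_1: "gauss_density x \<le> 1"
proof -
  have "1 \<le> sqrt (2 * pi) ^ DIM('a)" using pi_gt3 by (intro one_le_power) auto
  then have "exp (- (norm x)\<^sup>2 / 2) \<le> sqrt (2 * pi) ^ DIM('a)"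
    by (meson order_trans exp_le_one_iff divide_nonpos_pos neg_le_0_iff_le zero_le_power2 zero_less_numeral)
  then show ?thesis
    unfolding gauss_density_def by (subst divide_le_eq_1_pos) auto
qed

lemma sets_std_gauss [simp, measurable_cong]: "sets std_gauss = sets borel"
  and space_std_gauss [simp]: "space std_gauss = UNIV"
  by (simp_all add: std_gauss_def)

lemma prob_space_std_gauss: "prob_space (std_gauss :: 'a::euclidean_space measure)"
proof
  have "emeasure std_gauss (space std_gauss :: 'a set) = (\<integral>\<^sup>+x. (\<Prod>b\<in>Basis. ennreal (std_normal_density ((x::'a) \<bullet> b))) \<partial>lborel)"
    by (simp add: std_gauss_def emeasure_density gauss_density_prod prod_ennreal)
  also have "\<dots> = (\<Prod>b\<in>(Basis::'a set). \<integral>\<^sup>+x. ennreal (std_normal_density x) \<partial>lborel)"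
    by (rule nn_integral_lborel_prod) auto
  also have "(\<integral>\<^sup>+x. ennreal (std_normal_density x) \<partial>lborel) = 1"
    using prob_space.emeasure_space_1[OF prob_space_normal_density[of 1 0]] by (simp add: emeasure_density)
  finally show "emeasure std_gauss (space std_gauss :: 'a set) = 1" by simp
qed

lemma integral_std_gauss:
  fixes f :: "'a::euclidean_space \<Rightarrow> 'b::{banach, second_countable_topology}"
  assumes [measurable]: "f \<in> borel_measurable borel"
  shows "(\<integral>x. f x \<partial>std_gauss) = (\<integral>x. gauss_density x *\<^sub>R f x \<partial>lborel)"
  unfolding std_gauss_def by (rule integral_density) (auto simp: gauss_density_nonneg)

text \<open>Density and exponential both factor over the coordinates, which reduces the claim to the
  one-dimensional normal distribution.\<close>

lemma char_std_gauss:
  "(\<integral>x. iexp (t \<bullet> x) \<partial>std_gauss) = complex_of_real (exp (- (norm t)\<^sup>2 / 2))"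
proof -
  interpret P: product_sigma_finite "\<lambda>b::'a. lborel :: real measure"
    by (simp add: product_sigma_finite_def sigma_finite_lborel)
  let ?f = "\<lambda>b x. std_normal_density x *\<^sub>R iexp ((t \<bullet> b) * x)"
  have 1: "integrable lborel (?f b)" for b
  proof (rule Bochner_Integration.integrable_bound)
    show "integrable lborel std_normal_density" by (rule integrable_normal_density) auto
    show "AE x in lborel. norm (?f b x) \<le> norm (std_normal_density x)"
      by (auto simp: norm_mult)
  qed simp
  have 2: "integral\<^sup>L lborel (?f b) = complex_of_real (exp (- (t \<bullet> b)\<^sup>2 / 2))" for b
  proof -
    have "integral\<^sup>L lborel (?f b) = char std_normal_distribution (t \<bullet> b)"
      unfolding char_def by (subst integral_density) auto
    then show ?thesis by (simp add: char_std_normal_distribution)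
  qed
  have "(\<integral>x. iexp (t \<bullet> x) \<partial>std_gauss) = (\<integral>x. gauss_density x *\<^sub>R iexp (t \<bullet> x) \<partial>lborel)"
    by (rule integral_std_gauss) measurable
  also have "\<dots> = (\<integral>x. (\<Prod>b\<in>Basis. ?f b (x \<bullet> b)) \<partial>lborel)"
  proof (rule Bochner_Integration.integral_cong[OF refl])
    fix x :: 'a
    have "iexp (t \<bullet> x) = (\<Prod>b\<in>Basis. iexp ((t \<bullet> b) * (x \<bullet> b)))"
      by (subst exp_sum[symmetric]) (simp_all add: euclidean_inner[of t x] sum_distrib_left)
    then show "gauss_density x *\<^sub>R iexp (t \<bullet> x) = (\<Prod>b\<in>Basis. ?f b (x \<bullet> b))"
      unfolding gauss_density_prod by (simp add: scaleR_conv_of_real prod.distrib)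
  qed
  also have "\<dots> = (\<integral>x. (\<Prod>b\<in>Basis. ?f b (x b)) \<partial>(\<Pi>\<^sub>M b\<in>(Basis::'a set). lborel))"
    by (subst lborel_eq, subst integral_distr) simp_all
  also have "\<dots> = (\<Prod>b\<in>(Basis::'a set). integral\<^sup>L lborel (?f b))"
    by (rule P.product_integral_prod) (use 1 in auto)
  also have "\<dots> = (\<Prod>b\<in>(Basis::'a set). complex_of_real (exp (- (t \<bullet> b)\<^sup>2 / 2)))"
    by (simp only: 2)
  also have "\<dots> = complex_of_real (exp (- (norm t)\<^sup>2 / 2))"
  proof -
    have "(norm t)\<^sup>2 = (\<Sum>b\<in>Basis. (t \<bullet> b)\<^sup>2)"
      by (simp only: norm_eq_sqrt_inner euclidean_inner[of t t])
        (simp add: power2_eq_square sum_nonneg)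
    then have "exp (- (norm t)\<^sup>2 / 2) = (\<Prod>b\<in>Basis. exp (- (t \<bullet> b)\<^sup>2 / 2))"
      by (simp add: exp_sum[symmetric] sum_negf sum_divide_distrib)
    then show ?thesis by simp
  qed
  finally show ?thesis .
qed

lemma norm_iexp [simp]: "norm (iexp x) = 1" by simp

lemma (in prob_space) integrable_iexp_inner:
  fixes X :: "'a \<Rightarrow> 'b::euclidean_space"
  assumes [measurable]: "X \<in> borel_measurable M"
  shows "integrable M (\<lambda>\<omega>. iexp (t \<bullet> X \<omega>))"
  by (rule integrable_const_bound[where B=1]) auto

text \<open>The Gaussian kernel is, up to a constant, its own Fourier transform, so averaging it over
  \<open>\<mu>\<close> only involves the characteristic function of \<open>\<mu>\<close>.\<close>

lemma gauss_smoothing_char: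
  fixes \<mu> :: "'a::euclidean_space measure"
  assumes "prob_space \<mu>" and [measurable_cong, simp]: "sets \<mu> = sets borel"
  shows "complex_of_real (sqrt (2 * pi) ^ DIM('a) * (\<integral>x. gauss_density (r *\<^sub>R (y - x)) \<partial>\<mu>)) =
    (\<integral>w. iexp (r *\<^sub>R w \<bullet> y) * (\<integral>x. iexp (- (r *\<^sub>R w) \<bullet> x) \<partial>\<mu>) \<partial>std_gauss)"
proof -
  interpret \<mu>: prob_space \<mu> by fact
  interpret G: prob_space "std_gauss :: 'a measure" by (rule prob_space_std_gauss)
  interpret P: pair_prob_space \<mu> "std_gauss :: 'a measure" ..
  have sp[simp]: "space \<mu> = UNIV" using sets_eq_imp_space_eq[of \<mu> borel] by simp
  have int: "integrable (\<mu> \<Otimes>\<^sub>M std_gauss) (\<lambda>(x, w). iexp (r *\<^sub>R w \<bullet> y) * iexp (- (r *\<^sub>R w) \<bullet> x))"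
    by (rule P.P.integrable_const_bound[where B=1]) (auto simp: norm_mult)
  have "complex_of_real (sqrt (2 * pi) ^ DIM('a) * (\<integral>x. gauss_density (r *\<^sub>R (y - x)) \<partial>\<mu>))
     = (\<integral>x. complex_of_real (sqrt (2 * pi) ^ DIM('a) * gauss_density (r *\<^sub>R (y - x))) \<partial>\<mu>)"
    by simp
  also have "\<dots> = (\<integral>x. (\<integral>w. iexp (r *\<^sub>R w \<bullet> y) * iexp (- (r *\<^sub>R w) \<bullet> x) \<partial>std_gauss) \<partial>\<mu>)"
  proof (rule Bochner_Integration.integral_cong[OF refl])
    fix x
    have "complex_of_real (sqrt (2 * pi) ^ DIM('a) * gauss_density (r *\<^sub>R (y - x)))
       = (\<integral>w. iexp (r *\<^sub>R (y - x) \<bullet> w) \<partial>std_gauss)"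
      by (subst char_std_gauss) (simp add: gauss_density_def)
    also have "\<dots> = (\<integral>w. iexp (r *\<^sub>R w \<bullet> y) * iexp (- (r *\<^sub>R w) \<bullet> x) \<partial>std_gauss)"
      by (intro Bochner_Integration.integral_cong refl)
        (simp add: exp_add[symmetric] algebra_simps inner_commute)
    finally show "complex_of_real (sqrt (2 * pi) ^ DIM('a) * gauss_density (r *\<^sub>R (y - x))) = \<dots>" .
  qed
  also have "\<dots> = (\<integral>w. (\<integral>x. iexp (r *\<^sub>R w \<bullet> y) * iexp (- (r *\<^sub>R w) \<bullet> x) \<partial>\<mu>) \<partial>std_gauss)"
    by (rule P.Fubini_integral[symmetric, OF int])
  also have "\<dots> = (\<integral>w. iexp (r *\<^sub>R w \<bullet> y) * (\<integral>x. iexp (- (r *\<^sub>R w) \<bullet> x) \<partial>\<mu>) \<partial>std_gauss)"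
    by (intro Bochner_Integration.integral_cong refl integral_mult_right_zero)
  finally show ?thesis .
qed

text \<open>The substitution y = x + \<sigma> z. On the right \<open>f\<close> no longer depends on
  x, so a later integration in x touches only the kernel.\<close>

lemma integral_gauss_shift:
  fixes f :: "'a::euclidean_space \<Rightarrow> real"
  assumes [measurable]: "f \<in> borel_measurable borel" and \<sigma>: "\<sigma> > 0"
  shows "(\<integral>z. f (x + \<sigma> *\<^sub>R z) \<partial>std_gauss) =
    (\<integral>y. f y * gauss_density ((1/\<sigma>) *\<^sub>R (y - x)) \<partial>lborel) / \<sigma> ^ DIM('a)"
proof -
  have "(\<integral>y. f y * gauss_density ((1/\<sigma>) *\<^sub>R (y - x)) \<partial>lborel) =
    (\<integral>y. f y * gauss_density ((1/\<sigma>) *\<^sub>R (y - x)) \<partial>density (distr lborel borel (\<lambda>z. x + \<sigma> *\<^sub>R z)) (\<lambda>_. ennreal (\<bar>\<sigma>\<bar> ^ DIM('a))))"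
    using lborel_affine[of \<sigma> x] \<sigma> by (simp add: ennreal_power)
  also have "\<dots> = \<sigma> ^ DIM('a) * (\<integral>z. f (x + \<sigma> *\<^sub>R z) * gauss_density z \<partial>lborel)"
    using \<sigma> by (subst integral_density) (simp_all add: integral_distr)
  also have "(\<integral>z. f (x + \<sigma> *\<^sub>R z) * gauss_density z \<partial>lborel) = (\<integral>z. f (x + \<sigma> *\<^sub>R z) \<partial>std_gauss)"
    by (subst integral_std_gauss) (simp_all add: mult.commute)
  finally show ?thesis using \<sigma> by simp
qed

text \<open>Fubini: the average over \<mu> falls on the kernel at a fixed point y, the quantity that
  \<open>gauss_smoothing_char\<close> expresses by the characteristic function.\<close>

lemma integral_gauss_smoothing:
  fixes \<mu> :: "'a::euclidean_space measure" and f :: "'a \<Rightarrow> real"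
  assumes "prob_space \<mu>" and [measurable_cong, simp]: "sets \<mu> = sets borel"
    and f: "integrable lborel f" and \<sigma>: "\<sigma> > 0"
  shows "(\<integral>x. (\<integral>z. f (x + \<sigma> *\<^sub>R z) \<partial>std_gauss) \<partial>\<mu>) =
    (\<integral>y. f y * (\<integral>x. gauss_density ((1/\<sigma>) *\<^sub>R (y - x)) \<partial>\<mu>) \<partial>lborel) / \<sigma> ^ DIM('a)"
proof -
  interpret \<mu>: prob_space \<mu> by fact
  interpret P: pair_sigma_finite lborel \<mu> ..
  have [measurable]: "f \<in> borel_measurable borel" using f by auto
  have int: "integrable (lborel \<Otimes>\<^sub>M \<mu>) (\<lambda>(y, x). f y * gauss_density ((1/\<sigma>) *\<^sub>R (y - x)))"
  proof (rule P.Fubini_integrable)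
    have i: "integrable \<mu> (\<lambda>x. gauss_density ((1/\<sigma>) *\<^sub>R (y - x)))" for y
      by (rule \<mu>.integrable_const_bound[where B=1]) (auto simp: gauss_density_nonneg gauss_density_le_1)
    show "AE y in lborel. integrable \<mu> (\<lambda>x. case (y, x) of (y, x) \<Rightarrow> f y * gauss_density ((1/\<sigma>) *\<^sub>R (y - x)))"
      using i by auto
    have *: "(\<integral>x. norm (f y * gauss_density ((1/\<sigma>) *\<^sub>R (y - x))) \<partial>\<mu>) = \<bar>f y\<bar> * (\<integral>x. gauss_density ((1/\<sigma>) *\<^sub>R (y - x)) \<partial>\<mu>)" for y
      by (simp add: abs_mult abs_of_nonneg[OF gauss_density_nonneg])
    have le: "0 \<le> (\<integral>x. gauss_density ((1/\<sigma>) *\<^sub>R (y - x)) \<partial>\<mu>)" "(\<integral>x. gauss_density ((1/\<sigma>) *\<^sub>R (y - x)) \<partial>\<mu>) \<le> 1" for y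
    proof -
      show "0 \<le> (\<integral>x. gauss_density ((1/\<sigma>) *\<^sub>R (y - x)) \<partial>\<mu>)" by (simp add: gauss_density_nonneg)
      have "(\<integral>x. gauss_density ((1/\<sigma>) *\<^sub>R (y - x)) \<partial>\<mu>) \<le> (\<integral>x. 1 \<partial>\<mu>)"
        by (rule integral_mono[OF i]) (auto simp: gauss_density_le_1)
      then show "(\<integral>x. gauss_density ((1/\<sigma>) *\<^sub>R (y - x)) \<partial>\<mu>) \<le> 1" by (simp add: \<mu>.prob_space)
    qed
    show "integrable lborel (\<lambda>y. \<integral>x. norm (case (y, x) of (y, x) \<Rightarrow> f y * gauss_density ((1/\<sigma>) *\<^sub>R (y - x))) \<partial>\<mu>)"
      unfolding prod.case *
      by (rule Bochner_Integration.integrable_bound[OF f]) (use le in \<open>auto simp: abs_mult intro!: mult_left_le\<close>)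
  qed measurable
  have "(\<integral>x. (\<integral>z. f (x + \<sigma> *\<^sub>R z) \<partial>std_gauss) \<partial>\<mu>) =
    (\<integral>x. (\<integral>y. f y * gauss_density ((1/\<sigma>) *\<^sub>R (y - x)) \<partial>lborel) \<partial>\<mu>) / \<sigma> ^ DIM('a)"
    using \<sigma> by (subst integral_gauss_shift) auto
  also have "\<dots> = (\<integral>y. (\<integral>x. f y * gauss_density ((1/\<sigma>) *\<^sub>R (y - x)) \<partial>\<mu>) \<partial>lborel) / \<sigma> ^ DIM('a)"
    using P.Fubini_integral[OF int] by simp
  finally show ?thesis by simp
qed

text \<open>Two dominated convergences. Characteristic functions are bounded by 1, so the smoothed
  densities converge at every point; these are bounded as well, so the absolute value of
  \<open>f\<close> dominates their product with \<open>f\<close>.\<close>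

lemma tendsto_gauss_smoothing:
  fixes \<mu> :: "nat \<Rightarrow> 'a::euclidean_space measure" and f :: "'a \<Rightarrow> real"
  assumes p: "\<And>n. prob_space (\<mu> n)" "prob_space \<nu>"
    and s [measurable_cong, simp]: "\<And>n. sets (\<mu> n) = sets borel" "sets \<nu> = sets borel"
    and char: "\<And>t. (\<lambda>n. \<integral>x. iexp (t \<bullet> x) \<partial>\<mu> n) \<longlonglongrightarrow> (\<integral>x. iexp (t \<bullet> x) \<partial>\<nu>)"
    and f: "integrable lborel f" and \<sigma>: "\<sigma> > 0"
  shows "(\<lambda>n. \<integral>x. (\<integral>z. f (x + \<sigma> *\<^sub>R z) \<partial>std_gauss) \<partial>\<mu> n) \<longlonglongrightarrow> (\<integral>x. (\<integral>z. f (x + \<sigma> *\<^sub>R z) \<partial>std_gauss) \<partial>\<nu>)"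
proof -
  interpret G: prob_space "std_gauss :: 'a measure" by (rule prob_space_std_gauss)
  interpret \<nu>: prob_space \<nu> by (rule p)
  have [measurable]: "f \<in> borel_measurable borel" using f by auto
  have le1: "norm (\<integral>x. iexp (t \<bullet> x) \<partial>m) \<le> 1" if "prob_space m" "sets m = sets borel" for m and t :: 'a
  proof -
    interpret m: prob_space m by fact
    have "norm (\<integral>x. iexp (t \<bullet> x) \<partial>m) \<le> (\<integral>x. norm (iexp (t \<bullet> x)) \<partial>m)" by (rule integral_norm_bound)
    then show ?thesis by (simp add: m.prob_space)
  qed
  have K: "(\<lambda>n. \<integral>x. gauss_density ((1/\<sigma>) *\<^sub>R (y - x)) \<partial>\<mu> n) \<longlonglongrightarrow> (\<integral>x. gauss_density ((1/\<sigma>) *\<^sub>R (y - x)) \<partial>\<nu>)" for y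
  proof -
    let ?c = "sqrt (2 * pi) ^ DIM('a)"
    have "(\<lambda>n. \<integral>w. iexp ((1/\<sigma>) *\<^sub>R w \<bullet> y) * (\<integral>x. iexp (- ((1/\<sigma>) *\<^sub>R w) \<bullet> x) \<partial>\<mu> n) \<partial>std_gauss)
      \<longlonglongrightarrow> (\<integral>w. iexp ((1/\<sigma>) *\<^sub>R w \<bullet> y) * (\<integral>x. iexp (- ((1/\<sigma>) *\<^sub>R w) \<bullet> x) \<partial>\<nu>) \<partial>std_gauss)"
    proof (rule integral_dominated_convergence[where w="\<lambda>_. 1"])
      show "(\<lambda>w. iexp ((1/\<sigma>) *\<^sub>R w \<bullet> y) * (\<integral>x. iexp (- ((1/\<sigma>) *\<^sub>R w) \<bullet> x) \<partial>\<nu>)) \<in> borel_measurable std_gauss"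
        by (intro borel_measurable_times \<nu>.borel_measurable_lebesgue_integral) measurable
      show "(\<lambda>w. iexp ((1/\<sigma>) *\<^sub>R w \<bullet> y) * (\<integral>x. iexp (- ((1/\<sigma>) *\<^sub>R w) \<bullet> x) \<partial>\<mu> n)) \<in> borel_measurable std_gauss" for n
      proof -
        interpret m: prob_space "\<mu> n" by (rule p)
        show ?thesis
        by (intro borel_measurable_times m.borel_measurable_lebesgue_integral) measurable
      qed
      show "AE w in std_gauss. (\<lambda>n. iexp ((1/\<sigma>) *\<^sub>R w \<bullet> y) * (\<integral>x. iexp (- ((1/\<sigma>) *\<^sub>R w) \<bullet> x) \<partial>\<mu> n))
        \<longlonglongrightarrow> iexp ((1/\<sigma>) *\<^sub>R w \<bullet> y) * (\<integral>x. iexp (- ((1/\<sigma>) *\<^sub>R w) \<bullet> x) \<partial>\<nu>)"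
        by (intro AE_I2 tendsto_mult tendsto_const char)
      show "AE w in std_gauss. norm (iexp ((1/\<sigma>) *\<^sub>R w \<bullet> y) * (\<integral>x. iexp (- ((1/\<sigma>) *\<^sub>R w) \<bullet> x) \<partial>\<mu> n)) \<le> 1" for n
        unfolding norm_mult norm_iexp mult_1_left by (intro AE_I2 le1 p s)
    qed simp
    then have "(\<lambda>n. complex_of_real (?c * (\<integral>x. gauss_density ((1/\<sigma>) *\<^sub>R (y - x)) \<partial>\<mu> n))) \<longlonglongrightarrow>
      complex_of_real (?c * (\<integral>x. gauss_density ((1/\<sigma>) *\<^sub>R (y - x)) \<partial>\<nu>))"
      by (simp only: gauss_smoothing_char[OF p(1) s(1)] gauss_smoothing_char[OF p(2) s(2)])
    then have "(\<lambda>n. ?c * (\<integral>x. gauss_density ((1/\<sigma>) *\<^sub>R (y - x)) \<partial>\<mu> n)) \<longlonglongrightarrow>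
      ?c * (\<integral>x. gauss_density ((1/\<sigma>) *\<^sub>R (y - x)) \<partial>\<nu>)" by (simp only: tendsto_of_real_iff)
    then show ?thesis by (subst (asm) tendsto_mult_left_iff) auto
  qed
  have le: "norm (\<integral>x. gauss_density ((1/\<sigma>) *\<^sub>R (y - x)) \<partial>m) \<le> 1" if "prob_space m" "sets m = sets borel" for m and y :: 'a
  proof -
    interpret m: prob_space m by fact
    have [measurable_cong]: "sets m = sets borel" by fact
    have "norm (\<integral>x. gauss_density ((1/\<sigma>) *\<^sub>R (y - x)) \<partial>m) \<le> (\<integral>x. norm (gauss_density ((1/\<sigma>) *\<^sub>R (y - x))) \<partial>m)" by (rule integral_norm_bound)
    also have "\<dots> \<le> (\<integral>x. 1 \<partial>m)"
      by (intro integral_mono m.integrable_const_bound[where B=1]) (auto simp: gauss_density_nonneg gauss_density_le_1)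
    finally show ?thesis by (simp add: m.prob_space)
  qed
  have "(\<lambda>n. \<integral>y. f y * (\<integral>x. gauss_density ((1/\<sigma>) *\<^sub>R (y - x)) \<partial>\<mu> n) \<partial>lborel)
     \<longlonglongrightarrow> (\<integral>y. f y * (\<integral>x. gauss_density ((1/\<sigma>) *\<^sub>R (y - x)) \<partial>\<nu>) \<partial>lborel)"
  proof (rule integral_dominated_convergence[where w="\<lambda>y. \<bar>f y\<bar>"])
    show "(\<lambda>y. f y * (\<integral>x. gauss_density ((1/\<sigma>) *\<^sub>R (y - x)) \<partial>\<nu>)) \<in> borel_measurable lborel"
      by (intro borel_measurable_times \<nu>.borel_measurable_lebesgue_integral) measurable
    show "(\<lambda>y. f y * (\<integral>x. gauss_density ((1/\<sigma>) *\<^sub>R (y - x)) \<partial>\<mu> n)) \<in> borel_measurable lborel" for n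
    proof -
      interpret m: prob_space "\<mu> n" by (rule p)
      show ?thesis
      by (intro borel_measurable_times m.borel_measurable_lebesgue_integral) measurable
    qed
    show "integrable lborel (\<lambda>y. \<bar>f y\<bar>)" using f by simp
    show "AE y in lborel. norm (f y * (\<integral>x. gauss_density ((1/\<sigma>) *\<^sub>R (y - x)) \<partial>\<mu> n)) \<le> \<bar>f y\<bar>" for n
      unfolding norm_mult using le[OF p(1) s(1)] by (intro AE_I2) (auto intro!: mult_left_le)
  qed (intro AE_I2 tendsto_mult tendsto_const K)
  then show ?thesis
    unfolding integral_gauss_smoothing[OF p(1) s(1) f \<sigma>] integral_gauss_smoothing[OF p(2) s(2) f \<sigma>]
    using \<sigma> by (intro tendsto_divide tendsto_const) auto
qed


section \<open>From smoothed to bounded continuous test functions\<close>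

lemma (in prob_space) prob_norm_tail_small:
  fixes X :: "'a \<Rightarrow> 'b::euclidean_space"
  assumes [measurable]: "X \<in> borel_measurable M" and e: "e > 0"
  shows "\<exists>K>0. prob {\<omega>\<in>space M. K < norm (X \<omega>)} < e"
proof -
  have "(\<lambda>k::nat. prob {\<omega>\<in>space M. real k < norm (X \<omega>)}) \<longlonglongrightarrow> prob (\<Inter>k::nat. {\<omega>\<in>space M. real k < norm (X \<omega>)})"
    by (rule finite_Lim_measure_decseq) (auto simp: decseq_def)
  moreover have "(\<Inter>k::nat. {\<omega>\<in>space M. real k < norm (X \<omega>)}) = {}"
    using real_arch_simple by (auto simp: not_less) (meson not_le real_arch_simple)
  ultimately have "(\<lambda>k::nat. prob {\<omega>\<in>space M. real k < norm (X \<omega>)}) \<longlonglongrightarrow> 0" by simp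
  from order_tendstoD(2)[OF this e] obtain k :: nat where k: "prob {\<omega>\<in>space M. real k < norm (X \<omega>)} < e"
    by (auto simp: eventually_sequentially)
  \<comment> \<open>\<open>Suc k\<close> in place of \<open>k\<close> guarantees a positive
    threshold.\<close>
  have "prob {\<omega>\<in>space M. real (Suc k) < norm (X \<omega>)} \<le> prob {\<omega>\<in>space M. real k < norm (X \<omega>)}"
    by (intro finite_measure_mono) auto
  with k show ?thesis by (intro exI[of _ "real (Suc k)"]) auto
qed

lemma gauss_smoothing_approx:
  fixes f :: "'a::euclidean_space \<Rightarrow> real"
  assumes uc: "uniformly_continuous_on UNIV f" and B: "\<And>x. \<bar>f x\<bar> \<le> B" and e: "e > 0"
  shows "\<exists>\<sigma>>0. \<forall>x. \<bar>(\<integral>z. f (x + \<sigma> *\<^sub>R z) \<partial>std_gauss) - f x\<bar> \<le> e"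
proof -
  interpret G: prob_space "std_gauss :: 'a measure" by (rule prob_space_std_gauss)
  have B0: "0 \<le> B" using B[of undefined] by linarith
  have [measurable]: "f \<in> borel_measurable borel"
    using uniformly_continuous_imp_continuous[OF uc] by (rule borel_measurable_continuous_onI)
  obtain \<delta> where \<delta>: "\<delta> > 0" "\<And>x y. dist x y < \<delta> \<Longrightarrow> dist (f x) (f y) < e / 2"
    using uc e unfolding uniformly_continuous_on_def by (metis UNIV_I half_gt_zero)
  \<comment> \<open>The tail is paid for with \<open>2 * B\<close>, the largest possible oscillation
    of \<open>f\<close>; the \<open>+ 1\<close> avoids a division by 0 when \<open>B\<close> is
    0.\<close>
  obtain K where K: "K > 0" "G.prob {z. K < norm z} < e / 2 / (2 * B + 1)"
    using G.prob_norm_tail_small[of "\<lambda>z. z" "e / 2 / (2 * B + 1)"] e B0 by auto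
  \<comment> \<open>With this width, a Gaussian vector of norm at most \<open>K\<close> moves the
    argument by at most \<delta>/2.\<close>
  define \<sigma> where "\<sigma> = \<delta> / (2 * K)"
  have \<sigma>: "\<sigma> > 0" using \<delta> K by (simp add: \<sigma>_def)
  have "\<bar>(\<integral>z. f (x + \<sigma> *\<^sub>R z) \<partial>std_gauss) - f x\<bar> \<le> e" for x
  proof -
    have i: "integrable std_gauss (\<lambda>z. f (x + \<sigma> *\<^sub>R z))"
      by (rule G.integrable_const_bound[where B=B]) (use B in auto)
    have i2: "integrable std_gauss (\<lambda>z::'a. e / 2 + 2 * B * indicator {z. K < norm z} z)"
      by (rule G.integrable_const_bound[where B="e/2 + 2 * B"]) (use e B0 in \<open>auto split: split_indicator\<close>)
    have "(\<integral>z. f (x + \<sigma> *\<^sub>R z) \<partial>std_gauss) - f x = (\<integral>z. f (x + \<sigma> *\<^sub>R z) - f x \<partial>std_gauss)"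
      using i G.prob_space by (simp del: space_std_gauss)
    then have "\<bar>(\<integral>z. f (x + \<sigma> *\<^sub>R z) \<partial>std_gauss) - f x\<bar> \<le> (\<integral>z. \<bar>f (x + \<sigma> *\<^sub>R z) - f x\<bar> \<partial>std_gauss)"
      using integral_abs_bound by metis
    also have "\<dots> \<le> (\<integral>z. e / 2 + 2 * B * indicator {z. K < norm z} z \<partial>(std_gauss :: 'a measure))"
    proof (rule integral_mono)
      show "integrable std_gauss (\<lambda>z. \<bar>f (x + \<sigma> *\<^sub>R z) - f x\<bar>)" using i by auto
      fix z :: 'a
      show "\<bar>f (x + \<sigma> *\<^sub>R z) - f x\<bar> \<le> e / 2 + 2 * B * indicator {z. K < norm z} z"
      proof (cases "K < norm z")
        case True
        then show ?thesis using B[of "x + \<sigma> *\<^sub>R z"] B[of x] e by (simp add: abs_le_iff)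
      next
        case False
        have "\<sigma> * norm z \<le> \<sigma> * K" using False \<sigma> by (intro mult_left_mono) auto
        also have "\<dots> = \<delta> / 2" using K by (simp add: \<sigma>_def)
        finally have "dist (x + \<sigma> *\<^sub>R z) x < \<delta>" using \<sigma> \<delta>(1) by (simp add: dist_norm)
        from \<delta>(2)[OF this] show ?thesis using False by (simp add: dist_real_def)
      qed
    qed (rule i2)
    also have "\<dots> = e / 2 + 2 * B * G.prob {z::'a. K < norm z}"
    proof -
      have "{z. K < norm z} \<in> sets (std_gauss :: 'a measure)" by measurable
      then have "integrable std_gauss (indicator {z::'a. K < norm z} :: _ \<Rightarrow> real)"
        by (intro integrable_real_indicator) (auto simp: less_top[symmetric])
      then show ?thesis using G.prob_space by (subst Bochner_Integration.integral_add) (auto simp del: space_std_gauss)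
    qed
    also have "\<dots> \<le> e / 2 + (2 * B + 1) * (e / 2 / (2 * B + 1))"
      using K(2) B0 measure_nonneg[of std_gauss "{z::'a. K < norm z}"] by (intro add_left_mono mult_mono) auto
    also have "\<dots> = e" using B0 by (simp add: field_simps)
    finally show ?thesis .
  qed
  with \<sigma> show ?thesis by blast
qed

lemma continuous_vanishing_uniformly_continuous:
  fixes f :: "'a::euclidean_space \<Rightarrow> real"
  assumes c: "continuous_on UNIV f" and z: "\<And>x. norm x \<ge> R \<Longrightarrow> f x = 0"
  shows "uniformly_continuous_on UNIV f"
  unfolding uniformly_continuous_on_def
proof (intro allI impI)
  fix e :: real assume e: "e > 0"
  have "uniformly_continuous_on (cball 0 (R + 1)) f"
    by (intro compact_uniformly_continuous continuous_on_subset[OF c]) auto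
  then obtain d where d: "d > 0" "\<And>x y. x \<in> cball 0 (R+1) \<Longrightarrow> y \<in> cball 0 (R+1) \<Longrightarrow> dist y x < d \<Longrightarrow> dist (f y) (f x) < e"
    using e unfolding uniformly_continuous_on_def by metis
  show "\<exists>d>0. \<forall>x\<in>UNIV. \<forall>y\<in>UNIV. dist y x < d \<longrightarrow> dist (f y) (f x) < e"
  \<comment> \<open>The cap 1 puts both points into the ball of radius R + 1 as soon as one of them
    lies in the ball of radius R.\<close>
  proof (intro exI[of _ "min d 1"] conjI ballI impI)
    fix x y :: 'a assume xy: "dist y x < min d 1"
    have tri: "norm x \<le> norm y + dist y x" "norm y \<le> norm x + dist y x"
      by (metis dist_norm norm_triangle_sub dist_commute add.commute)+
    show "dist (f y) (f x) < e"
    proof (cases "norm x \<le> R \<or> norm y \<le> R")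
      case True
      then show ?thesis using tri xy by (intro d(2)) auto
    next
      case False then show ?thesis using z e by auto
    qed
  qed (use d in auto)
qed

text \<open>Such an \<open>f\<close> is integrable, bounded and uniformly continuous, so its
  smoothing is uniformly close to it and \<open>tendsto_gauss_smoothing\<close> applies. The two
  smoothing errors and the convergence take e/4 each.\<close>

lemma levy_continuity_compact_support:
  fixes \<mu> :: "nat \<Rightarrow> 'a::euclidean_space measure" and f :: "'a \<Rightarrow> real"
  assumes p: "\<And>n. prob_space (\<mu> n)" "prob_space \<nu>"
    and s [measurable_cong, simp]: "\<And>n. sets (\<mu> n) = sets borel" "sets \<nu> = sets borel"
    and char: "\<And>t. (\<lambda>n. \<integral>x. iexp (t \<bullet> x) \<partial>\<mu> n) \<longlonglongrightarrow> (\<integral>x. iexp (t \<bullet> x) \<partial>\<nu>)"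
    and c: "continuous_on UNIV f" and z: "\<And>x. norm x \<ge> R \<Longrightarrow> f x = 0"
  shows "(\<lambda>n. \<integral>x. f x \<partial>\<mu> n) \<longlonglongrightarrow> (\<integral>x. f x \<partial>\<nu>)"
proof (rule LIMSEQ_I)
  fix e :: real assume e: "e > 0"
  have [measurable]: "f \<in> borel_measurable borel" using c by (rule borel_measurable_continuous_onI)
  have "bounded (f ` cball 0 R)"
    by (intro compact_imp_bounded compact_continuous_image continuous_on_subset[OF c]) auto
  then obtain B where B': "\<And>x. x \<in> cball 0 R \<Longrightarrow> \<bar>f x\<bar> \<le> B" unfolding bounded_iff real_norm_def by blast
  have B: "\<bar>f x\<bar> \<le> max B 0" for x
    using B'[of x] z[of x] by (cases "norm x \<le> R") auto
  have "integrable lborel (\<lambda>x. indicator (cball 0 R) x *\<^sub>R f x)"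
    using borel_integrable_compact[of "cball 0 R" f] continuous_on_subset[OF c] by auto
  moreover have "(\<lambda>x. indicator (cball 0 R) x *\<^sub>R f x) = f"
    using z by (force split: split_indicator)
  ultimately have f: "integrable lborel f" by simp
  have "uniformly_continuous_on UNIV f" by (rule continuous_vanishing_uniformly_continuous[OF c z])
  from gauss_smoothing_approx[OF this B, of "e/4"] e
  obtain \<sigma> where \<sigma>: "\<sigma> > 0" "\<And>x. \<bar>(\<integral>z. f (x + \<sigma> *\<^sub>R z) \<partial>std_gauss) - f x\<bar> \<le> e / 4"
    by auto
  let ?g = "\<lambda>x. (\<integral>z. f (x + \<sigma> *\<^sub>R z) \<partial>std_gauss)"
  \<comment> \<open>The smoothing error is the same for every probability measure, hence serves for
    all \<open>\<mu> n\<close> and for \<nu>.\<close>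
  have cl: "\<bar>(\<integral>x. ?g x \<partial>m) - (\<integral>x. f x \<partial>m)\<bar> \<le> e / 4" if "prob_space m" and [measurable_cong]: "sets m = sets borel" for m
  proof -
    interpret m: prob_space m by fact
    interpret G: prob_space "std_gauss :: 'a measure" by (rule prob_space_std_gauss)
    have i: "integrable m f" by (rule m.integrable_const_bound[where B="max B 0"]) (use B in auto)
    have mg: "?g \<in> borel_measurable m"
      by (rule G.borel_measurable_lebesgue_integral) measurable
    have "\<bar>?g x\<bar> \<le> e / 4 + max B 0" for x using \<sigma>(2)[of x] B[of x] by linarith
    then have ig: "integrable m ?g" by (intro m.integrable_const_bound[where B="e/4 + max B 0"] mg) auto
    have "\<bar>(\<integral>x. ?g x \<partial>m) - (\<integral>x. f x \<partial>m)\<bar> = \<bar>\<integral>x. ?g x - f x \<partial>m\<bar>" using i ig by simp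
    also have "\<dots> \<le> (\<integral>x. \<bar>?g x - f x\<bar> \<partial>m)" by (rule integral_abs_bound)
    also have "\<dots> \<le> (\<integral>x. e / 4 \<partial>m)" using i ig \<sigma> by (intro integral_mono) auto
    finally show ?thesis by (simp add: m.prob_space)
  qed
  obtain N where N: "\<And>n. n \<ge> N \<Longrightarrow> \<bar>(\<integral>x. ?g x \<partial>\<mu> n) - (\<integral>x. ?g x \<partial>\<nu>)\<bar> < e / 4"
    using LIMSEQ_D[OF tendsto_gauss_smoothing[OF p s char f \<sigma>(1)], of "e/4"] e by auto
  have "norm ((\<integral>x. f x \<partial>\<mu> n) - (\<integral>x. f x \<partial>\<nu>)) < e" if "n \<ge> N" for n
    using N[OF that] cl[OF p(1) s(1), of n] cl[OF p(2) s(2)] e unfolding real_norm_def by linarith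
  then show "\<exists>no. \<forall>n\<ge>no. norm ((\<integral>x. f x \<partial>\<mu> n) - (\<integral>x. f x \<partial>\<nu>)) < e" by blast
qed

text \<open>Tightness is derived on the way: the cut-off \<open>\<kappa>\<close> is itself a
  compactly supported test function, so the convergence of its integrals transfers the small tail of
  \<nu> to the measures \<open>\<mu> n\<close>.\<close>

theorem levy_continuity_euclidean:
  fixes \<mu> :: "nat \<Rightarrow> 'a::euclidean_space measure"
  assumes p: "\<And>n. prob_space (\<mu> n)" "prob_space \<nu>"
    and s [measurable_cong, simp]: "\<And>n. sets (\<mu> n) = sets borel" "sets \<nu> = sets borel"
    and char: "\<And>t. (\<lambda>n. \<integral>x. iexp (t \<bullet> x) \<partial>\<mu> n) \<longlonglongrightarrow> (\<integral>x. iexp (t \<bullet> x) \<partial>\<nu>)"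
  shows "weakly_converges \<mu> \<nu>"
  unfolding weakly_converges_def
proof (intro allI impI, elim conjE)
  fix f :: "'a \<Rightarrow> real" assume c: "continuous_on UNIV f" and b: "bounded (range f)"
  interpret \<nu>: prob_space \<nu> by (rule p)
  have sp[simp]: "space \<nu> = UNIV" using sets_eq_imp_space_eq[OF s(2)] by simp
  have [measurable]: "f \<in> borel_measurable borel" using c by (rule borel_measurable_continuous_onI)
  obtain B where B: "B > 0" "\<And>x. \<bar>f x\<bar> \<le> B" using b unfolding bounded_pos by auto
  show "(\<lambda>n. \<integral>x. f x \<partial>\<mu> n) \<longlonglongrightarrow> (\<integral>x. f x \<partial>\<nu>)"
  proof (rule LIMSEQ_I)
    fix e :: real assume e: "e > 0"
    \<comment> \<open>Error budget in units of e/5: one for the tail of \<nu>, two for the tail of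
      \<open>\<mu> n\<close>, one for the truncated function.\<close>
    obtain K where K: "K > 0" "\<nu>.prob {x. K < norm x} < e / (5 * B)"
      using \<nu>.prob_norm_tail_small[of "\<lambda>x. x" "e / (5 * B)"] e B(1) by auto
    define \<kappa> :: "'a \<Rightarrow> real" where "\<kappa> x = max 0 (min 1 (K + 1 - norm x))" for x
    have \<kappa>: "0 \<le> \<kappa> x" "\<kappa> x \<le> 1" for x by (auto simp: \<kappa>_def)
    have \<kappa>c: "continuous_on UNIV \<kappa>" unfolding \<kappa>_def by (intro continuous_intros)
    then have [measurable]: "\<kappa> \<in> borel_measurable borel" by (rule borel_measurable_continuous_onI)
    have \<kappa>z: "norm x \<ge> K + 1 \<Longrightarrow> \<kappa> x = 0" for x by (auto simp: \<kappa>_def)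
    have cut: "\<bar>(\<integral>x. f x \<partial>m) - (\<integral>x. f x * \<kappa> x \<partial>m)\<bar> \<le> B * (1 - (\<integral>x. \<kappa> x \<partial>m)) \<and> integrable m \<kappa>"
      if "prob_space m" and [measurable_cong]: "sets m = sets borel" for m
    proof -
      interpret m: prob_space m by fact
      have i: "integrable m f" by (rule m.integrable_const_bound[where B=B]) (use B in auto)
      have i2: "integrable m \<kappa>" by (rule m.integrable_const_bound[where B=1]) (use \<kappa> in auto)
      have i3: "integrable m (\<lambda>x. f x * \<kappa> x)"
        by (rule m.integrable_const_bound[where B=B])
          (use \<kappa> B in \<open>auto simp: abs_mult intro!: mult_left_le order_trans[OF mult_left_le]\<close>)
      have "\<bar>(\<integral>x. f x \<partial>m) - (\<integral>x. f x * \<kappa> x \<partial>m)\<bar> = \<bar>\<integral>x. f x - f x * \<kappa> x \<partial>m\<bar>" using i i3 by simp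
      also have "\<dots> \<le> (\<integral>x. \<bar>f x - f x * \<kappa> x\<bar> \<partial>m)" by (rule integral_abs_bound)
      also have "\<dots> \<le> (\<integral>x. B * (1 - \<kappa> x) \<partial>m)"
      proof (rule integral_mono)
        fix x
        have "f x - f x * \<kappa> x = f x * (1 - \<kappa> x)" by (simp add: algebra_simps)
        then have "\<bar>f x - f x * \<kappa> x\<bar> = \<bar>f x\<bar> * (1 - \<kappa> x)" using \<kappa>[of x] by (simp add: abs_mult)
        also have "\<dots> \<le> B * (1 - \<kappa> x)" using \<kappa>[of x] B(2) by (intro mult_right_mono) auto
        finally show "\<bar>f x - f x * \<kappa> x\<bar> \<le> B * (1 - \<kappa> x)" .
      qed (use i i2 i3 in auto)
      also have "\<dots> = B * (1 - (\<integral>x. \<kappa> x \<partial>m))" using i2 by (simp add: m.prob_space)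
      finally show ?thesis using i2 by blast
    qed
    have "1 - \<nu>.prob {x. K < norm x} = (\<integral>x. 1 - indicator {x. K < norm x} x \<partial>\<nu>)"
    proof -
      have "integrable \<nu> (indicator {x. K < norm x} :: _ \<Rightarrow> real)"
        by (rule \<nu>.integrable_const_bound[where B=1]) (auto split: split_indicator)
      then show ?thesis
        by (subst Bochner_Integration.integral_diff) (auto simp: \<nu>.prob_space simp del: sp)
    qed
    also have "\<dots> \<le> (\<integral>x. \<kappa> x \<partial>\<nu>)"
    proof (rule integral_mono)
      show "integrable \<nu> (\<lambda>x. 1 - indicator {x. K < norm x} x :: real)"
        by (rule \<nu>.integrable_const_bound[where B=1]) (auto split: split_indicator)
      show "integrable \<nu> \<kappa>" using cut[OF p(2) s(2)] by blast
    qed (auto simp: \<kappa>_def split: split_indicator)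
    finally have tail: "1 - (\<integral>x. \<kappa> x \<partial>\<nu>) < e / (5 * B)" using K by linarith
    have "(\<lambda>n. \<integral>x. \<kappa> x \<partial>\<mu> n) \<longlonglongrightarrow> (\<integral>x. \<kappa> x \<partial>\<nu>)"
      by (rule levy_continuity_compact_support[OF p s char \<kappa>c \<kappa>z])
    from LIMSEQ_D[OF this, of "e / (5 * B)"] obtain N1
      where N1: "\<And>n. n \<ge> N1 \<Longrightarrow> \<bar>(\<integral>x. \<kappa> x \<partial>\<mu> n) - (\<integral>x. \<kappa> x \<partial>\<nu>)\<bar> < e / (5 * B)"
      using e B by auto
    have "(\<lambda>n. \<integral>x. f x * \<kappa> x \<partial>\<mu> n) \<longlonglongrightarrow> (\<integral>x. f x * \<kappa> x \<partial>\<nu>)"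
      by (rule levy_continuity_compact_support[OF p s char, where R="K + 1"])
        (use \<kappa>z c \<kappa>c in \<open>auto intro!: continuous_intros\<close>)
    from LIMSEQ_D[OF this, of "e / 5"] obtain N2
      where N2: "\<And>n. n \<ge> N2 \<Longrightarrow> \<bar>(\<integral>x. f x * \<kappa> x \<partial>\<mu> n) - (\<integral>x. f x * \<kappa> x \<partial>\<nu>)\<bar> < e / 5"
      using e by auto
    have "norm ((\<integral>x. f x \<partial>\<mu> n) - (\<integral>x. f x \<partial>\<nu>)) < e" if n: "n \<ge> max N1 N2" for n
    proof -
      have a: "B * (1 - (\<integral>x. \<kappa> x \<partial>\<nu>)) \<le> B * (e / (5 * B))"
        using tail B by (intro mult_left_mono) auto
      have "1 - (\<integral>x. \<kappa> x \<partial>\<mu> n) \<le> 2 * (e / (5 * B))" using tail N1[of n] n by auto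
      then have b: "B * (1 - (\<integral>x. \<kappa> x \<partial>\<mu> n)) \<le> B * (2 * (e / (5 * B)))"
        using B by (intro mult_left_mono) auto
      have "B * (e / (5 * B)) = e / 5" "B * (2 * (e / (5 * B))) = 2 * e / 5" using B by auto
      then show ?thesis
        using a b cut[OF p(2) s(2)] cut[OF p(1) s(1), of n] N2[of n] n e unfolding real_norm_def by linarith
    qed
    then show "\<exists>no. \<forall>n\<ge>no. norm ((\<integral>x. f x \<partial>\<mu> n) - (\<integral>x. f x \<partial>\<nu>)) < e" by blast
  qed
qed

section \<open>Linear change of variables for Lebesgue measure\<close>

lemma nn_integral_lborel_shear:
  fixes g :: "'a::euclidean_space \<Rightarrow> ennreal"
  assumes [measurable]: "g \<in> borel_measurable borel" and b: "b \<in> Basis" "c \<in> Basis" "b \<noteq> c"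
  shows "(\<integral>\<^sup>+x. g (x + (x \<bullet> c) *\<^sub>R b) \<partial>lborel) = (\<integral>\<^sup>+x. g x \<partial>lborel)"
proof -
  interpret P: product_sigma_finite "\<lambda>b::'a. lborel :: real measure"
    by (simp add: product_sigma_finite_def sigma_finite_lborel)
  let ?I = "Basis - {b}" and ?S = "\<lambda>f. (\<Sum>b\<in>Basis. f b *\<^sub>R b) :: 'a"
  have I: "insert b ?I = Basis" using b by auto
  have split: "?S (x(b := y)) = (\<Sum>j\<in>?I. x j *\<^sub>R j) + y *\<^sub>R b" for x y
  proof -
    have "?S (x(b := y)) = y *\<^sub>R b + (\<Sum>j\<in>?I. (x(b := y)) j *\<^sub>R j)"
      using b by (subst sum.remove[of _ b]) auto
    also have "(\<Sum>j\<in>?I. (x(b := y)) j *\<^sub>R j) = (\<Sum>j\<in>?I. x j *\<^sub>R j)" by (rule sum.cong) auto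
    finally show ?thesis by simp
  qed
  have coord: "?S f \<bullet> c = f c" for f using b by (simp add: inner_sum_left_Basis)
  \<comment> \<open>The coordinate along b is integrated innermost: with the others fixed, the shear
    only translates it by the constant x c.\<close>
  have lhs: "(\<integral>\<^sup>+x. h x \<partial>lborel) = (\<integral>\<^sup>+x. (\<integral>\<^sup>+y. h ((\<Sum>j\<in>?I. x j *\<^sub>R j) + y *\<^sub>R b) \<partial>lborel) \<partial>Pi\<^sub>M ?I (\<lambda>_. lborel))"
    if [measurable]: "h \<in> borel_measurable borel" for h :: "'a \<Rightarrow> ennreal"
  proof -
    have "(\<integral>\<^sup>+x. h x \<partial>lborel) = (\<integral>\<^sup>+f. h (?S f) \<partial>Pi\<^sub>M Basis (\<lambda>_. lborel))"
      by (subst lborel_eq, subst nn_integral_distr) auto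
    also have "\<dots> = (\<integral>\<^sup>+f. h (?S f) \<partial>Pi\<^sub>M (insert b ?I) (\<lambda>_. lborel))"
      by (simp only: I)
    also have "\<dots> = (\<integral>\<^sup>+x. (\<integral>\<^sup>+y. h (?S (x(b := y))) \<partial>lborel) \<partial>Pi\<^sub>M ?I (\<lambda>_. lborel))"
      by (rule P.product_nn_integral_insert) (unfold I, auto)
    finally show ?thesis by (simp only: split)
  qed
  have "(\<integral>\<^sup>+y. g (((\<Sum>j\<in>?I. x j *\<^sub>R j) + y *\<^sub>R b) + (((\<Sum>j\<in>?I. x j *\<^sub>R j) + y *\<^sub>R b) \<bullet> c) *\<^sub>R b) \<partial>lborel)
      = (\<integral>\<^sup>+y. g ((\<Sum>j\<in>?I. x j *\<^sub>R j) + y *\<^sub>R b) \<partial>lborel)" for x :: "'a \<Rightarrow> real"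
  proof -
    have "((\<Sum>j\<in>?I. x j *\<^sub>R j) + y *\<^sub>R b) \<bullet> c = x c" for y
      using coord[of "x(b := y)"] b unfolding split by simp
    then have "(\<integral>\<^sup>+y. g (((\<Sum>j\<in>?I. x j *\<^sub>R j) + y *\<^sub>R b) + (((\<Sum>j\<in>?I. x j *\<^sub>R j) + y *\<^sub>R b) \<bullet> c) *\<^sub>R b) \<partial>lborel)
      = (\<integral>\<^sup>+y. g ((\<Sum>j\<in>?I. x j *\<^sub>R j) + (x c + 1 * y) *\<^sub>R b) \<partial>lborel)"
      by (simp add: algebra_simps)
    also have "\<dots> = (\<integral>\<^sup>+y. g ((\<Sum>j\<in>?I. x j *\<^sub>R j) + y *\<^sub>R b) \<partial>lborel)"
      using nn_integral_real_affine[of "\<lambda>y. g ((\<Sum>j\<in>?I. x j *\<^sub>R j) + y *\<^sub>R b)" 1 "x c"] by simp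
    finally show ?thesis .
  qed
  then show ?thesis by (subst (1 2) lhs) auto
qed

lemma borel_measurable_linear [measurable (raw)]:
  fixes f :: "'a::euclidean_space \<Rightarrow> 'b::real_normed_vector"
  assumes "linear f"
  shows "f \<in> borel_measurable borel"
  by (intro borel_measurable_continuous_onI linear_continuous_on linear_conv_bounded_linear[THEN iffD1] assms)

text \<open>Induction over elementary linear maps: diagonal maps scale the coordinates, swaps
  permute the sides of boxes, shears translate one coordinate, and composition multiplies
  determinants.\<close>

lemma nn_integral_lborel_linear:
  fixes f :: "real^'d \<Rightarrow> real^'d" and g :: "real^'d \<Rightarrow> ennreal"
  assumes lin: "linear f" and "det (matrix f) \<noteq> 0" and "g \<in> borel_measurable borel"
  shows "(\<integral>\<^sup>+x. g x \<partial>lborel) = ennreal \<bar>det (matrix f)\<bar> * (\<integral>\<^sup>+x. g (f x) \<partial>lborel)"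
proof -
  \<comment> \<open>The implication makes singular elementary factors harmless, and a nonzero
    product passes nonsingularity on to both factors. The test function is quantified inside because
    composition applies the hypothesis to \<open>k\<close> and to \<open>k\<close> after
    \<open>f\<close>.\<close>
  let ?P = "\<lambda>f :: real^'d \<Rightarrow> real^'d. linear f \<and> (det (matrix f) \<noteq> 0 \<longrightarrow> (\<forall>g\<in>borel_measurable borel.
      (\<integral>\<^sup>+x. g x \<partial>lborel) = ennreal \<bar>det (matrix f)\<bar> * (\<integral>\<^sup>+x. g (f x) \<partial>lborel)))"
  have "?P f"
  proof (rule induct_linear_elementary[OF lin])
    fix f g :: "real^'d \<Rightarrow> real^'d" assume l: "linear f" "linear g" and P: "?P f" "?P g"
    have d: "det (matrix (f \<circ> g)) = det (matrix f) * det (matrix g)"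
      using matrix_compose[OF l(2,1)] by (simp add: det_mul)
    show "?P (f \<circ> g)"
    proof (intro conjI impI ballI)
      show "linear (f \<circ> g)" using l linear_compose by blast
      fix k :: "real^'d \<Rightarrow> ennreal" assume k: "det (matrix (f \<circ> g)) \<noteq> 0" "k \<in> borel_measurable borel"
      then have nz: "det (matrix f) \<noteq> 0" "det (matrix g) \<noteq> 0" unfolding d by auto
      have m: "(\<lambda>x. k (f x)) \<in> borel_measurable borel"
        using k(2) borel_measurable_linear[OF l(1)] by measurable
      have "(\<integral>\<^sup>+x. k x \<partial>lborel) = ennreal \<bar>det (matrix f)\<bar> * (\<integral>\<^sup>+x. k (f x) \<partial>lborel)"
        using P(1) nz k by blast
      also have "(\<integral>\<^sup>+x. k (f x) \<partial>lborel) = ennreal \<bar>det (matrix g)\<bar> * (\<integral>\<^sup>+x. k (f (g x)) \<partial>lborel)"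
        using P(2) nz m by blast
      finally show "(\<integral>\<^sup>+x. k x \<partial>lborel) = ennreal \<bar>det (matrix (f \<circ> g))\<bar> * (\<integral>\<^sup>+x. k ((f \<circ> g) x) \<partial>lborel)"
        by (simp add: d abs_mult ennreal_mult mult.assoc)
    qed
  next
    \<comment> \<open>A map with a vanishing coordinate is not injective, so its determinant is 0
      and the implication is vacuous.\<close>
    fix f :: "real^'d \<Rightarrow> real^'d" and i assume l: "linear f" and 0: "\<And>x. f x $ i = 0"
    then have "\<not> inj f"
      by (metis (full_types) linear_injective_imp_surjective one_neq_zero surjE vec_component)
    then show "?P f" using det_nz_iff_inj[OF l] l by blast
  next
    fix c :: "'d \<Rightarrow> real"
    let ?h = "\<lambda>x::real^'d. \<chi> i. c i * x $ i"
    have l: "linear ?h" by (rule linearI) (simp_all add: vec_eq_iff algebra_simps)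
    have det: "det (matrix ?h) = (\<Prod>i\<in>UNIV. c i)"
      by (simp add: axis_def matrix_def det_diagonal)
    show "?P ?h"
    proof (intro conjI impI ballI l)
      fix g :: "real^'d \<Rightarrow> ennreal" assume nz: "det (matrix ?h) \<noteq> 0" and [measurable]: "g \<in> borel_measurable borel"
      \<comment> \<open>\<open>C\<close> recovers the diagonal entry from a basis vector, since the
        coordinates in \<open>Basis\<close> are indexed by vectors.\<close>
      define C where "C v = v \<bullet> ?h v" for v
      have Ca: "C (axis i 1) = c i" for i
        unfolding C_def inner_axis' by (simp add: axis_def)
      have h: "?h x = 0 + (\<Sum>j\<in>Basis. (C j * (x \<bullet> j)) *\<^sub>R j)" for x
      proof -
        have "(\<Sum>j\<in>Basis. (C j * (x \<bullet> j)) *\<^sub>R j) = (\<Sum>i\<in>UNIV. (c i * x $ i) *\<^sub>R axis i 1)"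
          by (rule sum.reindex_cong[of "\<lambda>i. axis i 1"])
            (auto simp: Basis_vec_def inj_on_def axis_eq_axis Ca inner_axis)
        also have "\<dots> = ?h x" by (simp add: vec_eq_iff axis_def if_distrib cong: if_cong)
        finally show ?thesis by simp
      qed
      have nz': "C j \<noteq> 0" if "j \<in> Basis" for j
        using that nz by (auto simp: Basis_vec_def Ca det)
      have pr: "(\<Prod>j\<in>Basis. \<bar>C j\<bar>) = \<bar>det (matrix ?h)\<bar>"
        unfolding det abs_prod
        by (rule prod.reindex_cong[of "\<lambda>i. axis i 1"]) (auto simp: Basis_vec_def inj_on_def axis_eq_axis Ca)
      have [measurable]: "?h \<in> borel_measurable borel" by (rule borel_measurable_linear[OF l])
      have eq: "lborel = density (distr lborel borel ?h) (\<lambda>_. \<bar>det (matrix ?h)\<bar>)"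
        using lborel_affine_euclidean[of C 0, OF nz'] unfolding h[symmetric] pr[symmetric] by (simp add: prod_ennreal)
      have "(\<integral>\<^sup>+x. g x \<partial>lborel) = (\<integral>\<^sup>+x. g x \<partial>density (distr lborel borel ?h) (\<lambda>_. \<bar>det (matrix ?h)\<bar>))"
        using eq by simp
      also have "\<dots> = ennreal \<bar>det (matrix ?h)\<bar> * (\<integral>\<^sup>+x. g (?h x) \<partial>lborel)"
        by (simp add: nn_integral_density nn_integral_distr nn_integral_cmult)
      finally show "(\<integral>\<^sup>+x. g x \<partial>lborel) = ennreal \<bar>det (matrix ?h)\<bar> * (\<integral>\<^sup>+x. g (?h x) \<partial>lborel)" .
    qed
  next
    fix m n :: 'd assume "m \<noteq> n"
    let ?t = "Transposition.transpose m n"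
    let ?h = "\<lambda>v::(real, 'd) vec. \<chi> i. v $ ?t i"
    have l: "linear ?h" by (rule linearI) (simp_all add: plus_vec_def scaleR_vec_def)
    have hm [measurable]: "?h \<in> borel_measurable borel" by (rule borel_measurable_linear[OF l])
    have "(\<chi> i j. if ?t i = j then 1 else 0) = (\<chi> i j. if j = ?t i then 1 else (0::real))"
      by (auto intro!: Cart_lambda_cong)
    then have "matrix ?h = Finite_Cartesian_Product.transpose(\<chi> i j. mat 1 $ i $ ?t j)"
      by (auto simp: matrix_eq transpose_def axis_def mat_def matrix_def)
    then have 1: "\<bar>det (matrix ?h)\<bar> = 1"
      by (simp add: det_permute_columns permutes_swap_id sign_swap_id abs_mult)
    have pr: "(\<Prod>b\<in>Basis. (v::real^'d) \<bullet> b) = (\<Prod>i\<in>UNIV. v $ i)" for v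
      by (rule prod.reindex_cong[of "\<lambda>i. axis i 1"]) (auto simp: Basis_vec_def inj_on_def axis_eq_axis inner_axis)
    \<comment> \<open>The swap pulls boxes back to boxes with permuted sides, and Lebesgue measure
      is determined by its values on boxes.\<close>
    have "lborel = distr lborel borel ?h"
    proof (rule lborel_eqI)
      fix lo u :: "real^'d" assume lu: "\<And>b. b \<in> Basis \<Longrightarrow> lo \<bullet> b \<le> u \<bullet> b"
      then have lu': "lo $ i \<le> u $ i" for i by (metis inner_axis real_inner_1_right axis_in_Basis_iff Basis_real_def insertI1)
      have "?h -` box lo u = box (?h lo) (?h u)"
        by (auto simp: mem_box_cart) (metis transpose_involutory)+
      then have "emeasure (distr lborel borel ?h) (box lo u) = emeasure lborel (box (?h lo) (?h u))"
        by (simp add: emeasure_distr)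
      also have "\<dots> = (\<Prod>b\<in>Basis. (?h u - ?h lo) \<bullet> b)"
        using lu' by (intro emeasure_lborel_box) (auto simp: Basis_vec_def inner_axis)
      also have "\<dots> = (\<Prod>b\<in>Basis. (u - lo) \<bullet> b)"
        unfolding pr prod.permute[OF permutes_swap_id[of m UNIV n, simplified], of "\<lambda>i. (u - lo)$i"]
        by (intro arg_cong[where f=ennreal] prod.cong) auto
      finally show "emeasure (distr lborel borel ?h) (box lo u) = (\<Prod>b\<in>Basis. (u - lo) \<bullet> b)" .
    qed simp
    then have eq: "(\<integral>\<^sup>+x. g x \<partial>lborel) = (\<integral>\<^sup>+x. g (?h x) \<partial>lborel)" if "g \<in> borel_measurable borel" for g
      using nn_integral_distr[of ?h lborel borel g] that hm by simp
    show "?P ?h"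
      by (intro conjI impI ballI l) (simp only: 1 ennreal_1 mult_1_left eq[symmetric])
  next
    fix m n :: 'd assume mn: "m \<noteq> n"
    let ?h = "\<lambda>v::(real, 'd) vec. \<chi> i. if i = m then v $ m + v $ n else v $ i"
    have l: "linear ?h" by (rule linearI) (auto simp: algebra_simps plus_vec_def scaleR_vec_def vec_eq_iff)
    have "matrix ?h = (\<chi> k. if k = m then row m (mat 1) + 1 *s row n (mat 1) else row k (mat 1))"
      by (auto simp: vec_eq_iff matrix_def axis_def row_def mat_def)
    then have det: "det (matrix ?h) = 1" using det_row_operation[OF mn, of "mat 1 :: real^'d^'d" 1] by simp
    have h: "?h v = v + (v \<bullet> axis n 1) *\<^sub>R axis m 1" for v
      unfolding inner_axis by (auto simp: vec_eq_iff axis_def)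
    have "(\<integral>\<^sup>+x. g (?h x) \<partial>lborel) = (\<integral>\<^sup>+x. g x \<partial>lborel)" if "g \<in> borel_measurable borel" for g
      unfolding h using that mn by (intro nn_integral_lborel_shear) (auto simp: axis_eq_axis)
    then show "?P ?h"
      by (intro conjI impI ballI l) (simp only: det abs_one ennreal_1 mult_1_left)
  qed
  then show ?thesis using assms by blast
qed

text \<open>Gram-Schmidt for the inner product u \<bullet> S v gives a basis \<open>f\<close> that
  is orthonormal for \<open>S\<close>. With its vectors as the rows of \<open>R\<close> this reads R
  S R^T = 1, so A = S R^T is the inverse of \<open>R\<close>, and A A^T = A R S = S.\<close>

lemma positive_definite_factor:
  fixes S :: "real^'d^'d"
  assumes "positive_definite S"
  shows "\<exists>A :: real^'d^'d. invertible A \<and> S = A ** transpose A"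
proof -
  have sym: "transpose S = S" and pd: "\<And>v. v \<noteq> 0 \<Longrightarrow> 0 < v \<bullet> (S *v v)"
    using assms by (auto simp: positive_definite_def)
  have comm: "u \<bullet> (S *v v) = v \<bullet> (S *v u)" for u v
    by (metis sym dot_lmul_matrix transpose_matrix_vector inner_commute)
  have ex: "\<exists>f :: nat \<Rightarrow> real^'d. \<forall>i<k. \<forall>j<k. f i \<bullet> (S *v f j) = (if i = j then 1 else 0)"
    if "k \<le> CARD('d)" for k
    using that
  proof (induction k)
    case (Suc k)
    then obtain f :: "nat \<Rightarrow> real^'d" where f: "\<forall>i<k. \<forall>j<k. f i \<bullet> (S *v f j) = (if i = j then 1 else 0)" by auto
    have "dim (span (f ` {..<k})) \<le> card (f ` {..<k})" by (simp add: dim_le_card')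
    also have "\<dots> \<le> k" using card_image_le[of "{..<k}" f] by simp
    also have "\<dots> < CARD('d)" using Suc by simp
    finally have "dim (span (f ` {..<k})) < dim (UNIV :: (real^'d) set)" by (simp only: dim_UNIV DIM_cart DIM_real mult_1_right)
    then have "span (f ` {..<k}) \<noteq> UNIV" by force
    then obtain v where v: "v \<notin> span (f ` {..<k})" by auto
    \<comment> \<open>\<open>v\<close> minus its projection, in the inner product of
      \<open>S\<close>, on the vectors found so far; nonzero because \<open>v\<close> lies outside
      their span.\<close>
    define u where "u = v - (\<Sum>i<k. (f i \<bullet> (S *v v)) *\<^sub>R f i)"
    have "(\<Sum>i<k. (f i \<bullet> (S *v v)) *\<^sub>R f i) \<in> span (f ` {..<k})"
      by (intro span_sum span_scale span_base) auto
    with v have u0: "u \<noteq> 0" unfolding u_def by auto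
    have orth: "f j \<bullet> (S *v u) = 0" if "j < k" for j
    proof -
      have "f j \<bullet> (S *v u) = f j \<bullet> (S *v v) - (\<Sum>i<k. (f i \<bullet> (S *v v)) * (f j \<bullet> (S *v f i)))"
        unfolding u_def
        by (simp add: matrix_vector_mult_diff_distrib inner_diff_right inner_sum_right
            linear_sum[OF matrix_vector_mul_linear] o_def matrix_vector_mult_scaleR)
      also have "(\<Sum>i<k. (f i \<bullet> (S *v v)) * (f j \<bullet> (S *v f i))) = (\<Sum>i<k. if i = j then f i \<bullet> (S *v v) else 0)"
        using f that by (intro sum.cong) auto
      also have "\<dots> = f j \<bullet> (S *v v)" using that by simp
      finally show ?thesis by simp
    qed
    define w where "w = (1 / sqrt (u \<bullet> (S *v u))) *\<^sub>R u"
    have ww: "w \<bullet> (S *v w) = 1"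
      using pd[OF u0] by (simp add: w_def matrix_vector_mult_scaleR field_simps)
    have fw: "f j \<bullet> (S *v w) = 0" "w \<bullet> (S *v f j) = 0" if "j < k" for j
      using orth[OF that] comm[of w "f j"] by (simp_all add: w_def matrix_vector_mult_scaleR)
    show ?case
      by (intro exI[of _ "f(k := w)"]) (use f ww fw in \<open>auto simp: less_Suc_eq\<close>)
  qed auto
  obtain f :: "nat \<Rightarrow> real^'d" where f: "\<And>i j. i < CARD('d) \<Longrightarrow> j < CARD('d) \<Longrightarrow> f i \<bullet> (S *v f j) = (if i = j then 1 else 0)"
    using ex[of "CARD('d)"] by auto
  \<comment> \<open>The Gram-Schmidt vectors are numbered by naturals and the matrix rows by the
    index type; \<open>b\<close> translates between the two.\<close>
  obtain b where b: "bij_betw b (UNIV :: 'd set) {0..<CARD('d)}"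
    using ex_bij_betw_finite_nat[of "UNIV :: 'd set"] by auto
  have b1: "b i < CARD('d)" "b i = b j \<longleftrightarrow> i = j" for i j
    using b bij_betwE[OF b] by (auto simp: bij_betw_def inj_on_def)
  define R :: "real^'d^'d" where "R = (\<chi> i. f (b i))"
  define A where "A = S ** transpose R"
  have col: "column j (S ** transpose R) = S *v f (b j)" for j
    by (simp add: vec_eq_iff column_def matrix_matrix_mult_def matrix_vector_mult_def transpose_def R_def)
  have "(R ** A) $ i $ j = (if i = j then 1 else 0)" for i j
  proof -
    have "(R ** A) $ i $ j = f (b i) \<bullet> column j A"
      by (simp add: matrix_matrix_mult_def inner_vec_def column_def R_def)
    then show ?thesis unfolding A_def col using f b1 by auto
  qed
  then have RA: "R ** A = mat 1" by (simp add: vec_eq_iff mat_def)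
  then have AR: "A ** R = mat 1" using matrix_left_right_inverse by blast
  have "A ** transpose A = A ** (R ** S)" by (simp add: A_def matrix_transpose_mul sym)
  also have "\<dots> = S" by (simp add: matrix_mul_assoc AR)
  finally have "S = A ** transpose A" ..
  moreover have "invertible A" unfolding invertible_def using AR RA by blast
  ultimately show ?thesis by blast
qed

section \<open>The Gaussian law as an affine image of the standard one\<close>

lemma matrix_inv_props:
  fixes A :: "real^'d^'d"
  assumes "invertible A"
  shows "A ** matrix_inv A = mat 1" "matrix_inv A ** A = mat 1"
  using someI_ex[OF assms[unfolded invertible_def]] unfolding matrix_inv_def by auto

lemma matrix_inv_unique:
  fixes A B :: "real^'d^'d"
  assumes "A ** B = mat 1" "B ** A = mat 1"
  shows "matrix_inv A = B"
proof -
  have "invertible A" unfolding invertible_def using assms by blast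
  then show ?thesis using matrix_inv_props(1) assms(2) by (metis matrix_mul_assoc matrix_mul_lid matrix_mul_rid)
qed

lemma lborel_matrix_affine:
  fixes A :: "real^'d^'d"
  assumes "invertible A"
  shows "(lborel :: (real^'d) measure) = density (distr lborel borel (\<lambda>x. c + A *v x)) (\<lambda>_. ennreal \<bar>det A\<bar>)"
proof (rule measure_eqI)
  fix X :: "(real^'d) set" assume "X \<in> sets lborel"
  then have [measurable]: "X \<in> sets borel" by simp
  have [measurable]: "(\<lambda>x. c + A *v x) \<in> borel_measurable borel"
    by (intro borel_measurable_continuous_onI continuous_intros)
  have d: "det A \<noteq> 0" using assms invertible_det_nz by blast
  have t: "lborel = distr (lborel :: (real^'d) measure) borel (\<lambda>x. c + x)"
    using lborel_distr_plus by (metis)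
  have "emeasure lborel X = (\<integral>\<^sup>+x. indicator X x \<partial>distr lborel borel (\<lambda>x. c + x))"
    by (subst t[symmetric]) simp
  also have "\<dots> = (\<integral>\<^sup>+x. indicator X (c + x) \<partial>lborel)" by (subst nn_integral_distr) auto
  also have "\<dots> = ennreal \<bar>det A\<bar> * (\<integral>\<^sup>+x. indicator X (c + A *v x) \<partial>lborel)"
    using nn_integral_lborel_linear[of "(*v) A" "\<lambda>x. indicator X (c + x)"] d by simp
  also have "\<dots> = emeasure (density (distr lborel borel (\<lambda>x. c + A *v x)) (\<lambda>_. ennreal \<bar>det A\<bar>)) X"
    by (simp add: emeasure_density nn_integral_distr nn_integral_cmult del: nn_integral_indicator)
  finally show "emeasure lborel X = emeasure (density (distr lborel borel (\<lambda>x. c + A *v x)) (\<lambda>_. ennreal \<bar>det A\<bar>)) X" .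
qed simp

text \<open>At the point c + A x the quadratic form of the inverse covariance becomes the squared
  norm of x, and the square root of det (A A^T) cancels the Jacobian |det A|.\<close>

lemma gaussian_eq_affine_image:
  fixes A :: "real^'d^'d"
  assumes A: "invertible A"
  shows "gaussian c (A ** transpose A) = distr std_gauss borel (\<lambda>x. c + A *v x)"
proof -
  let ?\<Sigma> = "A ** transpose A" and ?Ai = "matrix_inv A" and ?T = "\<lambda>x. c + A *v x"
  define G where "G = (\<lambda>x. exp (- ((x - c) \<bullet> (matrix_inv ?\<Sigma> *v (x - c))) / 2) / sqrt ((2 * pi) ^ CARD('d) * det ?\<Sigma>))"
  have inv: "A ** ?Ai = mat 1" "?Ai ** A = mat 1" using matrix_inv_props[OF A] by auto
  have inv': "transpose A ** transpose ?Ai = mat 1" "transpose ?Ai ** transpose A = mat 1"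
    by (simp_all add: matrix_transpose_mul[symmetric] inv)
  have 1: "(transpose ?Ai ** ?Ai) ** ?\<Sigma> = mat 1"
    by (metis inv(2) inv'(2) matrix_mul_assoc matrix_mul_lid)
  then have 2: "?\<Sigma> ** (transpose ?Ai ** ?Ai) = mat 1" using matrix_left_right_inverse by blast
  have si: "matrix_inv ?\<Sigma> = transpose ?Ai ** ?Ai"
    by (rule matrix_inv_unique[OF 2 1])
  have q: "(?T x - c) \<bullet> (matrix_inv ?\<Sigma> *v (?T x - c)) = (norm x)\<^sup>2" for x
  proof -
    have "matrix_inv ?\<Sigma> *v (A *v x) = transpose ?Ai *v x"
      by (simp add: si matrix_vector_mul_assoc matrix_mul_assoc[symmetric] inv)
    then have "(?T x - c) \<bullet> (matrix_inv ?\<Sigma> *v (?T x - c)) = (A *v x) \<bullet> (transpose ?Ai *v x)" by simp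
    also have "\<dots> = (?Ai *v (A *v x)) \<bullet> x"
      by (metis dot_lmul_matrix inner_commute transpose_matrix_vector)
    also have "\<dots> = (norm x)\<^sup>2" by (simp add: matrix_vector_mul_assoc inv power2_norm_eq_inner)
    finally show ?thesis .
  qed
  have d: "det A \<noteq> 0" using A invertible_det_nz by blast
  have Gx: "\<bar>det A\<bar> * G (?T x) = gauss_density x" for x
    unfolding G_def q gauss_density_def using d
    by (simp add: det_mul det_transpose real_sqrt_mult real_sqrt_power power_mult_distrib real_sqrt_abs2)
  have "continuous_on UNIV (\<lambda>x. matrix_inv ?\<Sigma> *v (x - c))"
    by (rule continuous_on_compose2[OF matrix_vector_mult_linear_continuous_on]) (auto intro!: continuous_intros)
  then have [measurable]: "G \<in> borel_measurable borel"
    unfolding G_def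
    by (intro borel_measurable_continuous_onI continuous_intros) (use d in \<open>auto simp: det_mul\<close>)
  have [measurable]: "?T \<in> borel_measurable borel"
    by (intro borel_measurable_continuous_onI continuous_intros) 
  have "gaussian c ?\<Sigma> = density lborel (\<lambda>x. ennreal (G x))" by (simp add: gaussian_def G_def)
  also have "\<dots> = density (density (distr lborel borel ?T) (\<lambda>_. ennreal \<bar>det A\<bar>)) (\<lambda>x. ennreal (G x))"
    by (simp only: lborel_matrix_affine[OF A, of c, symmetric])
  also have "\<dots> = density (distr lborel borel ?T) (\<lambda>x. ennreal \<bar>det A\<bar> * ennreal (G x))"
    by (rule density_density_eq) auto
  also have "\<dots> = distr (density lborel (\<lambda>x. ennreal \<bar>det A\<bar> * ennreal (G (?T x)))) borel ?T"
    by (rule density_distr) auto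
  also have "(\<lambda>x. ennreal \<bar>det A\<bar> * ennreal (G (?T x))) = (\<lambda>x. ennreal (gauss_density x))"
    by (simp add: Gx ennreal_mult'[symmetric])
  finally show ?thesis by (simp add: std_gauss_def)
qed

text \<open>The covariance has the shape L S L^T of the limit law, where L is an inverse Jacobian. A
  factor A of S turns it into (L A)(L A)^T, so the law is the image of the standard Gaussian under
  the map x \<mapsto> c + L A x.\<close>

lemma
  fixes L S :: "real^'d^'d"
  assumes L: "invertible L" and S: "positive_definite S"
  shows prob_space_gaussian: "prob_space (gaussian c (L ** S ** transpose L))"
    and char_gaussian: "(\<integral>x. iexp (t \<bullet> x) \<partial>gaussian c (L ** S ** transpose L)) =
      iexp (t \<bullet> c) * complex_of_real (exp (- ((transpose L *v t) \<bullet> (S *v (transpose L *v t))) / 2))"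
    and sets_gaussian: "sets (gaussian c (L ** S ** transpose L)) = sets borel"
proof -
  obtain A :: "real^'d^'d" where A: "invertible A" "S = A ** transpose A" using positive_definite_factor[OF S] by blast
  have LA: "invertible (L ** A)" using L A invertible_mult by blast
  have eq: "L ** S ** transpose L = (L ** A) ** transpose (L ** A)"
    by (simp add: A(2) matrix_transpose_mul matrix_mul_assoc)
  have g: "gaussian c (L ** S ** transpose L) = distr std_gauss borel (\<lambda>x. c + (L ** A) *v x)"
    unfolding eq by (rule gaussian_eq_affine_image[OF LA])
  interpret G: prob_space "std_gauss :: (real^'d) measure" by (rule prob_space_std_gauss)
  have [measurable]: "(\<lambda>x. c + (L ** A) *v x) \<in> borel_measurable borel"
    by (intro borel_measurable_continuous_onI continuous_intros) 
  show "prob_space (gaussian c (L ** S ** transpose L))" unfolding g by (rule G.prob_space_distr) simp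
  show "sets (gaussian c (L ** S ** transpose L)) = sets borel" by (simp add: gaussian_def)
  let ?B = "transpose (L ** A)"
  have tr: "t \<bullet> ((L ** A) *v x) = (?B *v t) \<bullet> x" for x
    by (metis dot_lmul_matrix transpose_matrix_vector)
  have "(\<integral>x. iexp (t \<bullet> x) \<partial>gaussian c (L ** S ** transpose L)) = (\<integral>x. iexp (t \<bullet> (c + (L ** A) *v x)) \<partial>std_gauss)"
    unfolding g by (subst integral_distr) auto
  also have "\<dots> = (\<integral>x. iexp (t \<bullet> c) * iexp ((?B *v t) \<bullet> x) \<partial>std_gauss)"
    by (intro Bochner_Integration.integral_cong refl) (simp only: inner_add_right tr, simp add: algebra_simps exp_add)
  also have "\<dots> = iexp (t \<bullet> c) * (\<integral>x. iexp ((?B *v t) \<bullet> x) \<partial>std_gauss)" by (rule integral_mult_right_zero)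
  also have "\<dots> = iexp (t \<bullet> c) * complex_of_real (exp (- (norm (?B *v t))\<^sup>2 / 2))"
    by (simp only: char_std_gauss)
  also have "(norm (?B *v t))\<^sup>2 = (transpose L *v t) \<bullet> (S *v (transpose L *v t))"
  proof -
    have "?B *v t = transpose A *v (transpose L *v t)"
      by (simp only: matrix_transpose_mul matrix_vector_mul_assoc)
    then have "(norm (?B *v t))\<^sup>2 = (transpose A *v (transpose L *v t)) \<bullet> (transpose A *v (transpose L *v t))"
      by (simp add: power2_norm_eq_inner)
    also have "\<dots> = (transpose L *v t) \<bullet> (A *v (transpose A *v (transpose L *v t)))"
      by (metis dot_lmul_matrix transpose_matrix_vector transpose_transpose)
    finally show ?thesis by (simp only: A(2) matrix_vector_mul_assoc matrix_mul_assoc)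
  qed
  finally show "(\<integral>x. iexp (t \<bullet> x) \<partial>gaussian c (L ** S ** transpose L)) =
      iexp (t \<bullet> c) * complex_of_real (exp (- ((transpose L *v t) \<bullet> (S *v (transpose L *v t))) / 2))" .
qed

section \<open>Normalized sums of i.i.d. rows\<close>

text \<open>The exponential limit with numerator and number of factors both varying, because the row
  variance depends on n and only converges. The logarithm differs from \<open>x n\<close> by at most
  2 (x n)^2 / m n.\<close>

lemma tendsto_one_plus_over_power:
  fixes x :: "nat \<Rightarrow> real" and m :: "nat \<Rightarrow> nat"
  assumes x: "x \<longlonglongrightarrow> L" and m: "filterlim m at_top sequentially"
  shows "(\<lambda>n. (1 + x n / real (m n)) ^ m n) \<longlonglongrightarrow> exp L"
proof -
  have rm: "filterlim (\<lambda>n. real (m n)) at_top sequentially"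
    using filterlim_compose[OF filterlim_real_sequentially m] by simp
  have y0: "(\<lambda>n. x n / real (m n)) \<longlonglongrightarrow> 0"
    by (rule tendsto_divide_0[OF x filterlim_at_top_imp_at_infinity[OF rm]])
  \<comment> \<open>Within 1/2 of 0 the second-order bound for ln (1 + y) holds, and 1 + y is
    positive.\<close>
  have ev: "eventually (\<lambda>n. \<bar>x n / real (m n)\<bar> < 1/2 \<and> m n \<ge> 1) sequentially"
    using order_tendstoD(2)[OF tendsto_rabs_zero[OF y0], of "1/2"] m
    by (auto simp: filterlim_at_top intro: eventually_conj)
  have bnd0: "(\<lambda>n. 2 * (x n * (x n / real (m n)))) \<longlonglongrightarrow> 0"
    using tendsto_mult_right_zero[OF tendsto_mult[OF x y0, simplified], of 2] by simp
  have "(\<lambda>n. real (m n) * ln (1 + x n / real (m n)) - x n) \<longlonglongrightarrow> 0"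
  proof (rule Lim_null_comparison[OF _ bnd0])
    show "eventually (\<lambda>n. norm (real (m n) * ln (1 + x n / real (m n)) - x n) \<le> 2 * (x n * (x n / real (m n)))) sequentially"
      using ev
    proof eventually_elim
      case (elim n)
      let ?y = "x n / real (m n)"
      have "\<bar>ln (1 + ?y) - ?y\<bar> \<le> 2 * ?y\<^sup>2" using elim by (intro abs_ln_one_plus_x_minus_x_bound) auto
      then have "real (m n) * \<bar>ln (1 + ?y) - ?y\<bar> \<le> real (m n) * (2 * ?y\<^sup>2)" by (intro mult_left_mono) auto
      moreover have "real (m n) * \<bar>ln (1 + ?y) - ?y\<bar> = \<bar>real (m n) * ln (1 + ?y) - x n\<bar>"
      proof -
        have "real (m n) * ln (1 + ?y) - x n = real (m n) * (ln (1 + ?y) - ?y)" using elim by (simp add: algebra_simps)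
        then show ?thesis by (simp add: abs_mult)
      qed
      moreover have "real (m n) * (2 * ?y\<^sup>2) = 2 * (x n * ?y)" using elim by (simp add: power2_eq_square)
      ultimately show ?case by simp
    qed
  qed
  from tendsto_exp[OF tendsto_add[OF this x]]
  have "(\<lambda>n. exp (real (m n) * ln (1 + x n / real (m n)))) \<longlonglongrightarrow> exp L" by simp
  then show ?thesis
  proof (rule Lim_transform_eventually)
    show "eventually (\<lambda>n. exp (real (m n) * ln (1 + x n / real (m n))) = (1 + x n / real (m n)) ^ m n) sequentially"
      using ev
    proof eventually_elim
      case (elim n)
      then have "1 + x n / real (m n) > 0" by linarith
      then show ?case by (simp add: exp_of_nat_mult)
    qed
  qed
qed

text \<open>A Lyapunov estimate with explicit error, because the law changes from row to row and
  only \<open>C\<close> is common. The m-th powers of two numbers of modulus at most 1 differ by at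
  most m times the difference of the numbers, so it suffices to compare one factor with 1 - s/(2m);
  \<open>s \<le> 4 * real m\<close> says that this number is at least -1.\<close>

lemma (in prob_space) char_iid_sum_approx:
  fixes X :: "nat \<Rightarrow> 'a \<Rightarrow> real"
  assumes ind: "indep_vars (\<lambda>_. borel) X {1..}"
    and law: "\<And>p. p \<ge> 1 \<Longrightarrow> distr M borel (X p) = \<mu>"
    and int2: "integrable \<mu> (\<lambda>x. x\<^sup>2)" and mean: "(\<integral>x. x \<partial>\<mu>) = 0" and var: "(\<integral>x. x\<^sup>2 \<partial>\<mu>) = s"
    and mom: "integrable \<mu> (\<lambda>x. \<bar>x\<bar> powr (2 + \<delta>))" "(\<integral>x. \<bar>x\<bar> powr (2 + \<delta>) \<partial>\<mu>) \<le> C"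
    and \<delta>: "0 < \<delta>" "\<delta> \<le> 1" and m: "m \<ge> 1" "s \<le> 4 * real m"
  shows "cmod ((\<integral>\<omega>. iexp ((\<Sum>p=1..m. X p \<omega>) / sqrt (real m)) \<partial>M) - complex_of_real ((1 + (- s / 2) / real m) ^ m))
     \<le> C * real m powr (- \<delta> / 2)"
proof -
  have rv: "random_variable borel (X p)" if "p \<ge> 1" for p using ind that unfolding indep_vars_def2 by auto
  interpret \<mu>: real_distribution \<mu>
    by (subst law[symmetric, of 1], simp, rule real_distribution_distr) (simp add: rv)
  have int1: "integrable \<mu> (\<lambda>x. x)"
    by (rule \<mu>.square_integrable_imp_integrable) (use int2 in auto)
  define t where "t = 1 / sqrt (real m)"
  have t: "t > 0" "t\<^sup>2 = 1 / real m" using m by (auto simp: t_def power_divide)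
  have s0: "s \<ge> 0" unfolding var[symmetric] by simp
  have "(\<integral>\<omega>. iexp ((\<Sum>p=1..m. X p \<omega>) / sqrt (real m)) \<partial>M) = char (distr M borel (\<lambda>\<omega>. \<Sum>p\<in>{1..m}. X p \<omega>)) t"
    unfolding char_def
    by (subst integral_distr) (auto intro!: borel_measurable_sum rv simp: t_def)
  also have "\<dots> = (\<Prod>p\<in>{1..m}. char (distr M borel (X p)) t)"
    by (intro char_distr_sum indep_vars_subset[OF ind]) auto
  also have "\<dots> = (\<Prod>p\<in>{1..m}. char \<mu> t)" by (intro prod.cong) (auto simp: law)
  also have "\<dots> = char \<mu> t ^ m" by simp
  finally have eq: "(\<integral>\<omega>. iexp ((\<Sum>p=1..m. X p \<omega>) / sqrt (real m)) \<partial>M) = char \<mu> t ^ m" .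
  \<comment> \<open>Interpolation between the two entries of the minimum, split at t |x| = 1; it
    turns a moment of order 2 + \<delta> into the rate t powr \<delta>.\<close>
  have pt: "min (6 * x\<^sup>2) (\<bar>t\<bar> * \<bar>x\<bar> ^ 3) \<le> 6 * t powr \<delta> * \<bar>x\<bar> powr (2 + \<delta>)" for x
  proof (cases "x = 0")
    case False
    have r: "t powr \<delta> * \<bar>x\<bar> powr (2 + \<delta>) = x\<^sup>2 * (t * \<bar>x\<bar>) powr \<delta>"
      using t False by (simp add: powr_add powr_mult powr_numeral)
    show ?thesis
    proof (cases "t * \<bar>x\<bar> \<le> 1")
      case True
      have "(t * \<bar>x\<bar>) powr 1 \<le> (t * \<bar>x\<bar>) powr \<delta>"
        using True t \<delta> by (intro powr_mono') auto
      then have "t * \<bar>x\<bar> \<le> (t * \<bar>x\<bar>) powr \<delta>" using t False by simp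
      then have "x\<^sup>2 * (t * \<bar>x\<bar>) \<le> x\<^sup>2 * (t * \<bar>x\<bar>) powr \<delta>" by (intro mult_left_mono) auto
      moreover have "\<bar>t\<bar> * \<bar>x\<bar> ^ 3 = x\<^sup>2 * (t * \<bar>x\<bar>)" using t by (simp add: power2_eq_square power3_eq_cube)
      moreover have "0 \<le> x\<^sup>2 * (t * \<bar>x\<bar>) powr \<delta>" by simp
      ultimately show ?thesis unfolding mult.assoc r min_le_iff_disj by linarith
    next
      case False
      then have "1 \<le> (t * \<bar>x\<bar>) powr \<delta>" using \<delta> by (intro ge_one_powr_ge_zero) auto
      then have "x\<^sup>2 * 1 \<le> x\<^sup>2 * (t * \<bar>x\<bar>) powr \<delta>" by (intro mult_left_mono) auto
      then show ?thesis using r by (simp add: mult.assoc)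
    qed
  qed simp
  have "cmod (char \<mu> t - (1 - t\<^sup>2 * s / 2)) \<le> (t\<^sup>2 / 6) * \<mu>.expectation (\<lambda>x. min (6 * x\<^sup>2) (\<bar>t\<bar> * \<bar>x\<bar> ^ 3))"
    by (rule \<mu>.char_approx3) (use int1 int2 mean var in auto)
  also have "\<dots> \<le> (t\<^sup>2 / 6) * (\<integral>x. 6 * t powr \<delta> * \<bar>x\<bar> powr (2 + \<delta>) \<partial>\<mu>)"
  proof (intro mult_left_mono integral_mono)
    show "integrable \<mu> (\<lambda>x. min (6 * x\<^sup>2) (\<bar>t\<bar> * \<bar>x\<bar> ^ 3))"
      by (rule Bochner_Integration.integrable_bound[of _ "\<lambda>x. 6 * x\<^sup>2"]) (use int2 in auto)
  qed (use pt mom in auto)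
  also have "\<dots> \<le> (t\<^sup>2 / 6) * (6 * t powr \<delta> * C)"
    using mom by (intro mult_left_mono) (auto intro: mult_left_mono)
  also have "\<dots> = t\<^sup>2 * (C * t powr \<delta>)" by simp
  finally have ap: "cmod (char \<mu> t - (1 - t\<^sup>2 * s / 2)) \<le> t\<^sup>2 * (C * t powr \<delta>)" .
  have e: "1 - t\<^sup>2 * s / 2 = 1 + (- s / 2) / real m" by (simp add: t(2))
  have "cmod (char \<mu> t ^ m - complex_of_real (1 + (- s / 2) / real m) ^ m)
      \<le> real m * cmod (char \<mu> t - complex_of_real (1 + (- s / 2) / real m))"
  proof (rule norm_power_diff)
    show "cmod (char \<mu> t) \<le> 1" by (rule \<mu>.cmod_char_le_1)
    have "\<bar>1 + (- s / 2) / real m\<bar> \<le> 1" using m s0 by (auto simp: abs_le_iff field_simps)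
    then show "cmod (complex_of_real (1 + (- s / 2) / real m)) \<le> 1" unfolding norm_of_real .
  qed
  also have "\<dots> \<le> real m * (t\<^sup>2 * (C * t powr \<delta>))"
    using ap e by (intro mult_left_mono) (auto simp: of_real_diff[symmetric] simp del: of_real_diff)
  also have "\<dots> = C * t powr \<delta>" using m by (simp add: t(2))
  also have "t powr \<delta> = real m powr (- \<delta> / 2)"
    by (simp add: t_def powr_divide powr_minus_divide powr_half_sqrt[symmetric] powr_powr)
  finally show ?thesis unfolding eq by simp
qed

section \<open>Independence along the recursion\<close>

text \<open>The variables \<open>T0, V 1, V 2, \<dots>\<close> are put into a single family over \<open>nat\<close> with a common
  codomain, because \<open>indep_var_restrict\<close> needs one type.\<close>

lemma (in prob_space) indep_vars_prepend:
  fixes T0 :: "'a \<Rightarrow> 'b::euclidean_space" and V :: "nat \<Rightarrow> 'a \<Rightarrow> 'c::euclidean_space"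
  assumes V: "indep_vars (\<lambda>_. borel) V {1..}"
    and T0: "indep_rv M borel T0 (PiM {1..} (\<lambda>_. borel)) (\<lambda>\<omega>. \<lambda>p\<in>{1..}. V p \<omega>)"
  shows "indep_vars (\<lambda>_. borel) (\<lambda>p \<omega>. if p = 0 then (T0 \<omega>, 0) else (0, V p \<omega>)) UNIV"
    (is "indep_vars _ ?W _")
proof -
  have T0m [measurable]: "T0 \<in> borel_measurable M" and set: "indep_set {T0 -` S \<inter> space M | S. S \<in> sets borel}
      {(\<lambda>\<omega>. \<lambda>p\<in>{1..}. V p \<omega>) -` S \<inter> space M | S. S \<in> sets (PiM {1..} (\<lambda>_. borel))}"
    using T0 by (auto simp: indep_rv_def)
  have Vm: "V p \<in> borel_measurable M" if "p \<ge> 1" for p using V that unfolding indep_vars_def2 by auto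
  have Wm: "?W p \<in> borel_measurable M" for p using Vm[of p] by (cases "p = 0") auto
  show ?thesis
    unfolding indep_vars_def2
  proof (intro conjI ballI Wm indep_setsI)
    fix p show "{?W p -` A \<inter> space M |A. A \<in> sets borel} \<subseteq> events"
      using measurable_sets[OF Wm] by blast
  next
    fix A and J :: "nat set" assume J: "J \<noteq> {}" "J \<subseteq> UNIV" "finite J"
      and A: "\<forall>j\<in>J. A j \<in> {?W j -` A \<inter> space M |A. A \<in> sets borel}"
    have AV: "\<exists>S\<in>sets borel. A j = V j -` S \<inter> space M" if "j \<in> J - {0}" for j
    proof -
      have "A j \<in> {?W j -` A \<inter> space M |A. A \<in> sets borel}" using A that by (intro bspec[OF A]) blast
      then obtain S where S: "S \<in> sets borel" "A j = ?W j -` S \<inter> space M" by blast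
      have "Pair 0 -` S \<inter> space borel \<in> sets (borel :: 'c measure)"
        by (rule measurable_sets[of "Pair 0" borel borel]) (use S in auto)
      moreover have "A j = V j -` (Pair 0 -` S) \<inter> space M" using S that by auto
      ultimately show ?thesis by auto
    qed
    then obtain S where S: "\<And>j. j \<in> J - {0} \<Longrightarrow> S j \<in> sets borel \<and> A j = V j -` S j \<inter> space M" by metis
    have prodV: "prob (\<Inter>j\<in>J - {0}. A j) = (\<Prod>j\<in>J - {0}. prob (A j))" if "J - {0} \<noteq> {}"
    proof -
      have "indep_sets (\<lambda>i. {V i -` A \<inter> space M |A. A \<in> sets borel}) {1..}" using V unfolding indep_vars_def2 by auto
      moreover have "\<forall>j\<in>J - {0}. A j \<in> {V j -` A \<inter> space M |A. A \<in> sets borel}" using S by blast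
      moreover have "J - {0} \<subseteq> {1..}" by auto
      ultimately show ?thesis using J that by (intro indep_setsD) auto
    qed
    show "prob (\<Inter>j\<in>J. A j) = (\<Prod>j\<in>J. prob (A j))"
    proof (cases "0 \<in> J")
      case False then show ?thesis using prodV J by simp
    next
      case True
      have "A 0 \<in> {?W 0 -` A \<inter> space M |A. A \<in> sets borel}" by (rule bspec[OF A True])
      then obtain S0 where S0: "S0 \<in> sets borel" "A 0 = ?W 0 -` S0 \<inter> space M" by blast
      have "(\<lambda>x. (x, 0)) -` S0 \<inter> space borel \<in> sets (borel :: 'b measure)"
        by (rule measurable_sets[of "\<lambda>x. (x, 0)" borel borel]) (use S0 in auto)
      moreover have "A 0 = T0 -` ((\<lambda>x. (x, 0)) -` S0) \<inter> space M" using S0 by auto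
      ultimately have A0: "A 0 \<in> {T0 -` S \<inter> space M | S. S \<in> sets borel}" by auto
      show ?thesis
      proof (cases "J - {0} = {}")
        case True
        with \<open>0 \<in> J\<close> have "J = {0}" by auto
        then show ?thesis by simp
      next
        case ne: False
        \<comment> \<open>The events with index at least 1 form a single cylinder in sequence space,
          so the independence of \<open>T0\<close> from the whole sequence covers them at
          once.\<close>
        let ?R = "{f \<in> space (PiM {1..} (\<lambda>_. borel :: 'c measure)). \<forall>j\<in>J - {0}. f j \<in> S j}"
        have "?R \<in> sets (PiM {1..} (\<lambda>_. borel))"
        proof -
          have "{f \<in> space (PiM {1..} (\<lambda>_. borel :: 'c measure)). f j \<in> S j} \<in> sets (PiM {1..} (\<lambda>_. borel))" if "j \<in> J - {0}" for j
            using S[OF that] that by (intro sets_Collect_single) auto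
          then show ?thesis using J by (intro sets.sets_Collect_finite_All) auto
        qed
        moreover have "(\<Inter>j\<in>J - {0}. A j) = (\<lambda>\<omega>. \<lambda>p\<in>{1..}. V p \<omega>) -` ?R \<inter> space M"
        proof (intro equalityI subsetI)
          fix \<omega> assume "\<omega> \<in> (\<Inter>j\<in>J - {0}. A j)"
          then have *: "\<And>j. j \<in> J - {0} \<Longrightarrow> \<omega> \<in> A j" by blast
          then have "\<omega> \<in> space M" "\<And>j. j \<in> J - {0} \<Longrightarrow> V j \<omega> \<in> S j" using ne S by blast+
          then show "\<omega> \<in> (\<lambda>\<omega>. \<lambda>p\<in>{1..}. V p \<omega>) -` ?R \<inter> space M" by (simp add: space_PiM)
        next
          fix \<omega> assume "\<omega> \<in> (\<lambda>\<omega>. \<lambda>p\<in>{1..}. V p \<omega>) -` ?R \<inter> space M"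
          then have *: "\<omega> \<in> space M" "\<And>j. j \<in> J - {0} \<Longrightarrow> V j \<omega> \<in> S j" by auto
          then show "\<omega> \<in> (\<Inter>j\<in>J - {0}. A j)" using S by blast
        qed
        ultimately have "(\<Inter>j\<in>J - {0}. A j) \<in> {(\<lambda>\<omega>. \<lambda>p\<in>{1..}. V p \<omega>) -` S \<inter> space M | S. S \<in> sets (PiM {1..} (\<lambda>_. borel))}"
          by blast
        from indep_setD[OF set A0 this]
        have "prob (A 0 \<inter> (\<Inter>j\<in>J - {0}. A j)) = prob (A 0) * (\<Prod>j\<in>J - {0}. prob (A j))" using prodV[OF ne] by simp
        moreover have "A 0 \<inter> (\<Inter>j\<in>J - {0}. A j) = (\<Inter>j\<in>J. A j)" using True by auto
        moreover have "prob (A 0) * (\<Prod>j\<in>J - {0}. prob (A j)) = (\<Prod>j\<in>J. prob (A j))"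
          using J True by (simp add: prod.remove[of J 0])
        ultimately show ?thesis by simp
      qed
    qed
  qed
qed

text \<open>\<open>Y p\<close> is a measurable function of the first p + 1 members of the combined
  family, and \<open>V (Suc p)\<close> a function of the next one. The state has a type of its own
  because it is taken both as the iterate alone and as the iterate paired with a running sum;
  \<open>F\<close> turns the initial value into the initial state.\<close>

lemma (in prob_space) recursive_chain_indep:
  fixes T0 :: "'a \<Rightarrow> 'b::euclidean_space" and V :: "nat \<Rightarrow> 'a \<Rightarrow> 'c::euclidean_space"
    and Y :: "nat \<Rightarrow> 'a \<Rightarrow> 'd::euclidean_space"
  assumes V: "indep_vars (\<lambda>_. borel) V {1..}"
    and T0: "indep_rv M borel T0 (PiM {1..} (\<lambda>_. borel)) (\<lambda>\<omega>. \<lambda>p\<in>{1..}. V p \<omega>)"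
    and Y0: "\<And>\<omega>. \<omega> \<in> space M \<Longrightarrow> Y 0 \<omega> = F (T0 \<omega>)" and F [measurable]: "F \<in> borel_measurable borel"
    and YS: "\<And>p \<omega>. \<omega> \<in> space M \<Longrightarrow> Y (Suc p) \<omega> = G p (Y p \<omega>, V (Suc p) \<omega>)"
    and G [measurable]: "\<And>p. G p \<in> borel_measurable (borel \<Otimes>\<^sub>M borel)"
  shows "Y p \<in> borel_measurable M"
    and "distr M (borel \<Otimes>\<^sub>M borel) (\<lambda>\<omega>. (Y p \<omega>, V (Suc p) \<omega>)) = distr M borel (Y p) \<Otimes>\<^sub>M distr M borel (V (Suc p))"
proof -
  define W where "W = (\<lambda>p \<omega>. if p = 0 then (T0 \<omega>, 0) else (0, V p \<omega>))"
  have W: "indep_vars (\<lambda>_. borel) W UNIV" unfolding W_def by (rule indep_vars_prepend[OF V T0])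
  have Wm [measurable]: "W p \<in> borel_measurable M" for p using W unfolding indep_vars_def2 by blast
  have bf: "fst \<in> borel_measurable (borel :: ('b \<times> 'c) measure)" and bs: "snd \<in> borel_measurable (borel :: ('b \<times> 'c) measure)"
    by (auto intro!: borel_measurable_continuous_onI continuous_intros)
  \<comment> \<open>Unrolling the recursion: the state depends measurably on the finite history,
    viewed as a point of the product space over \<open>{..p}\<close>.\<close>
  have "\<exists>\<Phi>\<in>borel_measurable (PiM {..p} (\<lambda>_. borel)). \<forall>\<omega>\<in>space M. Y p \<omega> = \<Phi> (\<lambda>i\<in>{..p}. W i \<omega>)" for p
  proof (induction p)
    case 0
    show ?case
    proof (intro bexI ballI)
      have "(\<lambda>f. f 0) \<in> PiM {..0::nat} (\<lambda>_. borel :: ('b \<times> 'c) measure) \<rightarrow>\<^sub>M borel"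
        by (rule measurable_component_singleton) simp
      from measurable_compose[OF measurable_compose[OF this bf] F]
      show "(\<lambda>f. F (fst (f 0))) \<in> borel_measurable (PiM {..0::nat} (\<lambda>_. borel :: ('b \<times> 'c) measure))" .
    qed (auto simp: Y0 W_def)
  next
    case (Suc p)
    then obtain \<Phi> where [measurable]: "\<Phi> \<in> borel_measurable (PiM {..p} (\<lambda>_. borel))"
      and \<Phi>: "\<And>\<omega>. \<omega> \<in> space M \<Longrightarrow> Y p \<omega> = \<Phi> (\<lambda>i\<in>{..p}. W i \<omega>)" by blast
    show ?case
    proof (intro bexI ballI)
      have [measurable]: "(\<lambda>f. restrict f {..p}) \<in> PiM {..Suc p} (\<lambda>_. borel :: ('b \<times> 'c) measure) \<rightarrow>\<^sub>M PiM {..p} (\<lambda>_. borel)"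
        by (rule measurable_restrict_subset) auto
      have "(\<lambda>f. f (Suc p)) \<in> PiM {..Suc p} (\<lambda>_. borel :: ('b \<times> 'c) measure) \<rightarrow>\<^sub>M borel"
        by (rule measurable_component_singleton) simp
      from measurable_compose[OF this bs]
      have [measurable]: "(\<lambda>f. snd (f (Suc p))) \<in> borel_measurable (PiM {..Suc p} (\<lambda>_. borel :: ('b \<times> 'c) measure))" .
      show "(\<lambda>f. G p (\<Phi> (restrict f {..p}), snd (f (Suc p)))) \<in> borel_measurable (PiM {..Suc p} (\<lambda>_. borel :: ('b \<times> 'c) measure))"
        by measurable
      fix \<omega> assume "\<omega> \<in> space M"
      moreover have "restrict (\<lambda>i\<in>{..Suc p}. W i \<omega>) {..p} = (\<lambda>i\<in>{..p}. W i \<omega>)" by (auto simp: restrict_def)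
      ultimately show "Y (Suc p) \<omega> = G p (\<Phi> (restrict (\<lambda>i\<in>{..Suc p}. W i \<omega>) {..p}), snd ((\<lambda>i\<in>{..Suc p}. W i \<omega>) (Suc p)))"
        by (simp add: YS \<Phi> W_def)
    qed
  qed
  then obtain \<Phi> where [measurable]: "\<Phi> \<in> borel_measurable (PiM {..p} (\<lambda>_. borel))"
    and \<Phi>: "\<And>\<omega>. \<omega> \<in> space M \<Longrightarrow> Y p \<omega> = \<Phi> (\<lambda>i\<in>{..p}. W i \<omega>)" by blast
  let ?A = "\<lambda>\<omega>. \<lambda>i\<in>{..p}. W i \<omega>" and ?B = "\<lambda>\<omega>. \<lambda>i\<in>{Suc p}. W i \<omega>"
  have "indep_var (PiM {..p} (\<lambda>_. borel)) ?A (PiM {Suc p} (\<lambda>_. borel)) ?B"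
    by (rule indep_var_restrict[OF W]) auto
  then have AB [measurable]: "?A \<in> M \<rightarrow>\<^sub>M PiM {..p} (\<lambda>_. borel)" "?B \<in> M \<rightarrow>\<^sub>M PiM {Suc p} (\<lambda>_. borel)"
    and pr: "distr M (PiM {..p} (\<lambda>_. borel)) ?A \<Otimes>\<^sub>M distr M (PiM {Suc p} (\<lambda>_. borel)) ?B =
      distr M (PiM {..p} (\<lambda>_. borel) \<Otimes>\<^sub>M PiM {Suc p} (\<lambda>_. borel)) (\<lambda>\<omega>. (?A \<omega>, ?B \<omega>))"
    unfolding indep_var_distribution_eq by auto
  let ?g = "\<lambda>f. snd (f (Suc p)) :: 'c"
  have gm [measurable]: "?g \<in> borel_measurable (PiM {Suc p} (\<lambda>_. borel :: ('b \<times> 'c) measure))"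
    by (rule measurable_compose[OF _ bs], rule measurable_component_singleton) simp
  have Yeq: "distr M borel (Y p) = distr (distr M (PiM {..p} (\<lambda>_. borel)) ?A) borel \<Phi>"
    by (subst distr_distr) (auto intro!: distr_cong simp: \<Phi>)
  have Veq: "distr M borel (V (Suc p)) = distr (distr M (PiM {Suc p} (\<lambda>_. borel)) ?B) borel ?g"
    by (subst distr_distr[OF gm AB(2)], intro distr_cong) (auto simp: W_def)
  show Ym: "Y p \<in> borel_measurable M"
    by (subst measurable_cong[OF \<Phi>]) measurable
  have "prob_space (distr (distr M (PiM {Suc p} (\<lambda>_. borel)) ?B) borel ?g)"
    by (intro prob_space.prob_space_distr prob_space_distr) auto
  then have sf: "sigma_finite_measure (distr (distr M (PiM {Suc p} (\<lambda>_. borel)) ?B) borel ?g)"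
    using prob_space_imp_sigma_finite by blast
  have "distr M borel (Y p) \<Otimes>\<^sub>M distr M borel (V (Suc p)) =
    distr (distr M (PiM {..p} (\<lambda>_. borel)) ?A \<Otimes>\<^sub>M distr M (PiM {Suc p} (\<lambda>_. borel)) ?B) (borel \<Otimes>\<^sub>M borel) (\<lambda>(x, y). (\<Phi> x, ?g y))"
    unfolding Yeq Veq by (rule pair_measure_distr[OF _ _ sf]) auto
  also have "\<dots> = distr M (borel \<Otimes>\<^sub>M borel) (\<lambda>\<omega>. (Y p \<omega>, V (Suc p) \<omega>))"
    unfolding pr
  proof (subst distr_distr)
    show "distr M (borel \<Otimes>\<^sub>M borel) ((\<lambda>(x, y). (\<Phi> x, ?g y)) \<circ> (\<lambda>\<omega>. (?A \<omega>, ?B \<omega>))) = distr M (borel \<Otimes>\<^sub>M borel) (\<lambda>\<omega>. (Y p \<omega>, V (Suc p) \<omega>))"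
      by (intro distr_cong) (auto simp: \<Phi> W_def)
  qed (use AB gm in measurable)
  finally show "distr M (borel \<Otimes>\<^sub>M borel) (\<lambda>\<omega>. (Y p \<omega>, V (Suc p) \<omega>)) = distr M borel (Y p) \<Otimes>\<^sub>M distr M borel (V (Suc p))" ..
qed

text \<open>Integrating out the innovation first plays the role of conditioning on the past. It is
  stated for nonnegative integrals so that it can be applied before any moment of the iterates is
  known to be finite.\<close>

lemma (in prob_space) recursive_chain_nn_integral:
  fixes T0 :: "'a \<Rightarrow> 'b::euclidean_space" and V :: "nat \<Rightarrow> 'a \<Rightarrow> 'c::euclidean_space"
    and Y :: "nat \<Rightarrow> 'a \<Rightarrow> 'd::euclidean_space"
  assumes V: "indep_vars (\<lambda>_. borel) V {1..}"
    and T0: "indep_rv M borel T0 (PiM {1..} (\<lambda>_. borel)) (\<lambda>\<omega>. \<lambda>p\<in>{1..}. V p \<omega>)"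
    and Y0: "\<And>\<omega>. \<omega> \<in> space M \<Longrightarrow> Y 0 \<omega> = F (T0 \<omega>)" and F [measurable]: "F \<in> borel_measurable borel"
    and YS: "\<And>p \<omega>. \<omega> \<in> space M \<Longrightarrow> Y (Suc p) \<omega> = G p (Y p \<omega>, V (Suc p) \<omega>)"
    and G [measurable]: "\<And>p. G p \<in> borel_measurable (borel \<Otimes>\<^sub>M borel)"
    and law: "distr M borel (V (Suc p)) = \<nu>"
    and k [measurable]: "k \<in> borel_measurable (borel \<Otimes>\<^sub>M borel)"
  shows "(\<integral>\<^sup>+\<omega>. k (Y p \<omega>, V (Suc p) \<omega>) \<partial>M) = (\<integral>\<^sup>+\<omega>. (\<integral>\<^sup>+u. k (Y p \<omega>, u) \<partial>\<nu>) \<partial>M)"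
proof -
  have [measurable]: "Y p \<in> borel_measurable M"
    using V T0 Y0 F YS G by (rule recursive_chain_indep(1))
  have ch: "distr M (borel \<Otimes>\<^sub>M borel) (\<lambda>\<omega>. (Y p \<omega>, V (Suc p) \<omega>)) = distr M borel (Y p) \<Otimes>\<^sub>M distr M borel (V (Suc p))"
    using V T0 Y0 F YS G by (rule recursive_chain_indep(2))
  have Vm [measurable]: "V (Suc p) \<in> borel_measurable M" using V unfolding indep_vars_def2 by auto
  have "prob_space \<nu>" unfolding law[symmetric] by (rule prob_space_distr) simp
  then interpret \<nu>: prob_space \<nu> .
  have [measurable_cong]: "sets \<nu> = sets borel" unfolding law[symmetric] by simp
  have "(\<integral>\<^sup>+\<omega>. k (Y p \<omega>, V (Suc p) \<omega>) \<partial>M) = (\<integral>\<^sup>+z. k z \<partial>distr M (borel \<Otimes>\<^sub>M borel) (\<lambda>\<omega>. (Y p \<omega>, V (Suc p) \<omega>)))"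
    by (subst nn_integral_distr) auto
  also have "\<dots> = (\<integral>\<^sup>+z. k z \<partial>(distr M borel (Y p) \<Otimes>\<^sub>M \<nu>))" by (simp only: ch law)
  also have "\<dots> = (\<integral>\<^sup>+y. (\<integral>\<^sup>+u. k (y, u) \<partial>\<nu>) \<partial>distr M borel (Y p))"
    by (rule \<nu>.nn_integral_fst[symmetric]) measurable
  also have "\<dots> = (\<integral>\<^sup>+\<omega>. (\<integral>\<^sup>+u. k (Y p \<omega>, u) \<partial>\<nu>) \<partial>M)"
    by (subst nn_integral_distr) auto
  finally show ?thesis .
qed

text \<open>The square is expanded, and the cross term keeps the mean of \<open>D\<close>; this is
  where drift or centring enters. Integrability comes from the finite bound
  \<open>c\<close>.\<close>

lemma nn_integral_norm_add_square_le:
  fixes D :: "'b \<Rightarrow> 'c::euclidean_space"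
  assumes "prob_space \<nu>" and [measurable]: "D \<in> borel_measurable \<nu>"
    and D2: "(\<integral>\<^sup>+u. ennreal ((norm (D u))\<^sup>2) \<partial>\<nu>) \<le> ennreal c" and c: "0 \<le> c"
  shows "integrable \<nu> D"
    and "(\<integral>\<^sup>+u. ennreal ((norm (s + D u))\<^sup>2) \<partial>\<nu>) \<le> ennreal ((norm s)\<^sup>2 + 2 * (s \<bullet> (\<integral>u. D u \<partial>\<nu>)) + c)"
proof -
  interpret \<nu>: prob_space \<nu> by fact
  have "(\<integral>\<^sup>+u. ennreal ((norm (D u))\<^sup>2) \<partial>\<nu>) < \<infinity>" using D2 by (rule le_less_trans) simp
  then have i2: "integrable \<nu> (\<lambda>u. (norm (D u))\<^sup>2)" by (intro integrableI_nonneg) auto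
  have "integrable \<nu> (\<lambda>u. norm (D u))"
    by (rule \<nu>.square_integrable_imp_integrable[OF _ i2]) measurable
  then show i1: "integrable \<nu> D" by (rule integrable_norm_cancel) measurable
  have e: "(norm (s + D u))\<^sup>2 = (norm s)\<^sup>2 + 2 * (s \<bullet> D u) + (norm (D u))\<^sup>2" for u
    by (simp add: power2_norm_eq_inner inner_add_left inner_add_right inner_commute)
  have i: "integrable \<nu> (\<lambda>u. (norm (s + D u))\<^sup>2)" unfolding e using i1 i2 by auto
  have "ennreal (\<integral>u. (norm (D u))\<^sup>2 \<partial>\<nu>) \<le> ennreal c" using D2 by (subst (asm) nn_integral_eq_integral[OF i2]) auto
  then have c': "(\<integral>u. (norm (D u))\<^sup>2 \<partial>\<nu>) \<le> c" using c by simp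
  have "(\<integral>\<^sup>+u. ennreal ((norm (s + D u))\<^sup>2) \<partial>\<nu>) = ennreal (\<integral>u. (norm (s + D u))\<^sup>2 \<partial>\<nu>)"
    by (rule nn_integral_eq_integral[OF i]) simp
  also have "(\<integral>u. (norm (s + D u))\<^sup>2 \<partial>\<nu>) = (norm s)\<^sup>2 + 2 * (s \<bullet> (\<integral>u. D u \<partial>\<nu>)) + (\<integral>u. (norm (D u))\<^sup>2 \<partial>\<nu>)"
    unfolding e using i1 i2 by (simp add: \<nu>.prob_space)
  finally show "(\<integral>\<^sup>+u. ennreal ((norm (s + D u))\<^sup>2) \<partial>\<nu>) \<le> ennreal ((norm s)\<^sup>2 + 2 * (s \<bullet> (\<integral>u. D u \<partial>\<nu>)) + c)"
    using c' by (simp add: ennreal_leI)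
qed

section \<open>Moment bounds for one row\<close>

lemma nn_integral_affine_le:
  assumes "prob_space M" and [measurable]: "f \<in> borel_measurable M"
    and f: "\<And>\<omega>. 0 \<le> f \<omega>" "(\<integral>\<^sup>+\<omega>. ennreal (f \<omega>) \<partial>M) \<le> ennreal B" and ab: "0 \<le> a" "0 \<le> b" "0 \<le> B"
  shows "(\<integral>\<^sup>+\<omega>. ennreal (a * f \<omega> + b) \<partial>M) \<le> ennreal (a * B + b)"
proof -
  interpret prob_space M by fact
  have "(\<integral>\<^sup>+\<omega>. ennreal (a * f \<omega> + b) \<partial>M) = (\<integral>\<^sup>+\<omega>. ennreal a * ennreal (f \<omega>) + ennreal b \<partial>M)"
    using ab f by (intro nn_integral_cong) (simp add: ennreal_mult ennreal_plus)
  also have "\<dots> = ennreal a * (\<integral>\<^sup>+\<omega>. ennreal (f \<omega>) \<partial>M) + ennreal b"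
    by (simp add: nn_integral_add nn_integral_cmult emeasure_space_1)
  also have "\<dots> \<le> ennreal a * ennreal B + ennreal b"
    using f by (intro add_mono mult_left_mono) auto
  also have "\<dots> = ennreal (a * B + b)" using ab by (simp add: ennreal_mult ennreal_plus)
  finally show ?thesis .
qed

lemma (in prob_space) expectation_norm_le_sqrt:
  fixes f :: "'a \<Rightarrow> 'b::euclidean_space"
  assumes [measurable]: "f \<in> borel_measurable M"
    and B: "(\<integral>\<^sup>+\<omega>. ennreal ((norm (f \<omega>))\<^sup>2) \<partial>M) \<le> ennreal B" "0 \<le> B"
  shows "integrable M f" "integrable M (\<lambda>\<omega>. (norm (f \<omega>))\<^sup>2)" "expectation (\<lambda>\<omega>. (norm (f \<omega>))\<^sup>2) \<le> B"
    "expectation (\<lambda>\<omega>. norm (f \<omega>)) \<le> sqrt B"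
proof -
  have "(\<integral>\<^sup>+\<omega>. ennreal ((norm (f \<omega>))\<^sup>2) \<partial>M) < \<infinity>" using B(1) by (rule le_less_trans) simp
  then show i2: "integrable M (\<lambda>\<omega>. (norm (f \<omega>))\<^sup>2)" by (intro integrableI_nonneg) auto
  have i1: "integrable M (\<lambda>\<omega>. norm (f \<omega>))"
    by (rule square_integrable_imp_integrable[OF _ i2]) measurable
  then show "integrable M f" by (rule integrable_norm_cancel) measurable
  have "ennreal (expectation (\<lambda>\<omega>. (norm (f \<omega>))\<^sup>2)) \<le> ennreal B"
    using B by (subst (asm) nn_integral_eq_integral[OF i2]) auto
  then show le: "expectation (\<lambda>\<omega>. (norm (f \<omega>))\<^sup>2) \<le> B" using B(2) by simp
  \<comment> \<open>Jensen's inequality for the square, read off from a nonnegative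
    variance.\<close>
  have "(expectation (\<lambda>\<omega>. norm (f \<omega>)))\<^sup>2 \<le> expectation (\<lambda>\<omega>. (norm (f \<omega>))\<^sup>2)"
    using variance_eq[OF i1 i2] variance_positive[of "\<lambda>\<omega>. norm (f \<omega>)"] by simp
  then show "expectation (\<lambda>\<omega>. norm (f \<omega>)) \<le> sqrt B" using le by (intro real_le_rsqrt) simp
qed

text \<open>The one-step mean square estimate with equality in place of inequality. Only the common
  constants and the steps occur, so the same sequence bounds all rows.\<close>

fun msq_bound :: "(nat \<Rightarrow> real) \<Rightarrow> real \<Rightarrow> real \<Rightarrow> real \<Rightarrow> nat \<Rightarrow> real" where
  "msq_bound g l K A0 0 = A0"
| "msq_bound g l K A0 (Suc p) =
    (1 - 2 * l * g (Suc p) + K * (g (Suc p))\<^sup>2) * msq_bound g l K A0 p + K * (g (Suc p))\<^sup>2"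

text \<open>By \<open>l\<^sup>2 \<le> K\<close> the coefficient is at least (1 - l g)^2. Its sign is
  needed to iterate an upper bound.\<close>

lemma
  assumes "0 \<le> A0" "l\<^sup>2 \<le> K"
  shows msq_coeff_nonneg: "0 \<le> 1 - 2 * l * g (Suc p) + K * (g (Suc p))\<^sup>2"
    and msq_bound_nonneg: "0 \<le> msq_bound g l K A0 p"
proof -
  have c: "0 \<le> 1 - 2 * l * t + K * t\<^sup>2" for t
  proof -
    have "0 \<le> (1 - l * t)\<^sup>2" by simp
    also have "\<dots> = 1 - 2 * l * t + l\<^sup>2 * t\<^sup>2" by (simp add: power2_eq_square algebra_simps)
    also have "\<dots> \<le> 1 - 2 * l * t + K * t\<^sup>2" using assms by (intro add_left_mono mult_right_mono) auto
    finally show ?thesis .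
  qed
  then show "0 \<le> 1 - 2 * l * g (Suc p) + K * (g (Suc p))\<^sup>2" .
  have "0 \<le> K" using assms(2) by (meson order_trans zero_le_power2)
  then show "0 \<le> msq_bound g l K A0 p" by (induction p) (auto simp: assms c intro!: add_nonneg_nonneg mult_nonneg_nonneg)
qed

text \<open>One row with its index frozen: \<open>z\<close> is the zero of its mean field and \<nu>
  the law of its innovations. The constants are parameters, so instantiating every row with the same
  values makes the resulting bounds uniform in the row. Growth and Hoelder continuity are both
  measured from \<open>z\<close>, in terms of the squared distance.\<close>

locale sa_scheme = prob_space M for M :: "'w measure" +
  fixes H :: "'d::euclidean_space \<Rightarrow> 'q::euclidean_space \<Rightarrow> 'd"
    and V :: "nat \<Rightarrow> 'w \<Rightarrow> 'q" and \<theta> :: "nat \<Rightarrow> 'w \<Rightarrow> 'd"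
    and \<nu> :: "'q measure" and h :: "'d \<Rightarrow> 'd" and z :: 'd and g :: "nat \<Rightarrow> real"
    and l K A0 C b :: real
  assumes prob_nu: "prob_space \<nu>" and sets_nu [measurable_cong]: "sets \<nu> = sets borel"
    and H_meas: "(\<lambda>(x, u). H x u) \<in> borel_measurable borel"
    and V_indep: "indep_vars (\<lambda>_. borel) V {1..}"
    and V_law: "\<And>p. distr M borel (V (Suc p)) = \<nu>"
    and init_indep: "indep_rv M borel (\<theta> 0) (PiM {1..} (\<lambda>_. borel)) (\<lambda>\<omega>. \<lambda>p\<in>{1..}. V p \<omega>)"
    and init_moment: "(\<integral>\<^sup>+\<omega>. ennreal ((norm (\<theta> 0 \<omega> - z))\<^sup>2) \<partial>M) \<le> ennreal A0"
    and scheme: "\<And>p \<omega>. \<omega> \<in> space M \<Longrightarrow> \<theta> (Suc p) \<omega> = \<theta> p \<omega> - g (Suc p) *\<^sub>R H (\<theta> p \<omega>) (V (Suc p) \<omega>)"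
    and h_eq: "\<And>x. h x = (\<integral>u. H x u \<partial>\<nu>)" and h_zero: "h z = 0"
    and growth: "\<And>x. (\<integral>\<^sup>+u. ennreal ((norm (H x u))\<^sup>2) \<partial>\<nu>) \<le> ennreal (K * (1 + (norm (x - z))\<^sup>2))"
    and holder: "\<And>x. (\<integral>\<^sup>+u. ennreal ((norm (H x u - H z u))\<^sup>2) \<partial>\<nu>) \<le> ennreal (C * ((norm (x - z))\<^sup>2) powr b)"
    and mono: "\<And>x. l * (norm (x - z))\<^sup>2 \<le> (x - z) \<bullet> h x"
    and const: "0 \<le> A0" "0 < l" "l\<^sup>2 \<le> K" "0 \<le> C" "0 < b" "b \<le> 1"
    and g_pos: "\<And>p. 0 < g (Suc p)" and g_dec: "\<And>p. g (Suc (Suc p)) \<le> g (Suc p)"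
begin

sublocale \<nu>: prob_space \<nu> by (rule prob_nu)

lemma H_measurable [measurable (raw)]:
  assumes [measurable]: "X \<in> borel_measurable N" "Y \<in> borel_measurable N"
  shows "(\<lambda>\<omega>. H (X \<omega>) (Y \<omega>)) \<in> borel_measurable N"
  using measurable_compose[OF borel_measurable_Pair[OF assms] H_meas] by simp

lemma K_nonneg: "0 \<le> K"
  using const by (meson order_trans zero_le_power2)

lemma H_integrable: "integrable \<nu> (H x)"
  by (rule nn_integral_norm_add_square_le(1)[OF prob_nu _ growth]) (auto intro!: mult_nonneg_nonneg add_nonneg_nonneg K_nonneg)

lemma h_measurable [measurable]: "h \<in> borel_measurable borel"
  unfolding h_eq by (rule \<nu>.borel_measurable_lebesgue_integral) measurable

lemma V_measurable [measurable]: "V (Suc p) \<in> borel_measurable M"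
  using V_indep unfolding indep_vars_def2 by auto

lemma theta_measurable [measurable]: "\<theta> p \<in> borel_measurable M"
  by (rule recursive_chain_indep(1)[where Y=\<theta> and F="\<lambda>x. x" and G="\<lambda>p (x, u). x - g (Suc p) *\<^sub>R H x u",
      OF V_indep init_indep]) (auto simp: scheme)

text \<open>Given \<open>\<theta> p = x\<close>, the cross term of the expanded square is at most -2
  l g |x - z|^2 by \<open>mono\<close>, and the square term at most g^2 K (1 + |x - z|^2) by
  \<open>growth\<close>; together this is one step of \<open>msq_bound\<close>.\<close>

lemma second_moment_le: "(\<integral>\<^sup>+\<omega>. ennreal ((norm (\<theta> p \<omega> - z))\<^sup>2) \<partial>M) \<le> ennreal (msq_bound g l K A0 p)"
proof (induction p)
  case 0 then show ?case using init_moment by simp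
next
  case (Suc p)
  let ?g = "g (Suc p)"
  have inner: "(\<integral>\<^sup>+u. ennreal ((norm (x - ?g *\<^sub>R H x u - z))\<^sup>2) \<partial>\<nu>)
      \<le> ennreal ((1 - 2 * l * ?g + K * ?g\<^sup>2) * (norm (x - z))\<^sup>2 + K * ?g\<^sup>2)" for x
  proof -
    let ?c = "?g\<^sup>2 * (K * (1 + (norm (x - z))\<^sup>2))"
    have "(\<integral>\<^sup>+u. ennreal ((norm (- ?g *\<^sub>R H x u))\<^sup>2) \<partial>\<nu>) = ennreal (?g\<^sup>2) * (\<integral>\<^sup>+u. ennreal ((norm (H x u))\<^sup>2) \<partial>\<nu>)"
      by (subst nn_integral_cmult[symmetric]) (auto simp: power_mult_distrib ennreal_mult)
    also have "\<dots> \<le> ennreal (?g\<^sup>2) * ennreal (K * (1 + (norm (x - z))\<^sup>2))"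
      by (intro mult_left_mono growth) auto
    also have "\<dots> = ennreal ?c" using K_nonneg by (simp add: ennreal_mult)
    finally have "(\<integral>\<^sup>+u. ennreal ((norm (- ?g *\<^sub>R H x u))\<^sup>2) \<partial>\<nu>) \<le> ennreal ?c" .
    from nn_integral_norm_add_square_le(2)[OF prob_nu _ this, of "x - z"]
    have "(\<integral>\<^sup>+u. ennreal ((norm ((x - z) + - ?g *\<^sub>R H x u))\<^sup>2) \<partial>\<nu>) \<le>
        ennreal ((norm (x - z))\<^sup>2 + 2 * ((x - z) \<bullet> (\<integral>u. - ?g *\<^sub>R H x u \<partial>\<nu>)) + ?c)"
      using K_nonneg by auto
    also have "(\<integral>u. - ?g *\<^sub>R H x u \<partial>\<nu>) = - ?g *\<^sub>R h x" by (simp add: h_eq)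
    also have "ennreal ((norm (x - z))\<^sup>2 + 2 * ((x - z) \<bullet> (- ?g *\<^sub>R h x)) + ?c) \<le>
       ennreal ((1 - 2 * l * ?g + K * ?g\<^sup>2) * (norm (x - z))\<^sup>2 + K * ?g\<^sup>2)"
    proof (rule ennreal_leI)
      have "?g * (l * (norm (x - z))\<^sup>2) \<le> ?g * ((x - z) \<bullet> h x)" using mono g_pos[of p] by (intro mult_left_mono) auto
      then show "(norm (x - z))\<^sup>2 + 2 * ((x - z) \<bullet> (- ?g *\<^sub>R h x)) + ?c \<le>
          (1 - 2 * l * ?g + K * ?g\<^sup>2) * (norm (x - z))\<^sup>2 + K * ?g\<^sup>2"
        by (simp add: algebra_simps)
    qed
    finally show ?thesis by (simp add: algebra_simps)
  qed
  have "(\<integral>\<^sup>+\<omega>. ennreal ((norm (\<theta> (Suc p) \<omega> - z))\<^sup>2) \<partial>M)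
      = (\<integral>\<^sup>+\<omega>. (case (\<theta> p \<omega>, V (Suc p) \<omega>) of (x, u) \<Rightarrow> ennreal ((norm (x - ?g *\<^sub>R H x u - z))\<^sup>2)) \<partial>M)"
    by (intro nn_integral_cong) (simp add: scheme)
  also have "\<dots> = (\<integral>\<^sup>+\<omega>. (\<integral>\<^sup>+u. (case (\<theta> p \<omega>, u) of (x, u) \<Rightarrow> ennreal ((norm (x - ?g *\<^sub>R H x u - z))\<^sup>2)) \<partial>\<nu>) \<partial>M)"
    by (rule recursive_chain_nn_integral[where Y=\<theta> and F="\<lambda>x. x" and G="\<lambda>p (x, u). x - g (Suc p) *\<^sub>R H x u",
        OF V_indep init_indep]) (auto simp: scheme V_law)
  also have "\<dots> \<le> (\<integral>\<^sup>+\<omega>. ennreal ((1 - 2 * l * ?g + K * ?g\<^sup>2) * (norm (\<theta> p \<omega> - z))\<^sup>2 + K * ?g\<^sup>2) \<partial>M)"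
    unfolding prod.case by (intro nn_integral_mono inner)
  also have "\<dots> \<le> ennreal ((1 - 2 * l * ?g + K * ?g\<^sup>2) * msq_bound g l K A0 p + K * ?g\<^sup>2)"
    using Suc.IH msq_coeff_nonneg[OF const(1,3)] K_nonneg msq_bound_nonneg[OF const(1,3)]
    by (intro nn_integral_affine_le) (auto intro: prob_space_axioms)
  finally show ?case by simp
qed

text \<open>Conditionally centred increments are orthogonal, so the second moments add up.\<close>

lemma additive_functional_second_moment:
  fixes D :: "'d \<times> 'q \<Rightarrow> 'd"
  assumes D [measurable]: "D \<in> borel_measurable (borel \<Otimes>\<^sub>M borel)"
    and mean: "\<And>x. (\<integral>u. D (x, u) \<partial>\<nu>) = 0"
    and sq: "\<And>x. (\<integral>\<^sup>+u. ennreal ((norm (D (x, u)))\<^sup>2) \<partial>\<nu>) \<le> ennreal (\<phi> x)"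
    and \<phi>: "\<And>x. 0 \<le> \<phi> x" and \<phi>m [measurable]: "\<phi> \<in> borel_measurable borel"
  shows "(\<integral>\<^sup>+\<omega>. ennreal ((norm (\<Sum>k<p. D (\<theta> k \<omega>, V (Suc k) \<omega>)))\<^sup>2) \<partial>M) \<le> (\<Sum>k<p. \<integral>\<^sup>+\<omega>. ennreal (\<phi> (\<theta> k \<omega>)) \<partial>M)"
proof (induction p)
  case (Suc p)
  let ?S = "\<lambda>p \<omega>. \<Sum>k<p. D (\<theta> k \<omega>, V (Suc k) \<omega>)"
  have inner: "(\<integral>\<^sup>+u. ennreal ((norm (s + D (x, u)))\<^sup>2) \<partial>\<nu>) \<le> ennreal ((norm s)\<^sup>2) + ennreal (\<phi> x)" for s x
    using nn_integral_norm_add_square_le(2)[OF prob_nu _ sq \<phi>, of x s] \<phi>[of x] by (simp add: mean ennreal_plus)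
  have f[measurable]: "fst \<in> borel_measurable (borel :: ('d \<times> 'd) measure)" "snd \<in> borel_measurable (borel :: ('d \<times> 'd) measure)"
    by (auto intro!: borel_measurable_continuous_onI continuous_intros)
  \<comment> \<open>The state carries the running sum next to the iterate, so that the sum is
    independent of the next innovation and the centring of \<open>D\<close> removes the cross
    term.\<close>
  let ?G = "\<lambda>p (y, u). (fst y - g (Suc p) *\<^sub>R H (fst y) u, snd y + D (fst y, u))"
  have [measurable]: "(\<lambda>x. fst (fst x)) \<in> borel_measurable ((borel :: ('d \<times> 'd) measure) \<Otimes>\<^sub>M (borel :: 'q measure))"
    "(\<lambda>x. snd (fst x)) \<in> borel_measurable ((borel :: ('d \<times> 'd) measure) \<Otimes>\<^sub>M (borel :: 'q measure))"
    by (rule measurable_compose[OF measurable_fst f(1)], rule measurable_compose[OF measurable_fst f(2)])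
  have Gm: "?G p \<in> borel_measurable ((borel :: ('d \<times> 'd) measure) \<Otimes>\<^sub>M borel)" for p
    unfolding case_prod_beta by (rule borel_measurable_Pair) measurable
  have km: "(\<lambda>(y, u). ennreal ((norm (snd y + D (fst y, u)))\<^sup>2)) \<in> borel_measurable ((borel :: ('d \<times> 'd) measure) \<Otimes>\<^sub>M borel)"
    unfolding case_prod_beta by measurable
  have "(\<integral>\<^sup>+\<omega>. ennreal ((norm (?S (Suc p) \<omega>))\<^sup>2) \<partial>M)
      = (\<integral>\<^sup>+\<omega>. (case ((\<theta> p \<omega>, ?S p \<omega>), V (Suc p) \<omega>) of (y, u) \<Rightarrow> ennreal ((norm (snd y + D (fst y, u)))\<^sup>2)) \<partial>M)"
    by simp
  also have "\<dots> = (\<integral>\<^sup>+\<omega>. (\<integral>\<^sup>+u. (case ((\<theta> p \<omega>, ?S p \<omega>), u) of (y, u) \<Rightarrow> ennreal ((norm (snd y + D (fst y, u)))\<^sup>2)) \<partial>\<nu>) \<partial>M)"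
    by (rule recursive_chain_nn_integral[where Y="\<lambda>p \<omega>. (\<theta> p \<omega>, ?S p \<omega>)" and F="\<lambda>x. (x, 0)" and G="?G",
        OF V_indep init_indep _ _ _ Gm _ km]) (auto simp: scheme V_law)
  also have "\<dots> \<le> (\<integral>\<^sup>+\<omega>. ennreal ((norm (?S p \<omega>))\<^sup>2) + ennreal (\<phi> (\<theta> p \<omega>)) \<partial>M)"
    unfolding prod.case fst_conv snd_conv by (intro nn_integral_mono inner)
  also have "\<dots> = (\<integral>\<^sup>+\<omega>. ennreal ((norm (?S p \<omega>))\<^sup>2) \<partial>M) + (\<integral>\<^sup>+\<omega>. ennreal (\<phi> (\<theta> p \<omega>)) \<partial>M)"
    by (rule nn_integral_add) measurable
  also have "\<dots> \<le> (\<Sum>k<Suc p. \<integral>\<^sup>+\<omega>. ennreal (\<phi> (\<theta> k \<omega>)) \<partial>M)"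
    using Suc.IH by (simp add: add_mono)
  finally show ?case .
qed simp

end

text \<open>Takes the place of Jensen's inequality for the concave power: if \<open>t\<close> bounds
  the mean of y, integration bounds the mean of y powr b by 2 t powr b.\<close>

lemma powr_le_affine:
  fixes y t b :: real
  assumes "0 \<le> y" "0 < t" "0 < b" "b \<le> 1"
  shows "y powr b \<le> t powr (b - 1) * y + t powr b"
proof (cases "y \<le> t")
  case True
  then have "y powr b \<le> t powr b" using assms by (intro powr_mono2) auto
  then show ?thesis using assms by (simp add: add_increasing)
next
  case False
  then have y: "y > 0" using assms by auto
  have "y powr b = y powr (b - 1) * y" using y by (simp add: powr_diff)
  also have "\<dots> \<le> t powr (b - 1) * y" using False assms by (intro mult_right_mono powr_mono2') auto
  finally show ?thesis by (simp add: add_increasing2)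
qed

context sa_scheme
begin

lemma deviation_L1:
  shows "integrable M (\<lambda>\<omega>. \<theta> p \<omega> - z)" "integrable M (\<lambda>\<omega>. (norm (\<theta> p \<omega> - z))\<^sup>2)"
    "expectation (\<lambda>\<omega>. (norm (\<theta> p \<omega> - z))\<^sup>2) \<le> msq_bound g l K A0 p"
    "expectation (\<lambda>\<omega>. norm (\<theta> p \<omega> - z)) \<le> sqrt (msq_bound g l K A0 p)"
proof -
  have m: "(\<lambda>\<omega>. \<theta> p \<omega> - z) \<in> borel_measurable M" by measurable
  note E = expectation_norm_le_sqrt[OF m second_moment_le msq_bound_nonneg[OF const(1,3)]]
  show "integrable M (\<lambda>\<omega>. \<theta> p \<omega> - z)" "integrable M (\<lambda>\<omega>. (norm (\<theta> p \<omega> - z))\<^sup>2)"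
    "expectation (\<lambda>\<omega>. (norm (\<theta> p \<omega> - z))\<^sup>2) \<le> msq_bound g l K A0 p"
    "expectation (\<lambda>\<omega>. norm (\<theta> p \<omega> - z)) \<le> sqrt (msq_bound g l K A0 p)"
    by (rule E)+
qed

text \<open>The summands are centred because \<open>h z = 0\<close>, and \<open>growth\<close> at
  \<open>z\<close> bounds each of their second moments by \<open>K\<close>.\<close>

lemma noise_L1:
  shows "integrable M (\<lambda>\<omega>. \<Sum>p<m. H z (V (Suc p) \<omega>))"
    "expectation (\<lambda>\<omega>. norm (\<Sum>p<m. H z (V (Suc p) \<omega>))) \<le> sqrt (real m * K)"
proof -
  have meas: "(\<lambda>\<omega>. \<Sum>p<m. H z (V (Suc p) \<omega>)) \<in> borel_measurable M" by measurable
  have "(\<integral>\<^sup>+\<omega>. ennreal ((norm (\<Sum>k<m. (\<lambda>(x, u). H z u) (\<theta> k \<omega>, V (Suc k) \<omega>)))\<^sup>2) \<partial>M) \<le> (\<Sum>k<m. \<integral>\<^sup>+\<omega>. ennreal K \<partial>M)"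
    by (rule additive_functional_second_moment)
      (use h_eq[of z] h_zero growth[of z] K_nonneg in auto)
  then have "(\<integral>\<^sup>+\<omega>. ennreal ((norm (\<Sum>p<m. H z (V (Suc p) \<omega>)))\<^sup>2) \<partial>M) \<le> ennreal (real m * K)"
    using K_nonneg by (simp add: emeasure_space_1 ennreal_mult ennreal_of_nat_eq_real_of_nat)
  from expectation_norm_le_sqrt[OF meas this] K_nonneg
  show "integrable M (\<lambda>\<omega>. \<Sum>p<m. H z (V (Suc p) \<omega>))"
    "expectation (\<lambda>\<omega>. norm (\<Sum>p<m. H z (V (Suc p) \<omega>))) \<le> sqrt (real m * K)" by auto
qed

text \<open>The sum of \<open>D\<close> is what remains after the noise is frozen at
  \<open>z\<close>. Orthogonality bounds its second moment by a sum of moments of order 2b of the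
  errors, hence by a multiple of the sum of (p + 1) powr (- s b), which is o(m) once s b >
  0.\<close>

lemma replacement_error_L1:
  assumes decay: "\<And>p. msq_bound g l K A0 p \<le> A * (real p + 1) powr (- s)" and A: "0 < A"
  defines "D \<equiv> \<lambda>p \<omega>. H (\<theta> p \<omega>) (V (Suc p) \<omega>) - h (\<theta> p \<omega>) - H z (V (Suc p) \<omega>)"
  shows "integrable M (\<lambda>\<omega>. \<Sum>p<m. D p \<omega>)"
    "expectation (\<lambda>\<omega>. norm (\<Sum>p<m. D p \<omega>)) \<le> sqrt (2 * C * A powr b * (\<Sum>p<m. (real p + 1) powr (- (s * b))))"
proof -
  have meas: "(\<lambda>\<omega>. \<Sum>p<m. D p \<omega>) \<in> borel_measurable M" unfolding D_def by measurable
  let ?D = "\<lambda>(x, u). H x u - h x - H z u" and ?\<phi> = "\<lambda>x. C * ((norm (x - z))\<^sup>2) powr b"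
  have mean: "(\<integral>u. H x u - H z u \<partial>\<nu>) = h x" for x
    using H_integrable h_eq[of z] h_zero by (simp add: h_eq)
  \<comment> \<open>Subtracting the mean \<open>h x\<close> does not increase the second moment, so
    the Hoelder bound for H x - H z also covers the centred increment.\<close>
  have sq: "(\<integral>\<^sup>+u. ennreal ((norm (?D (x, u)))\<^sup>2) \<partial>\<nu>) \<le> ennreal (?\<phi> x)" for x
  proof -
    have "(\<integral>\<^sup>+u. ennreal ((norm (- h x + (H x u - H z u)))\<^sup>2) \<partial>\<nu>) \<le>
      ennreal ((norm (- h x))\<^sup>2 + 2 * (- h x \<bullet> (\<integral>u. H x u - H z u \<partial>\<nu>)) + ?\<phi> x)"
      by (rule nn_integral_norm_add_square_le(2)[OF prob_nu _ holder]) (use const in auto)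
    also have "\<dots> \<le> ennreal (?\<phi> x)" unfolding mean by (intro ennreal_leI) (simp add: power2_norm_eq_inner)
    finally show ?thesis by (simp add: algebra_simps)
  qed
  have "(\<integral>\<^sup>+\<omega>. ennreal ((norm (\<Sum>k<m. ?D (\<theta> k \<omega>, V (Suc k) \<omega>)))\<^sup>2) \<partial>M) \<le> (\<Sum>k<m. \<integral>\<^sup>+\<omega>. ennreal (?\<phi> (\<theta> k \<omega>)) \<partial>M)"
  proof (rule additive_functional_second_moment[OF _ _ sq])
    show "(\<integral>u. ?D (x, u) \<partial>\<nu>) = 0" for x
      using H_integrable h_eq[of z] h_zero by (simp add: h_eq \<nu>.prob_space)
    show "?D \<in> borel_measurable (borel \<Otimes>\<^sub>M borel)" unfolding case_prod_beta by measurable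
  qed (use const in auto)
  also have "\<dots> \<le> (\<Sum>k<m. ennreal (2 * C * A powr b * (real k + 1) powr (- (s * b))))"
  proof (rule sum_mono)
    fix k
    \<comment> \<open>\<open>powr_le_affine\<close> is used at the known bound for the second
      moment, the choice that makes its two terms equal after integration.\<close>
    let ?t = "A * (real k + 1) powr (- s)"
    have t: "?t > 0" using A by simp
    have "(\<integral>\<^sup>+\<omega>. ennreal (?\<phi> (\<theta> k \<omega>)) \<partial>M) \<le>
        (\<integral>\<^sup>+\<omega>. ennreal ((C * ?t powr (b - 1)) * (norm (\<theta> k \<omega> - z))\<^sup>2 + C * ?t powr b) \<partial>M)"
    proof (intro nn_integral_mono ennreal_leI)
      fix \<omega>
      have "?\<phi> (\<theta> k \<omega>) \<le> C * (?t powr (b - 1) * (norm (\<theta> k \<omega> - z))\<^sup>2 + ?t powr b)"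
        using const t by (intro mult_left_mono powr_le_affine) auto
      then show "?\<phi> (\<theta> k \<omega>) \<le> (C * ?t powr (b - 1)) * (norm (\<theta> k \<omega> - z))\<^sup>2 + C * ?t powr b"
        by (simp add: algebra_simps)
    qed
    also have "\<dots> \<le> ennreal ((C * ?t powr (b - 1)) * ?t + C * ?t powr b)"
      by (rule nn_integral_affine_le[OF prob_space_axioms])
        (use const t in \<open>auto intro!: order_trans[OF second_moment_le] ennreal_leI decay\<close>)
    also have "(C * ?t powr (b - 1)) * ?t = C * ?t powr b" using t by (simp add: powr_diff)
    also have "C * ?t powr b + C * ?t powr b = 2 * C * A powr b * (real k + 1) powr (- (s * b))"
      by (simp add: powr_mult powr_powr)
    finally show "(\<integral>\<^sup>+\<omega>. ennreal (?\<phi> (\<theta> k \<omega>)) \<partial>M) \<le> ennreal (2 * C * A powr b * (real k + 1) powr (- (s * b)))" .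
  qed
  also have "\<dots> = ennreal (2 * C * A powr b * (\<Sum>p<m. (real p + 1) powr (- (s * b))))"
    using const by (simp add: sum_ennreal sum_distrib_left)
  finally have "(\<integral>\<^sup>+\<omega>. ennreal ((norm (\<Sum>p<m. D p \<omega>))\<^sup>2) \<partial>M) \<le> ennreal (2 * C * A powr b * (\<Sum>p<m. (real p + 1) powr (- (s * b))))"
    by (simp add: D_def)
  moreover have "0 \<le> 2 * C * A powr b * (\<Sum>p<m. (real p + 1) powr (- (s * b)))"
    using const by (intro mult_nonneg_nonneg sum_nonneg) auto
  ultimately show "integrable M (\<lambda>\<omega>. \<Sum>p<m. D p \<omega>)"
    "expectation (\<lambda>\<omega>. norm (\<Sum>p<m. D p \<omega>)) \<le> sqrt (2 * C * A powr b * (\<Sum>p<m. (real p + 1) powr (- (s * b))))"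
    using expectation_norm_le_sqrt[OF meas] by blast+
qed

text \<open>The three summands of the bound are the telescoped, the Taylor and the martingale
  contribution, in this order. There are \<open>Suc N\<close> indices because the empirical mean up
  to \<open>N\<close> has that many terms. \<open>J\<close> is any linear map with the Taylor bound
  at \<open>z\<close>, so that each row can use the Jacobian at its own zero.\<close>

lemma linearization_L1:
  fixes J :: "'d \<Rightarrow> 'd"
  assumes J: "linear J" and taylor: "\<And>x. norm (h x - J (x - z)) \<le> L * (norm (x - z))\<^sup>2" and L: "0 \<le> L"
    and decay: "\<And>p. msq_bound g l K A0 p \<le> A * (real p + 1) powr (- s)" and A: "0 < A"
  defines "v \<equiv> \<lambda>p. (real p + 1) powr (- (s / 2))"
  shows "expectation (\<lambda>\<omega>. norm (J (\<Sum>p<Suc N. \<theta> p \<omega> - z) + (\<Sum>p<Suc N. H z (V (Suc p) \<omega>)))) \<le>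
    sqrt A * (v 0 / g 1 + v (Suc N) / g (Suc N) + (\<Sum>p<N. (1 / g (Suc (Suc p)) - 1 / g (Suc p)) * v (Suc p)))
    + L * A * (\<Sum>p<Suc N. (real p + 1) powr (- s))
    + sqrt (2 * C * A powr b * (\<Sum>p<Suc N. (real p + 1) powr (- (s * b))))"
    and "integrable M (\<lambda>\<omega>. J (\<Sum>p<Suc N. \<theta> p \<omega> - z) + (\<Sum>p<Suc N. H z (V (Suc p) \<omega>)))"
proof -
  define D where "D p \<omega> = H (\<theta> p \<omega>) (V (Suc p) \<omega>) - h (\<theta> p \<omega>) - H z (V (Suc p) \<omega>)" for p \<omega>
  let ?e = "\<lambda>p \<omega>. \<theta> p \<omega> - z" and ?\<rho> = "\<lambda>\<omega>. J (\<Sum>p<Suc N. \<theta> p \<omega> - z) + (\<Sum>p<Suc N. H z (V (Suc p) \<omega>))"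
  let ?T = "\<lambda>\<omega>. norm (?e 0 \<omega>) / g 1 + norm (?e (Suc N) \<omega>) / g (Suc N) + (\<Sum>p<N. (1 / g (Suc (Suc p)) - 1 / g (Suc p)) * norm (?e (Suc p) \<omega>))"
  have bl: "bounded_linear J" using J linear_conv_bounded_linear by blast
  \<comment> \<open>Here the monotonicity of the steps enters: nonnegative increments of 1/g may be
    taken out of the norms after Abel summation.\<close>
  have ig: "0 \<le> 1 / g (Suc (Suc p)) - 1 / g (Suc p)" for p
    using g_pos g_dec[of p] by (simp add: frac_le)
  \<comment> \<open>Pathwise, the triangle inequality is applied term by term except to the sum of
    \<open>D\<close>, whose cancellation is needed and is available only in mean square.\<close>
  have bound: "norm (?\<rho> \<omega>) \<le> ?T \<omega> + (\<Sum>p<Suc N. L * (norm (?e p \<omega>))\<^sup>2) + norm (\<Sum>p<Suc N. D p \<omega>)" if \<omega>: "\<omega> \<in> space M" for \<omega>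
  proof -
    have step: "J (?e p \<omega>) + H z (V (Suc p) \<omega>) = (1 / g (Suc p)) *\<^sub>R (?e p \<omega> - ?e (Suc p) \<omega>) - (h (\<theta> p \<omega>) - J (?e p \<omega>)) - D p \<omega>" for p
    proof -
      have "(1 / g (Suc p)) *\<^sub>R (?e p \<omega> - ?e (Suc p) \<omega>) = H (\<theta> p \<omega>) (V (Suc p) \<omega>)"
        using scheme[OF \<omega>, of p] g_pos[of p] by simp
      then show ?thesis by (simp add: D_def)
    qed
    have "?\<rho> \<omega> = (\<Sum>p<Suc N. J (?e p \<omega>) + H z (V (Suc p) \<omega>))"
      by (simp only: linear_sum[OF J] sum.distrib)
    also have "\<dots> = (\<Sum>p<Suc N. (1 / g (Suc p)) *\<^sub>R (?e p \<omega> - ?e (Suc p) \<omega>)) - (\<Sum>p<Suc N. h (\<theta> p \<omega>) - J (?e p \<omega>)) - (\<Sum>p<Suc N. D p \<omega>)"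
      unfolding step by (simp only: sum_subtractf)
    finally have eq: "?\<rho> \<omega> = (\<Sum>p<Suc N. (1 / g (Suc p)) *\<^sub>R (?e p \<omega> - ?e (Suc p) \<omega>)) - (\<Sum>p<Suc N. h (\<theta> p \<omega>) - J (?e p \<omega>)) - (\<Sum>p<Suc N. D p \<omega>)" .
    have tri: "norm (a - b - c) \<le> norm a + norm b + norm c" "norm (a - b + c) \<le> norm a + norm b + norm c" for a b c :: 'd
      using norm_triangle_ineq4[of "a - b" c] norm_triangle_ineq[of "a - b" c] norm_triangle_ineq4[of a b] by linarith+
    have "norm (?\<rho> \<omega>) \<le> norm (\<Sum>p<Suc N. (1 / g (Suc p)) *\<^sub>R (?e p \<omega> - ?e (Suc p) \<omega>)) + norm (\<Sum>p<Suc N. h (\<theta> p \<omega>) - J (?e p \<omega>)) + norm (\<Sum>p<Suc N. D p \<omega>)"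
      unfolding eq by (rule tri)
    moreover have "norm (\<Sum>p<Suc N. h (\<theta> p \<omega>) - J (?e p \<omega>)) \<le> (\<Sum>p<Suc N. L * (norm (?e p \<omega>))\<^sup>2)"
      by (rule sum_norm_le) (rule taylor)
    moreover have "norm (\<Sum>p<Suc N. (1 / g (Suc p)) *\<^sub>R (?e p \<omega> - ?e (Suc p) \<omega>)) \<le> ?T \<omega>"
    proof -
      have "norm ((1 / g 1) *\<^sub>R ?e 0 \<omega> - (1 / g (Suc N)) *\<^sub>R ?e (Suc N) \<omega> + (\<Sum>p<N. (1 / g (Suc (Suc p)) - 1 / g (Suc p)) *\<^sub>R ?e (Suc p) \<omega>))
        \<le> norm ((1 / g 1) *\<^sub>R ?e 0 \<omega>) + norm ((1 / g (Suc N)) *\<^sub>R ?e (Suc N) \<omega>) + norm (\<Sum>p<N. (1 / g (Suc (Suc p)) - 1 / g (Suc p)) *\<^sub>R ?e (Suc p) \<omega>)"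
        by (rule tri)
      moreover have "norm (\<Sum>p<N. (1 / g (Suc (Suc p)) - 1 / g (Suc p)) *\<^sub>R ?e (Suc p) \<omega>) \<le> (\<Sum>p<N. (1 / g (Suc (Suc p)) - 1 / g (Suc p)) * norm (?e (Suc p) \<omega>))"
        by (rule sum_norm_le) (use ig in simp)
      ultimately show ?thesis
        unfolding sum_by_parts_steps[of "\<lambda>p. 1 / g p" "\<lambda>p. ?e p \<omega>" N] using g_pos[of 0] g_pos[of N] by simp
    qed
    ultimately show ?thesis by linarith
  qed
  have ie: "integrable M (\<lambda>\<omega>. ?e p \<omega>)" and ie2: "integrable M (\<lambda>\<omega>. (norm (?e p \<omega>))\<^sup>2)" for p
    by (rule deviation_L1)+
  have iD: "integrable M (\<lambda>\<omega>. \<Sum>p<Suc N. D p \<omega>)" unfolding D_def by (rule replacement_error_L1[OF decay A])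
  show ir: "integrable M ?\<rho>"
    by (intro Bochner_Integration.integrable_add integrable_bounded_linear[OF bl] Bochner_Integration.integrable_sum ie noise_L1)
  have iT: "integrable M ?T"
    by (intro Bochner_Integration.integrable_add Bochner_Integration.integrable_sum integrable_mult_right integrable_divide integrable_norm ie)
  have iS: "integrable M (\<lambda>\<omega>. \<Sum>p<Suc N. L * (norm (?e p \<omega>))\<^sup>2)"
    by (intro Bochner_Integration.integrable_sum integrable_mult_right ie2)
  have e1: "expectation (\<lambda>\<omega>. norm (?e p \<omega>)) \<le> sqrt A * v p" for p
  proof -
    have "expectation (\<lambda>\<omega>. norm (?e p \<omega>)) \<le> sqrt (A * (real p + 1) powr (- s))"
      using deviation_L1(4)[of p] decay[of p] real_sqrt_le_mono order_trans by blast
    also have "\<dots> = sqrt A * v p" by (simp add: v_def real_sqrt_mult powr_half_sqrt[symmetric] powr_powr)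
    finally show ?thesis .
  qed
  have "expectation (\<lambda>\<omega>. norm (?\<rho> \<omega>)) \<le> expectation (\<lambda>\<omega>. ?T \<omega> + (\<Sum>p<Suc N. L * (norm (?e p \<omega>))\<^sup>2) + norm (\<Sum>p<Suc N. D p \<omega>))"
    by (intro integral_mono integrable_norm ir Bochner_Integration.integrable_add iT iS iD bound)
  also have "\<dots> = expectation ?T + expectation (\<lambda>\<omega>. \<Sum>p<Suc N. L * (norm (?e p \<omega>))\<^sup>2) + expectation (\<lambda>\<omega>. norm (\<Sum>p<Suc N. D p \<omega>))"
    by (subst Bochner_Integration.integral_add[OF Bochner_Integration.integrable_add[OF iT iS] integrable_norm[OF iD]],
        subst Bochner_Integration.integral_add[OF iT iS]) (rule refl)
  also have "\<dots> \<le> sqrt A * (v 0 / g 1 + v (Suc N) / g (Suc N) + (\<Sum>p<N. (1 / g (Suc (Suc p)) - 1 / g (Suc p)) * v (Suc p)))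
    + L * A * (\<Sum>p<Suc N. (real p + 1) powr (- s))
    + sqrt (2 * C * A powr b * (\<Sum>p<Suc N. (real p + 1) powr (- (s * b))))"
  proof (intro add_mono)
    have ien: "integrable M (\<lambda>\<omega>. norm (?e p \<omega>))" for p by (rule integrable_norm[OF ie])
    have "expectation ?T = expectation (\<lambda>\<omega>. norm (?e 0 \<omega>)) / g 1 + expectation (\<lambda>\<omega>. norm (?e (Suc N) \<omega>)) / g (Suc N) +
      (\<Sum>p<N. (1 / g (Suc (Suc p)) - 1 / g (Suc p)) * expectation (\<lambda>\<omega>. norm (?e (Suc p) \<omega>)))"
      using ien by simp
    also have "\<dots> \<le> (sqrt A * v 0) / g 1 + (sqrt A * v (Suc N)) / g (Suc N) +
      (\<Sum>p<N. (1 / g (Suc (Suc p)) - 1 / g (Suc p)) * (sqrt A * v (Suc p)))"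
      using g_pos[of 0] g_pos[of N] ig by (intro add_mono sum_mono mult_left_mono divide_right_mono e1) auto
    also have "\<dots> = sqrt A * (v 0 / g 1 + v (Suc N) / g (Suc N) + (\<Sum>p<N. (1 / g (Suc (Suc p)) - 1 / g (Suc p)) * v (Suc p)))"
      by (simp add: distrib_left sum_distrib_left mult_ac)
    finally show "expectation ?T \<le> \<dots>" .
    have "expectation (\<lambda>\<omega>. \<Sum>p<Suc N. L * (norm (?e p \<omega>))\<^sup>2) = (\<Sum>p<Suc N. L * expectation (\<lambda>\<omega>. (norm (?e p \<omega>))\<^sup>2))"
      using ie2 by (subst Bochner_Integration.integral_sum) auto
    also have "\<dots> \<le> (\<Sum>p<Suc N. L * (A * (real p + 1) powr (- s)))"
      using L by (intro sum_mono mult_left_mono order_trans[OF deviation_L1(3) decay]) auto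
    also have "\<dots> = L * A * (\<Sum>p<Suc N. (real p + 1) powr (- s))" by (simp add: sum_distrib_left mult.assoc del: sum.lessThan_Suc)
    finally show "expectation (\<lambda>\<omega>. \<Sum>p<Suc N. L * (norm (?e p \<omega>))\<^sup>2) \<le> L * A * (\<Sum>p<Suc N. (real p + 1) powr (- s))" .
    show "expectation (\<lambda>\<omega>. norm (\<Sum>p<Suc N. D p \<omega>)) \<le> sqrt (2 * C * A powr b * (\<Sum>p<Suc N. (real p + 1) powr (- (s * b))))"
      unfolding D_def by (rule replacement_error_L1[OF decay A])
  qed
  finally show "expectation (\<lambda>\<omega>. norm (?\<rho> \<omega>)) \<le> sqrt A * (v 0 / g 1 + v (Suc N) / g (Suc N) + (\<Sum>p<N. (1 / g (Suc (Suc p)) - 1 / g (Suc p)) * v (Suc p)))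
    + L * A * (\<Sum>p<Suc N. (real p + 1) powr (- s))
    + sqrt (2 * C * A powr b * (\<Sum>p<Suc N. (real p + 1) powr (- (s * b))))" .
qed

end

section \<open>Asymptotics in the row index\<close>

text \<open>The norm of a matrix is the Frobenius norm, the Euclidean norm of the norms of the rows,
  so Cauchy-Schwarz for each row suffices.\<close>

lemma norm_matrix_vector_mult_le:
  fixes A :: "real^'n^'m"
  shows "norm (A *v x) \<le> norm A * norm x"
proof -
  have "norm (A *v x) \<le> L2_set (\<lambda>i. norm (A $ i) * norm x) UNIV"
    unfolding norm_vec_def
  proof (rule L2_set_mono)
    fix i
    have "(A *v x) $ i = A $ i \<bullet> x" by (simp add: matrix_vector_mult_def inner_vec_def)
    then show "norm ((A *v x) $ i) \<le> L2_set (\<lambda>j. norm (A $ i $ j)) UNIV * L2_set (\<lambda>j. norm (x $ j)) UNIV"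
      using Cauchy_Schwarz_ineq2[of "A $ i" x] by (simp add: norm_vec_def)
  qed simp
  also have "\<dots> = norm A * norm x"
    by (simp add: L2_set_left_distrib[symmetric] norm_vec_def[of A])
  finally show ?thesis .
qed

text \<open>Mean value inequality on the segment from y to x, along which the Jacobian moves by at
  most L |x - y|.\<close>

lemma taylor_lipschitz_jacobian:
  fixes f :: "real^'n \<Rightarrow> real^'m"
  assumes der: "\<And>x. f differentiable (at x)"
    and lip: "L-lipschitz_on UNIV (\<lambda>x. jacobian f (at x))"
  shows "norm (f x - f y - jacobian f (at y) *v (x - y)) \<le> L * (norm (x - y))\<^sup>2"
proof -
  let ?J = "\<lambda>x. jacobian f (at x)"
  have "norm (f x - f y - ?J y *v (x - y)) \<le> norm (x - y) * (L * norm (x - y))"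
  proof (rule differentiable_bound_linearization[where S="closed_segment y x" and f'="\<lambda>x v. ?J x *v v"])
    show "y + t *\<^sub>R (x - y) \<in> closed_segment y x" if "t \<in> {0..1}" for t
      using that unfolding closed_segment_def by (auto intro!: exI[of _ t] simp: algebra_simps)
    show "(f has_derivative (\<lambda>v. ?J u *v v)) (at u within closed_segment y x)" for u
      using der jacobian_works has_derivative_at_withinI by blast
    show "onorm ((\<lambda>v. ?J u *v v) - (\<lambda>v. ?J y *v v)) \<le> L * norm (x - y)" if u: "u \<in> closed_segment y x" for u
      unfolding fun_diff_def
    proof (rule onorm_le)
      fix v
      have "norm (?J u *v v - ?J y *v v) \<le> norm (?J u - ?J y) * norm v"
        using norm_matrix_vector_mult_le[of "?J u - ?J y" v] by (simp add: matrix_vector_mult_diff_rdistrib)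
      also have "norm (?J u - ?J y) \<le> L * norm (u - y)"
        using lipschitz_onD[OF lip, of u y] by (simp add: dist_norm)
      also have "\<dots> \<le> L * norm (x - y)"
        using segment_bound(1)[OF u] lipschitz_on_nonneg[OF lip] by (intro mult_left_mono) auto
      finally show "norm (?J u *v v - ?J y *v v) \<le> L * norm (x - y) * norm v" by (simp add: mult_right_mono)
    qed
  qed auto
  then show ?thesis by (simp add: power2_eq_square mult_ac)
qed

lemma tendsto_matrix_vector_mult [tendsto_intros]:
  fixes A :: "nat \<Rightarrow> real^'n^'m"
  assumes "A \<longlonglongrightarrow> B" "x \<longlonglongrightarrow> y"
  shows "(\<lambda>n. A n *v x n) \<longlonglongrightarrow> B *v y"
  unfolding matrix_vector_mult_def
  by (intro tendsto_vec_lambda tendsto_sum tendsto_mult tendsto_vec_nth assms)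

text \<open>Strong monotonicity tested at y, with Cauchy-Schwarz, bounds l |y - zn|^2 by |y - zn|
  |hn y|, and one factor cancels. The resulting rate is reused for the scaled zeros.\<close>

lemma zeros_tendsto:
  fixes hn :: "nat \<Rightarrow> 'a::euclidean_space \<Rightarrow> 'a"
  assumes l: "0 < l" and mono: "\<And>n. n \<ge> 1 \<Longrightarrow> l * (norm (y - zn n))\<^sup>2 \<le> (y - zn n) \<bullet> hn n y"
    and lim: "(\<lambda>n. hn n y) \<longlonglongrightarrow> 0"
  shows "\<And>n. n \<ge> 1 \<Longrightarrow> norm (zn n - y) \<le> norm (hn n y) / l" and "zn \<longlonglongrightarrow> y"
proof -
  show b: "norm (zn n - y) \<le> norm (hn n y) / l" if n: "n \<ge> 1" for n
  proof (cases "zn n = y")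
    case False
    have "l * (norm (y - zn n))\<^sup>2 \<le> norm (y - zn n) * norm (hn n y)"
      using mono[OF n] Cauchy_Schwarz_ineq2[of "y - zn n" "hn n y"] by linarith
    then have "l * norm (y - zn n) \<le> norm (hn n y)" using False by (simp add: power2_eq_square)
    then show ?thesis using l by (simp add: pos_le_divide_eq mult.commute norm_minus_commute)
  qed (use l in simp)
  have "(\<lambda>n. norm (hn n y) / l) \<longlonglongrightarrow> 0"
    using tendsto_divide[OF tendsto_norm_zero[OF lim] tendsto_const, of l] l by simp
  then have "(\<lambda>n. zn n - y) \<longlonglongrightarrow> 0"
    by (rule Lim_null_comparison[rotated]) (use b in \<open>auto simp: eventually_sequentially\<close>)
  then show "zn \<longlonglongrightarrow> y" by (simp add: LIM_zero_iff)
qed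

text \<open>\<open>taylor\<close> says that \<open>hn n y\<close> is close to J n (y - zn n), a
  linearization at the zero evaluated at y. After scaling by \<open>r n\<close> this shows that D
  applied to \<open>c n\<close> tends to -E. The rate in \<open>bound\<close> keeps
  \<open>c n\<close> bounded, so the scaled quadratic remainder, of order |c n| |y - zn n|,
  vanishes.\<close>

lemma scaled_zeros_tendsto:
  fixes hn :: "nat \<Rightarrow> real^'d \<Rightarrow> real^'d" and J :: "nat \<Rightarrow> real^'d^'d" and r :: "nat \<Rightarrow> real"
  assumes l: "0 < l" and bound: "\<And>n. n \<ge> 1 \<Longrightarrow> norm (zn n - y) \<le> norm (hn n y) / l"
    and taylor: "\<And>n. n \<ge> 1 \<Longrightarrow> norm (hn n y - J n *v (y - zn n)) \<le> L * (norm (y - zn n))\<^sup>2"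
    and z: "zn \<longlonglongrightarrow> y" and J: "J \<longlonglongrightarrow> D" and D: "invertible D"
    and r: "\<And>n. 0 \<le> r n" and lim: "(\<lambda>n. r n *\<^sub>R hn n y) \<longlonglongrightarrow> E"
  shows "(\<lambda>n. r n *\<^sub>R (zn n - y)) \<longlonglongrightarrow> - (matrix_inv D *v E)"
proof -
  define c where "c n = r n *\<^sub>R (zn n - y)" for n
  obtain B where B: "\<And>n. norm (r n *\<^sub>R hn n y) \<le> B" using convergent_imp_Bseq[OF convergentI[OF lim]] by (auto simp: Bseq_def)
  have cb: "norm (c n) \<le> B / l" if "n \<ge> 1" for n
  proof -
    have "norm (c n) \<le> r n * (norm (hn n y) / l)" unfolding c_def norm_scaleR abs_of_nonneg[OF r] by (intro mult_left_mono bound that r)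
    also have "\<dots> = norm (r n *\<^sub>R hn n y) / l" using r[of n] by simp
    also have "\<dots> \<le> B / l" using B l by (intro divide_right_mono) auto
    finally show ?thesis .
  qed
  have e0: "(\<lambda>n. \<bar>L\<bar> * (B / l) * norm (y - zn n) + norm (D - J n) * (B / l)) \<longlonglongrightarrow> 0"
  proof -
    have "(\<lambda>n. \<bar>L\<bar> * (B / l) * norm (y - zn n) + norm (D - J n) * (B / l)) \<longlonglongrightarrow> \<bar>L\<bar> * (B / l) * norm (y - y) + norm (D - D) * (B / l)"
      by (intro tendsto_intros z J)
    then show ?thesis by simp
  qed
  have "(\<lambda>n. D *v c n + r n *\<^sub>R hn n y) \<longlonglongrightarrow> 0"
  proof (rule Lim_null_comparison[OF _ e0])
    have "norm (D *v c n + r n *\<^sub>R hn n y) \<le> \<bar>L\<bar> * (B / l) * norm (y - zn n) + norm (D - J n) * (B / l)" if n: "n \<ge> 1" for n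
    proof -
      have "D *v c n + r n *\<^sub>R hn n y = r n *\<^sub>R (hn n y - J n *v (y - zn n)) + (D - J n) *v c n"
        by (simp add: c_def matrix_vector_mult_diff_rdistrib matrix_vector_mult_scaleR matrix_vector_mult_diff_distrib algebra_simps)
      also have "norm \<dots> \<le> norm (r n *\<^sub>R (hn n y - J n *v (y - zn n))) + norm ((D - J n) *v c n)" by (rule norm_triangle_ineq)
      also have "\<dots> \<le> \<bar>L\<bar> * (B / l) * norm (y - zn n) + norm (D - J n) * (B / l)"
      proof (rule add_mono)
        have "norm (r n *\<^sub>R (hn n y - J n *v (y - zn n))) \<le> r n * (\<bar>L\<bar> * (norm (y - zn n))\<^sup>2)"
        proof -
          have "L * (norm (y - zn n))\<^sup>2 \<le> \<bar>L\<bar> * (norm (y - zn n))\<^sup>2" by (intro mult_right_mono) auto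
          then show ?thesis using taylor[OF n] r[of n] by (simp add: mult_left_mono)
        qed
        also have "\<dots> = \<bar>L\<bar> * norm (c n) * norm (y - zn n)" using r[of n] by (simp add: c_def power2_eq_square norm_minus_commute)
        also have "\<dots> \<le> \<bar>L\<bar> * (B / l) * norm (y - zn n)" using cb[OF n] by (intro mult_right_mono mult_left_mono) auto
        finally show "norm (r n *\<^sub>R (hn n y - J n *v (y - zn n))) \<le> \<bar>L\<bar> * (B / l) * norm (y - zn n)" .
        show "norm ((D - J n) *v c n) \<le> norm (D - J n) * (B / l)"
          by (rule order_trans[OF norm_matrix_vector_mult_le]) (intro mult_left_mono cb n, simp)
      qed
      finally show ?thesis .
    qed
    then show "eventually (\<lambda>n. norm (D *v c n + r n *\<^sub>R hn n y) \<le> \<bar>L\<bar> * (B / l) * norm (y - zn n) + norm (D - J n) * (B / l)) sequentially"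
      by (auto simp: eventually_sequentially)
  qed
  from tendsto_diff[OF this lim] have "(\<lambda>n. D *v c n) \<longlonglongrightarrow> - E" by simp
  from tendsto_matrix_vector_mult[OF tendsto_const this, of "matrix_inv D"]
  have "(\<lambda>n. matrix_inv D *v (D *v c n)) \<longlonglongrightarrow> matrix_inv D *v (- E)" .
  moreover have "matrix_inv D *v (D *v c n) = c n" for n
    by (simp add: matrix_vector_mul_assoc matrix_inv_props[OF D])
  moreover have "matrix_inv D *v (- E) = - (matrix_inv D *v E)"
    using matrix_vector_mult_scaleR[of "matrix_inv D" "-1" E] by simp
  ultimately show ?thesis by (simp add: c_def)
qed

lemma uniform_limit_diagonal:
  fixes f :: "nat \<Rightarrow> 'a::metric_space \<Rightarrow> 'b::metric_space"
  assumes f: "locally_uniform_limit f g" and g: "isCont g y" and z: "zn \<longlonglongrightarrow> y"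
  shows "(\<lambda>n. f n (zn n)) \<longlonglongrightarrow> g y"
proof -
  obtain S where S: "open S" "y \<in> S" "uniform_limit S f g sequentially"
    using f unfolding locally_uniform_limit_def by blast
  have ev: "eventually (\<lambda>n. zn n \<in> S) sequentially" using z S(1,2) by (rule topological_tendstoD)
  have gz: "(\<lambda>n. g (zn n)) \<longlonglongrightarrow> g y" using g z by (rule isCont_tendsto_compose)
  show ?thesis
  proof (rule metric_LIMSEQ_I)
    fix e :: real assume e: "e > 0"
    have "eventually (\<lambda>n. \<forall>x\<in>S. dist (f n x) (g x) < e / 2) sequentially"
      using S(3) e by (intro uniform_limitD) auto
    moreover have "eventually (\<lambda>n. dist (g (zn n)) (g y) < e / 2) sequentially" using gz e by (intro tendstoD) auto
    ultimately have "eventually (\<lambda>n. dist (f n (zn n)) (g y) < e) sequentially"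
      using ev
    proof eventually_elim
      case (elim n)
      then show ?case using dist_triangle[of "f n (zn n)" "g y" "g (zn n)"] by fastforce
    qed
    then show "\<exists>no. \<forall>n\<ge>no. dist (f n (zn n)) (g y) < e" by (simp add: eventually_sequentially)
  qed
qed

lemma locally_uniform_limit_pointwise:
  assumes "locally_uniform_limit f g"
  shows "(\<lambda>n. f n x) \<longlonglongrightarrow> g x"
proof -
  obtain S where "x \<in> S" "uniform_limit S f g sequentially"
    using assms unfolding locally_uniform_limit_def by blast
  then show ?thesis by (intro tendsto_uniform_limitI)
qed

lemma continuous_outer: "continuous_on UNIV (outer :: real^'d \<Rightarrow> real^'d^'d)"
  unfolding outer_def by (intro continuous_on_vec_lambda continuous_intros)

lemma outer_quadratic_form: "w \<bullet> (outer v *v w) = (w \<bullet> v)\<^sup>2"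
proof -
  have "outer v *v w = (v \<bullet> w) *\<^sub>R v"
    by (simp add: vec_eq_iff outer_def matrix_vector_mult_def inner_vec_def sum_distrib_left mult_ac)
  then show ?thesis by (simp add: power2_eq_square inner_commute)
qed

lemma norm_outer_le: "norm (outer v :: real^'d^'d) \<le> real CARD('d) * (norm v)\<^sup>2"
proof -
  have "norm (outer v) \<le> (\<Sum>i\<in>UNIV. norm (outer v $ i))"
    unfolding norm_vec_def[of "outer v"] by (rule L2_set_le_sum) simp
  also have "\<dots> \<le> (\<Sum>i\<in>(UNIV :: 'd set). (norm v)\<^sup>2)"
  proof (rule sum_mono)
    fix i
    have "outer v $ i = v $ i *\<^sub>R v" by (simp add: vec_eq_iff outer_def)
    then have "norm (outer v $ i) = \<bar>v $ i\<bar> * norm v" by simp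
    also have "\<dots> \<le> norm v * norm v" by (intro mult_right_mono component_le_norm_cart) auto
    finally show "norm (outer v $ i) \<le> (norm v)\<^sup>2" by (simp add: power2_eq_square)
  qed
  finally show ?thesis by simp
qed

text \<open>Links the second moment of the projection on w with the covariance matrix, as the
  one-dimensional limit theorem only sees projections.\<close>

lemma integral_outer_quadratic_form:
  fixes G :: "'b \<Rightarrow> real^'d"
  assumes [measurable]: "G \<in> borel_measurable \<nu>" and i2: "integrable \<nu> (\<lambda>u. (norm (G u))\<^sup>2)"
  shows "(\<integral>u. (w \<bullet> G u)\<^sup>2 \<partial>\<nu>) = w \<bullet> ((\<integral>u. outer (G u) \<partial>\<nu>) *v w)"
proof -
  have [measurable]: "(\<lambda>u. outer (G u)) \<in> borel_measurable \<nu>"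
    using measurable_compose[OF assms(1) borel_measurable_continuous_onI[OF continuous_outer]] .
  have io: "integrable \<nu> (\<lambda>u. outer (G u))"
    by (rule Bochner_Integration.integrable_bound[of _ "\<lambda>u. real CARD('d) * (norm (G u))\<^sup>2"])
      (use i2 norm_outer_le in auto)
  have lin: "linear (\<lambda>A :: real^'d^'d. w \<bullet> (A *v w))"
    by (rule linearI) (simp_all add: matrix_vector_mult_add_rdistrib inner_add_right scaleR_matrix_vector_assoc[symmetric])
  have "(\<integral>u. w \<bullet> (outer (G u) *v w) \<partial>\<nu>) = w \<bullet> ((\<integral>u. outer (G u) \<partial>\<nu>) *v w)"
    by (rule integral_bounded_linear[OF linear_conv_bounded_linear[THEN iffD1, OF lin] io])
  then show ?thesis by (simp add: outer_quadratic_form)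
qed

text \<open>A quantitative Slutsky lemma: the function \<open>iexp\<close> is 1-Lipschitz, so
  closeness in mean passes to characteristic functions.\<close>

lemma (in prob_space) char_slutsky:
  fixes P Q :: "'a \<Rightarrow> 'b::euclidean_space"
  assumes [measurable]: "P \<in> borel_measurable M" "Q \<in> borel_measurable M"
    and i: "integrable M (\<lambda>\<omega>. Q \<omega> - P \<omega>)"
  shows "norm ((\<integral>\<omega>. iexp (t \<bullet> Q \<omega>) \<partial>M) - (\<integral>\<omega>. iexp (t \<bullet> P \<omega>) \<partial>M)) \<le> norm t * expectation (\<lambda>\<omega>. norm (Q \<omega> - P \<omega>))"
proof -
  have lip: "cmod (iexp x - iexp y) \<le> \<bar>x - y\<bar>" for x y :: real
  proof -
    have "iexp x - iexp y = iexp y * (iexp (x - y) - 1)" by (simp add: algebra_simps exp_diff exp_minus)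
    then have "cmod (iexp x - iexp y) = cmod (iexp (x - y) - 1)" by (simp add: norm_mult)
    also have "\<dots> \<le> \<bar>x - y\<bar>" using iexp_approx1[of "x - y" 0] by simp
    finally show ?thesis .
  qed
  have ii: "integrable M (\<lambda>\<omega>. iexp (t \<bullet> P \<omega>))" "integrable M (\<lambda>\<omega>. iexp (t \<bullet> Q \<omega>))"
    by (rule integrable_iexp_inner, measurable)+
  have "norm ((\<integral>\<omega>. iexp (t \<bullet> Q \<omega>) \<partial>M) - (\<integral>\<omega>. iexp (t \<bullet> P \<omega>) \<partial>M)) = norm (\<integral>\<omega>. iexp (t \<bullet> Q \<omega>) - iexp (t \<bullet> P \<omega>) \<partial>M)"
    using ii by simp
  also have "\<dots> \<le> (\<integral>\<omega>. norm (iexp (t \<bullet> Q \<omega>) - iexp (t \<bullet> P \<omega>)) \<partial>M)" by (rule integral_norm_bound)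
  also have "\<dots> \<le> (\<integral>\<omega>. norm t * norm (Q \<omega> - P \<omega>) \<partial>M)"
  proof (rule integral_mono)
    fix \<omega>
    have "norm (iexp (t \<bullet> Q \<omega>) - iexp (t \<bullet> P \<omega>)) \<le> \<bar>t \<bullet> Q \<omega> - t \<bullet> P \<omega>\<bar>" by (rule lip)
    also have "\<dots> \<le> norm t * norm (Q \<omega> - P \<omega>)" using Cauchy_Schwarz_ineq2[of t "Q \<omega> - P \<omega>"] by (simp add: inner_diff_right)
    finally show "norm (iexp (t \<bullet> Q \<omega>) - iexp (t \<bullet> P \<omega>)) \<le> norm t * norm (Q \<omega> - P \<omega>)" .
  qed (use ii i in auto)
  finally show ?thesis by simp
qed

text \<open>Cramer-Wold: the characteristic function at w sees only the projections on w, which form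
  a real i.i.d. row for \<open>char_iid_sum_approx\<close>. Its error vanishes as the row length
  grows because the moment bound is common to all rows.\<close>

lemma (in prob_space) char_noise_tendsto:
  fixes V :: "nat \<Rightarrow> nat \<Rightarrow> 'a \<Rightarrow> 'q::euclidean_space" and G :: "nat \<Rightarrow> 'q \<Rightarrow> real^'d" and m :: "nat \<Rightarrow> nat"
  assumes ind: "\<And>n. n \<ge> 1 \<Longrightarrow> indep_vars (\<lambda>_. borel) (V n) {1..}"
    and law: "\<And>n p. n \<ge> 1 \<Longrightarrow> p \<ge> 1 \<Longrightarrow> distr M borel (V n p) = \<nu> n"
    and Gm: "\<And>n. G n \<in> borel_measurable borel"
    and mean: "\<And>n. n \<ge> 1 \<Longrightarrow> (\<integral>u. G n u \<partial>\<nu> n) = 0"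
    and mom: "\<And>n. n \<ge> 1 \<Longrightarrow> (\<integral>\<^sup>+u. ennreal (norm (G n u) powr (2 + \<eta>)) \<partial>\<nu> n) \<le> ennreal C" and \<eta>: "0 < \<eta>" and C: "0 \<le> C"
    and cov: "(\<lambda>n. \<integral>u. outer (G n u) \<partial>\<nu> n) \<longlonglongrightarrow> S"
    and m: "filterlim m at_top sequentially"
  shows "(\<lambda>n. \<integral>\<omega>. iexp (w \<bullet> ((1 / sqrt (real (m n))) *\<^sub>R (\<Sum>p<m n. G n (V n (Suc p) \<omega>)))) \<partial>M)
    \<longlonglongrightarrow> complex_of_real (exp (- (w \<bullet> (S *v w)) / 2))"
proof -
  \<comment> \<open>\<open>char_iid_sum_approx\<close> asks for an exponent at most 1.\<close>
  define \<delta> where "\<delta> = min \<eta> 1"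
  have \<delta>: "0 < \<delta>" "\<delta> \<le> 1" "\<delta> \<le> \<eta>" using \<eta> by (auto simp: \<delta>_def)
  note [measurable] = Gm
  define s where "s n = w \<bullet> ((\<integral>u. outer (G n u) \<partial>\<nu> n) *v w)" for n
  have s: "s \<longlonglongrightarrow> w \<bullet> (S *v w)" unfolding s_def by (intro tendsto_inner tendsto_matrix_vector_mult cov tendsto_const)
  \<comment> \<open>From |w \<bullet> G| \<le> |w| |G| and x powr (2 + \<delta>) \<le> 1 + x powr (2
    + \<eta>) for x the norm of G.\<close>
  define C' where "C' = norm w powr (2 + \<delta>) * (1 + C)"
  let ?Z = "\<lambda>n \<omega>. (1 / sqrt (real (m n))) *\<^sub>R (\<Sum>p<m n. G n (V n (Suc p) \<omega>))"
  let ?a = "\<lambda>n. complex_of_real ((1 + (- s n / 2) / real (m n)) ^ m n)"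
  have rm: "filterlim (\<lambda>n. real (m n)) at_top sequentially"
    using filterlim_compose[OF filterlim_real_sequentially m] by simp
  have row: "cmod ((\<integral>\<omega>. iexp (w \<bullet> ?Z n \<omega>) \<partial>M) - ?a n) \<le> C' * real (m n) powr (- \<delta> / 2)"
    if n: "n \<ge> 1" and mn: "m n \<ge> 1" "s n \<le> 4 * real (m n)" for n
  proof -
    have Vm: "V n 1 \<in> borel_measurable M" using ind[OF n] unfolding indep_vars_def2 by auto
    have "prob_space (\<nu> n)" using prob_space_distr[OF Vm] law[OF n, of 1] by simp
    then interpret \<nu>: prob_space "\<nu> n" .
    have [measurable_cong]: "sets (\<nu> n) = sets borel" using law[OF n, of 1] by (metis le_refl sets_distr)
    let ?X = "\<lambda>u. w \<bullet> G n u" and ?\<mu> = "distr (\<nu> n) borel (\<lambda>u. w \<bullet> G n u)"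
    have "(\<integral>\<^sup>+u. ennreal (norm (G n u) powr (2 + \<eta>)) \<partial>\<nu> n) < \<infinity>" by (rule le_less_trans[OF mom[OF n]]) simp
    then have i\<eta>: "integrable (\<nu> n) (\<lambda>u. norm (G n u) powr (2 + \<eta>))" by (intro integrableI_nonneg) auto
    have "ennreal (\<integral>u. norm (G n u) powr (2 + \<eta>) \<partial>\<nu> n) \<le> ennreal C"
      using mom[OF n] by (subst (asm) nn_integral_eq_integral[OF i\<eta>]) auto
    then have C\<eta>: "(\<integral>u. norm (G n u) powr (2 + \<eta>) \<partial>\<nu> n) \<le> C" using C by simp
    have pw: "norm (G n u) powr r \<le> 1 + norm (G n u) powr (2 + \<eta>)" if "0 < r" "r \<le> 2 + \<eta>" for u r
    proof (cases "norm (G n u) \<le> 1")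
      case True
      then have "norm (G n u) powr r \<le> 1" using that by (intro powr_le1) auto
      then show ?thesis by (simp add: add_increasing2)
    next
      case False
      then have "norm (G n u) powr r \<le> norm (G n u) powr (2 + \<eta>)" using that by (intro powr_mono) auto
      then show ?thesis by simp
    qed
    have i2: "integrable (\<nu> n) (\<lambda>u. (norm (G n u))\<^sup>2)"
    proof (rule Bochner_Integration.integrable_bound[of _ "\<lambda>u. 1 + norm (G n u) powr (2 + \<eta>)"])
      have "(norm (G n u))\<^sup>2 \<le> 1 + norm (G n u) powr (2 + \<eta>)" for u
        using pw[of 2 u] \<eta> by (cases "G n u = 0") (auto simp: powr_numeral)
      then show "AE u in \<nu> n. norm ((norm (G n u))\<^sup>2) \<le> norm (1 + norm (G n u) powr (2 + \<eta>))"
        by (auto simp: add_increasing)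
    qed (use i\<eta> in auto)
    have iX2: "integrable (\<nu> n) (\<lambda>u. (?X u)\<^sup>2)"
    proof (rule Bochner_Integration.integrable_bound[of _ "\<lambda>u. (norm w)\<^sup>2 * (norm (G n u))\<^sup>2"])
      have "(w \<bullet> G n u)\<^sup>2 \<le> (norm w)\<^sup>2 * (norm (G n u))\<^sup>2" for u
        using Cauchy_Schwarz_ineq[of w "G n u"] by (simp add: power2_norm_eq_inner)
      then show "AE u in \<nu> n. norm ((?X u)\<^sup>2) \<le> norm ((norm w)\<^sup>2 * (norm (G n u))\<^sup>2)" by (auto simp: abs_mult)
    qed (use i2 in auto)
    have iG: "integrable (\<nu> n) (G n)"
    proof (rule integrable_norm_cancel)
      show "integrable (\<nu> n) (\<lambda>u. norm (G n u))" by (rule \<nu>.square_integrable_imp_integrable[OF _ i2]) measurable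
    qed measurable
    have pd: "\<bar>?X u\<bar> powr (2 + \<delta>) \<le> norm w powr (2 + \<delta>) * (1 + norm (G n u) powr (2 + \<eta>))" for u
    proof -
      have "\<bar>?X u\<bar> powr (2 + \<delta>) \<le> (norm w * norm (G n u)) powr (2 + \<delta>)"
        using \<delta> Cauchy_Schwarz_ineq2[of w "G n u"] by (intro powr_mono2) auto
      also have "\<dots> = norm w powr (2 + \<delta>) * norm (G n u) powr (2 + \<delta>)" by (simp add: powr_mult)
      also have "\<dots> \<le> norm w powr (2 + \<delta>) * (1 + norm (G n u) powr (2 + \<eta>))"
        using \<delta> by (intro mult_left_mono pw) auto
      finally show ?thesis .
    qed
    have i\<delta>: "integrable (\<nu> n) (\<lambda>u. \<bar>?X u\<bar> powr (2 + \<delta>))"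
      by (rule Bochner_Integration.integrable_bound[of _ "\<lambda>u. norm w powr (2 + \<delta>) * (1 + norm (G n u) powr (2 + \<eta>))"])
        (use i\<eta> pd in \<open>auto simp: abs_mult add_nonneg_nonneg\<close>)
    have "(\<integral>u. \<bar>?X u\<bar> powr (2 + \<delta>) \<partial>\<nu> n) \<le> (\<integral>u. norm w powr (2 + \<delta>) * (1 + norm (G n u) powr (2 + \<eta>)) \<partial>\<nu> n)"
      using i\<delta> i\<eta> pd by (intro integral_mono) auto
    also have "\<dots> = norm w powr (2 + \<delta>) * (1 + (\<integral>u. norm (G n u) powr (2 + \<eta>) \<partial>\<nu> n))"
      using i\<eta> by (simp add: \<nu>.prob_space)
    also have "\<dots> \<le> C'" unfolding C'_def using C\<eta> by (intro mult_left_mono) auto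
    finally have C\<delta>: "(\<integral>u. \<bar>?X u\<bar> powr (2 + \<delta>) \<partial>\<nu> n) \<le> C'" .
    have main: "cmod ((\<integral>\<omega>. iexp ((\<Sum>p=1..m n. ?X (V n p \<omega>)) / sqrt (real (m n))) \<partial>M) - ?a n) \<le> C' * real (m n) powr (- \<delta> / 2)"
    proof (rule char_iid_sum_approx[where \<mu>="?\<mu>"])
      show "indep_vars (\<lambda>_. borel) (\<lambda>p \<omega>. ?X (V n p \<omega>)) {1..}"
        by (rule indep_vars_compose2[OF ind[OF n]]) simp
      show "distr M borel (\<lambda>\<omega>. ?X (V n p \<omega>)) = ?\<mu>" if p: "p \<ge> 1" for p
      proof -
        have "V n p \<in> borel_measurable M" using ind[OF n] p unfolding indep_vars_def2 by auto
        then show ?thesis unfolding law[OF n p, symmetric] by (subst distr_distr) (auto simp: comp_def)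
      qed
      show "integrable ?\<mu> (\<lambda>x. x\<^sup>2)" using iX2 by (simp add: integrable_distr_eq)
      show "(\<integral>x. x \<partial>?\<mu>) = 0" using iG mean[OF n] by (simp add: integral_distr)
      show "(\<integral>x. x\<^sup>2 \<partial>?\<mu>) = s n"
        unfolding s_def by (subst integral_outer_quadratic_form[symmetric]) (auto simp: integral_distr i2)
      show "integrable ?\<mu> (\<lambda>x. \<bar>x\<bar> powr (2 + \<delta>))" using i\<delta> by (simp add: integrable_distr_eq)
      show "(\<integral>x. \<bar>x\<bar> powr (2 + \<delta>) \<partial>?\<mu>) \<le> C'" using C\<delta> by (simp add: integral_distr)
    qed (use \<delta> mn in auto)
    have eq: "(\<Sum>p=1..m n. ?X (V n p \<omega>)) / sqrt (real (m n)) = w \<bullet> ?Z n \<omega>" for \<omega>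
    proof -
      have "(\<Sum>p=1..m n. ?X (V n p \<omega>)) = (\<Sum>p<m n. ?X (V n (Suc p) \<omega>))"
        by (rule sum.reindex_bij_witness[of _ Suc "\<lambda>p. p - 1"]) auto
      then show ?thesis by (simp add: inner_sum_right)
    qed
    show ?thesis using main unfolding eq .
  qed
  have ev: "eventually (\<lambda>n. n \<ge> 1 \<and> m n \<ge> 1 \<and> s n \<le> 4 * real (m n)) sequentially"
  proof (intro eventually_conj)
    show "eventually (\<lambda>n. m n \<ge> 1) sequentially" using m by (simp add: filterlim_at_top)
    have "eventually (\<lambda>n. s n < w \<bullet> (S *v w) + 1) sequentially" by (rule order_tendstoD(2)[OF s]) simp
    moreover have "eventually (\<lambda>n. real (m n) \<ge> (w \<bullet> (S *v w) + 1) / 4) sequentially" using rm unfolding filterlim_at_top by blast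
    ultimately show "eventually (\<lambda>n. s n \<le> 4 * real (m n)) sequentially" by eventually_elim simp
  qed (rule eventually_ge_at_top)
  have z: "(\<lambda>n. C' * real (m n) powr (- \<delta> / 2)) \<longlonglongrightarrow> 0"
    using \<delta> by (intro tendsto_mult_right_zero tendsto_neg_powr rm) auto
  have d0: "(\<lambda>n. (\<integral>\<omega>. iexp (w \<bullet> ?Z n \<omega>) \<partial>M) - ?a n) \<longlonglongrightarrow> 0"
    by (rule Lim_null_comparison[OF _ z]) (use ev in \<open>eventually_elim, use row in blast\<close>)
  have "(\<lambda>n. - s n / 2) \<longlonglongrightarrow> - (w \<bullet> (S *v w)) / 2" by (intro tendsto_intros s) simp
  from tendsto_of_real[OF tendsto_one_plus_over_power[OF this m]]
  have "?a \<longlonglongrightarrow> complex_of_real (exp (- (w \<bullet> (S *v w)) / 2))" .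
  from tendsto_add[OF d0 this] show ?thesis by simp
qed

text \<open>Put r = x + D^-1 y. Then r = D^-1 (J x + y) + D^-1 (D - J) x, and inserting x = r - D^-1
  y on the right brings back r with a factor at most 1/2. Moving it to the left doubles the
  constants.\<close>

lemma perturbed_linear_solve:
  fixes D J :: "real^'d^'d"
  assumes D: "invertible D" and small: "norm (matrix_inv D) * norm (D - J) \<le> 1/2"
  defines "\<beta> \<equiv> norm (matrix_inv D)"
  shows "norm (x + matrix_inv D *v y) \<le> 2 * \<beta> * norm (J *v x + y) + 2 * \<beta>\<^sup>2 * norm (D - J) * norm y"
proof -
  let ?B = "matrix_inv D" and ?r = "x + matrix_inv D *v y" and ?\<delta> = "norm (D - J)"
  have "x = ?B *v (D *v x)" by (simp add: matrix_vector_mul_assoc matrix_inv_props[OF D])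
  also have "D *v x = (J *v x + y) - y + (D - J) *v x" by (simp add: matrix_vector_mult_diff_rdistrib)
  finally have eq: "?r = ?B *v (J *v x + y) + ?B *v ((D - J) *v x)"
    by (simp add: matrix_vector_right_distrib algebra_simps matrix_vector_mult_diff_distrib)
  have "x = ?r - ?B *v y" by simp
  then have x: "norm x \<le> norm ?r + \<beta> * norm y"
    unfolding \<beta>_def using norm_triangle_ineq4[of ?r "?B *v y"] norm_matrix_vector_mult_le[of ?B y] by simp
  have "norm ?r \<le> norm (?B *v (J *v x + y)) + norm (?B *v ((D - J) *v x))"
    by (subst (1) eq) (rule norm_triangle_ineq)
  also have "\<dots> \<le> \<beta> * norm (J *v x + y) + \<beta> * (?\<delta> * norm x)"
    unfolding \<beta>_def by (intro add_mono order_trans[OF norm_matrix_vector_mult_le] mult_left_mono norm_matrix_vector_mult_le) auto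
  also have "\<beta> * (?\<delta> * norm x) \<le> \<beta> * (?\<delta> * (norm ?r + \<beta> * norm y))"
    unfolding \<beta>_def[symmetric] using x by (intro mult_left_mono) (auto simp: \<beta>_def)
  also have "\<dots> = (\<beta> * ?\<delta>) * norm ?r + \<beta>\<^sup>2 * ?\<delta> * norm y" by (simp add: algebra_simps power2_eq_square)
  also have "(\<beta> * ?\<delta>) * norm ?r \<le> 1/2 * norm ?r" using small unfolding \<beta>_def by (intro mult_right_mono) auto
  finally show ?thesis by simp
qed

lemma powr_over_sqrt_floor_tendsto_1:
  assumes "\<alpha> > 0"
  shows "(\<lambda>n. real n powr \<alpha> / sqrt (real (Suc (nat \<lfloor>real n powr (2 * \<alpha>)\<rfloor>)))) \<longlonglongrightarrow> 1"
proof (rule tendsto_sandwich)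
  show "(\<lambda>n. real n powr \<alpha> / sqrt (real n powr (2 * \<alpha>) + 1)) \<longlonglongrightarrow> 1" using assms by real_asymp
  show "(\<lambda>n. real n powr \<alpha> / sqrt (real n powr (2 * \<alpha>))) \<longlonglongrightarrow> 1" using assms by real_asymp
  \<comment> \<open>The number of averaged terms is the floor plus one, which lies between x and x +
    1 for x = n powr (2\<alpha>).\<close>
  have f: "x \<le> real (Suc (nat \<lfloor>x\<rfloor>))" "real (Suc (nat \<lfloor>x\<rfloor>)) \<le> x + 1" if "0 \<le> x" for x :: real
    using that by linarith+
  show "eventually (\<lambda>n. real n powr \<alpha> / sqrt (real n powr (2 * \<alpha>) + 1) \<le> real n powr \<alpha> / sqrt (real (Suc (nat \<lfloor>real n powr (2 * \<alpha>)\<rfloor>)))) sequentially"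
  proof (intro always_eventually allI divide_left_mono mult_pos_pos real_sqrt_le_mono f(2))
    fix n
    show "0 < sqrt (real (Suc (nat \<lfloor>real n powr (2 * \<alpha>)\<rfloor>)))" by (simp del: of_nat_Suc)
  qed (auto intro: add_nonneg_pos)
  show "eventually (\<lambda>n. real n powr \<alpha> / sqrt (real (Suc (nat \<lfloor>real n powr (2 * \<alpha>)\<rfloor>))) \<le> real n powr \<alpha> / sqrt (real n powr (2 * \<alpha>))) sequentially"
    using eventually_gt_at_top[of 0]
  proof eventually_elim
    case (elim n)
    have "0 < sqrt (real (Suc (nat \<lfloor>real n powr (2 * \<alpha>)\<rfloor>)))" by (simp del: of_nat_Suc)
    with elim show ?case by (intro divide_left_mono mult_pos_pos real_sqrt_le_mono f(1)) auto
  qed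
qed

lemma filterlim_floor_powr:
  assumes "\<alpha> > 0"
  shows "filterlim (\<lambda>n. nat \<lfloor>real n powr (2 * \<alpha>)\<rfloor>) at_top sequentially"
  using assms
  by (intro filterlim_compose[OF filterlim_nat_sequentially] filterlim_compose[OF filterlim_floor_sequentially]) real_asymp

lemma norm_add_square_le: "(norm (x + y))\<^sup>2 \<le> 2 * (norm x)\<^sup>2 + 2 * (norm (y :: 'a::real_normed_vector))\<^sup>2"
proof -
  have "(norm (x + y))\<^sup>2 \<le> (norm x + norm y)\<^sup>2" by (intro power_mono norm_triangle_ineq) simp
  also have "\<dots> \<le> 2 * (norm x)\<^sup>2 + 2 * (norm y)\<^sup>2"
    using zero_le_power2[of "norm x - norm y"] by (simp add: power2_eq_square algebra_simps)
  finally show ?thesis .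
qed

lemma nn_integral_norm_add_le:
  fixes X Y :: "'w \<Rightarrow> 'a::euclidean_space"
  assumes [measurable]: "X \<in> borel_measurable M" "Y \<in> borel_measurable M"
    and X: "(\<integral>\<^sup>+\<omega>. ennreal ((norm (X \<omega>))\<^sup>2) \<partial>M) \<le> ennreal a" and Y: "(\<integral>\<^sup>+\<omega>. ennreal ((norm (Y \<omega>))\<^sup>2) \<partial>M) \<le> ennreal b"
    and ab: "0 \<le> a" "0 \<le> b"
  shows "(\<integral>\<^sup>+\<omega>. ennreal ((norm (X \<omega> + Y \<omega>))\<^sup>2) \<partial>M) \<le> ennreal (2 * a + 2 * b)"
proof -
  have "(\<integral>\<^sup>+\<omega>. ennreal ((norm (X \<omega> + Y \<omega>))\<^sup>2) \<partial>M) \<le> (\<integral>\<^sup>+\<omega>. ennreal 2 * ennreal ((norm (X \<omega>))\<^sup>2) + ennreal 2 * ennreal ((norm (Y \<omega>))\<^sup>2) \<partial>M)"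
  proof (rule nn_integral_mono)
    fix \<omega>
    show "ennreal ((norm (X \<omega> + Y \<omega>))\<^sup>2) \<le> ennreal 2 * ennreal ((norm (X \<omega>))\<^sup>2) + ennreal 2 * ennreal ((norm (Y \<omega>))\<^sup>2)"
    proof -
      have "ennreal ((norm (X \<omega> + Y \<omega>))\<^sup>2) \<le> ennreal (2 * (norm (X \<omega>))\<^sup>2 + 2 * (norm (Y \<omega>))\<^sup>2)"
        by (intro ennreal_leI norm_add_square_le)
      then show ?thesis by (simp only: ennreal_plus ennreal_mult' mult_nonneg_nonneg zero_le_power2 zero_le_numeral)
    qed
  qed
  also have "\<dots> = ennreal 2 * (\<integral>\<^sup>+\<omega>. ennreal ((norm (X \<omega>))\<^sup>2) \<partial>M) + ennreal 2 * (\<integral>\<^sup>+\<omega>. ennreal ((norm (Y \<omega>))\<^sup>2) \<partial>M)"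
    by (subst nn_integral_add) (simp_all add: nn_integral_cmult)
  also have "\<dots> \<le> ennreal 2 * ennreal a + ennreal 2 * ennreal b" by (intro add_mono mult_left_mono X Y) auto
  also have "\<dots> = ennreal (2 * a + 2 * b)" using ab by (simp add: ennreal_plus ennreal_mult')
  finally show ?thesis .
qed

lemma (in prob_space) nn_integral_square_le_powr:
  fixes X :: "'a \<Rightarrow> 'b::euclidean_space"
  assumes [measurable]: "X \<in> borel_measurable M"
    and "(\<integral>\<^sup>+\<omega>. ennreal (norm (X \<omega>) powr (2 + \<eta>)) \<partial>M) \<le> ennreal c" and "0 < \<eta>" "0 \<le> c"
  shows "(\<integral>\<^sup>+\<omega>. ennreal ((norm (X \<omega>))\<^sup>2) \<partial>M) \<le> ennreal (1 + c)"
proof -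
  have "(norm (X \<omega>))\<^sup>2 \<le> 1 + norm (X \<omega>) powr (2 + \<eta>)" for \<omega>
  proof (cases "norm (X \<omega>) \<le> 1")
    case True
    then have "(norm (X \<omega>))\<^sup>2 \<le> 1" by (simp add: power_le_one)
    then show ?thesis by (simp add: add_increasing2)
  next
    case False
    then have "norm (X \<omega>) powr 2 \<le> norm (X \<omega>) powr (2 + \<eta>)" using assms(3) by (intro powr_mono) auto
    then show ?thesis using False by (simp add: powr_numeral)
  qed
  then have "(\<integral>\<^sup>+\<omega>. ennreal ((norm (X \<omega>))\<^sup>2) \<partial>M) \<le> (\<integral>\<^sup>+\<omega>. ennreal 1 + ennreal (norm (X \<omega>) powr (2 + \<eta>)) \<partial>M)"
    by (intro nn_integral_mono) (metis ennreal_leI ennreal_plus powr_ge_zero zero_le_one)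
  also have "\<dots> = ennreal 1 + (\<integral>\<^sup>+\<omega>. ennreal (norm (X \<omega>) powr (2 + \<eta>)) \<partial>M)"
    by (subst nn_integral_add) (simp_all add: emeasure_space_1)
  also have "\<dots> \<le> ennreal 1 + ennreal c" by (intro add_left_mono assms)
  also have "\<dots> = ennreal (1 + c)" using assms by (simp add: ennreal_plus)
  finally show ?thesis .
qed

section \<open>Assembly: from uniform row bounds to the limit law of the averages\<close>

theorem theorem2p8:
  fixes M :: "'w measure"
    and H :: "real^'d \<Rightarrow> real^'q \<Rightarrow> real^'d"
    and U :: "'w \<Rightarrow> real^'q"
    and Useq :: "nat \<Rightarrow> 'w \<Rightarrow> real^'q"
    and V :: "nat \<Rightarrow> nat \<Rightarrow> 'w \<Rightarrow> real^'q"
    and \<theta> :: "nat \<Rightarrow> nat \<Rightarrow> 'w \<Rightarrow> real^'d"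
    and h :: "real^'d \<Rightarrow> real^'d"
    and hn :: "nat \<Rightarrow> real^'d \<Rightarrow> real^'d"
    and \<theta>s :: "real^'d"
    and \<theta>sn :: "nat \<Rightarrow> real^'d"
    and \<gamma> :: "real \<Rightarrow> real"
    and \<alpha> a :: real
  assumes prob: "prob_space M"
    and H_borel: "(\<lambda>(x, u). H x u) \<in> borel_measurable borel"
    and U_rv: "U \<in> borel_measurable M"
    and Useq_rv: "\<forall>n\<ge>1. Useq n \<in> borel_measurable M"
    and h_eq: "h = mean_field M H U"
    and hn_eq: "\<forall>n\<ge>1. hn n = mean_field M H (Useq n)"
    and zero_h: "\<forall>x. h x = 0 \<longleftrightarrow> x = \<theta>s"
    and zero_hn: "\<forall>n\<ge>1. \<forall>x. hn n x = 0 \<longleftrightarrow> x = \<theta>sn n"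
    \<comment> \<open>\<open>V n p\<close> is the p-th copy of \<open>Useq n\<close>, for \<open>p \<ge> 1\<close>\<close>
    and V_indep: "\<forall>n\<ge>1. prob_space.indep_vars M (\<lambda>_. borel) (V n) {1..}"
    and V_law: "\<forall>n\<ge>1. \<forall>p\<ge>1. distr M borel (V n p) = distr M borel (Useq n)"
    and init_indep: "\<forall>n\<ge>1. indep_rv M borel (\<theta> n 0)
        (PiM {1..} (\<lambda>_. borel)) (\<lambda>\<omega>. \<lambda>p\<in>{1..}. V n p \<omega>)"
    and init_moment: "\<exists>C. \<forall>n\<ge>1. (\<integral>\<^sup>+\<omega>. ennreal ((norm (\<theta> n 0 \<omega>))\<^sup>2) \<partial>M) \<le> ennreal C"
    and scheme: "\<forall>n\<ge>1. \<forall>p. \<forall>\<omega>\<in>space M. \<theta> n (Suc p) \<omega>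
        = \<theta> n p \<omega> - \<gamma> (real (Suc p)) *\<^sub>R H (\<theta> n p \<omega>) (V n (Suc p) \<omega>)"
    and \<alpha>_pos: "\<alpha> > 0"
    \<comment> \<open>(i)\<close>
    and i_C1: "C1_on h UNIV" "\<forall>n\<ge>1. C1_on (hn n) UNIV"
    and i_mr: "\<forall>x. x \<noteq> \<theta>s \<longrightarrow> (x - \<theta>s) \<bullet> h x > 0"
    and i_mrn: "\<forall>n\<ge>1. \<forall>x. x \<noteq> \<theta>sn n \<longrightarrow> (x - \<theta>sn n) \<bullet> hn n x > 0"
    and i_lim: "locally_uniform_limit hn h"
    and i_Dlim: "locally_uniform_limit (\<lambda>n x. jacobian (hn n) (at x)) (\<lambda>x. jacobian h (at x))"
    and i_inv: "invertible (jacobian h (at \<theta>s))"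
    and i_exp: "\<forall>x. convergent (scaled_error hn h \<alpha> x)"
    \<comment> \<open>(ii)\<close>
    and ii_C2: "\<exists>S. open S \<and> \<theta>s \<in> S \<and> C2_on h S"
    and ii_eig: "\<forall>z. complex_eigenvalue (jacobian h (at \<theta>s)) z \<longrightarrow> Re z > 0"
    and ii_cont: "continuous_on UNIV (second_moment M H U)"
    and ii_mom: "\<exists>\<epsilon>>0. locally_bounded (abs_moment M H U (2 + \<epsilon>))"
    and ii_pd: "positive_definite (second_moment M H U \<theta>s)"
    \<comment> \<open>(iii)\<close>
    and iii: "\<exists>b. 0 < b \<and> b \<le> 1 \<and> (\<exists>C. \<forall>n\<ge>1. \<forall>x y. x \<noteq> y \<longrightarrow>
        (\<integral>\<^sup>+\<omega>. ennreal ((norm (H x (Useq n \<omega>) - H y (Useq n \<omega>)))\<^sup>2 / norm (x - y) powr (2 * b)) \<partial>M)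
          \<le> ennreal C)"
    \<comment> \<open>(iv)\<close>
    and iv_mom: "\<exists>\<eta>>0. \<forall>R>0. \<exists>C. \<forall>x. norm x \<le> R \<longrightarrow>
        (\<forall>n\<ge>1. abs_moment M H (Useq n) (2 + \<eta>) x \<le> ennreal C)"
    and iv_lim: "locally_uniform_limit (\<lambda>n. second_moment M H (Useq n)) (second_moment M H U)"
    \<comment> \<open>(v)\<close>
    and v: "\<exists>l>0. \<forall>n\<ge>1. \<forall>x. (x - \<theta>sn n) \<bullet> hn n x \<ge> l * (norm (x - \<theta>sn n))\<^sup>2"
    \<comment> \<open>(vi)\<close>
    and vi_C2: "\<forall>n\<ge>1. C2_on (hn n) UNIV"
    and vi_lip: "\<exists>L. \<forall>n\<ge>1. L-lipschitz_on UNIV (\<lambda>x. jacobian (hn n) (at x))"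
    \<comment> \<open>(vii)\<close>
    and vii_pos: "\<forall>t\<ge>0. \<gamma> t > 0"
    and vii_dec: "\<forall>s t. 0 \<le> s \<and> s \<le> t \<longrightarrow> \<gamma> t \<le> \<gamma> s"
    and vii_zero: "(\<gamma> \<longlongrightarrow> 0) at_top"
    and vii_a: "1/2 < a" "a < 1"
    and vii_rv: "regularly_varying \<gamma> (- a)"
  shows "converges_in_law M
      (\<lambda>n \<omega>. (real n powr \<alpha>) *\<^sub>R
        (empirical_mean (\<theta> n) (nat \<lfloor>real n powr (2 * \<alpha>)\<rfloor>) \<omega> - \<theta>s))
      (gaussian
        (- (matrix_inv (jacobian h (at \<theta>s)) *v lim (scaled_error hn h \<alpha> \<theta>s)))
        (matrix_inv (jacobian h (at \<theta>s)) ** second_moment M H U \<theta>s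
          ** transpose (matrix_inv (jacobian h (at \<theta>s)))))"
proof -
  interpret prob_space M by (rule prob)
  let ?J = "\<lambda>n. jacobian (hn n) (at (\<theta>sn n))"
  define D where "D = jacobian h (at \<theta>s)"
  define B where "B = matrix_inv D"
  define S where "S = second_moment M H U \<theta>s"
  define E where "E = lim (scaled_error hn h \<alpha> \<theta>s)"
  define c where "c = - (B *v E)"
  define \<beta> where "\<beta> = norm B"
  have D: "invertible D" using i_inv by (simp add: D_def)
  have h0: "h \<theta>s = 0" using zero_h by blast
  have hz: "hn n (\<theta>sn n) = 0" if "n \<ge> 1" for n using zero_hn that by blast
  obtain l where l: "l > 0" and mono: "\<And>n x. n \<ge> 1 \<Longrightarrow> l * (norm (x - \<theta>sn n))\<^sup>2 \<le> (x - \<theta>sn n) \<bullet> hn n x"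
    using v by blast
  obtain L where lip: "\<And>n. n \<ge> 1 \<Longrightarrow> L-lipschitz_on UNIV (\<lambda>x. jacobian (hn n) (at x))" using vi_lip by blast
  have L: "0 \<le> L" using lip[of 1] lipschitz_on_nonneg by blast
  have diff: "hn n differentiable (at x)" if "n \<ge> 1" for n x
    using i_C1(2) that unfolding C1_on_def differentiable_def by blast
  have taylor: "norm (hn n x - ?J n *v (x - \<theta>sn n)) \<le> L * (norm (x - \<theta>sn n))\<^sup>2" if "n \<ge> 1" for n x
    using taylor_lipschitz_jacobian[OF diff[OF that] lip[OF that], of x "\<theta>sn n"] hz[OF that] by simp

  \<comment> \<open>Convergence of the zeros and of their Jacobians, and the bias\<close>
  have hlim: "(\<lambda>n. hn n \<theta>s) \<longlonglongrightarrow> 0" using locally_uniform_limit_pointwise[OF i_lim, of \<theta>s] h0 by simp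
  have zb: "norm (\<theta>sn n - \<theta>s) \<le> norm (hn n \<theta>s) / l" if "n \<ge> 1" for n
    using zeros_tendsto(1)[of l \<theta>s \<theta>sn hn n] l mono hlim that by blast
  have z: "\<theta>sn \<longlonglongrightarrow> \<theta>s" by (rule zeros_tendsto(2)[of l \<theta>s \<theta>sn hn, OF l mono hlim])
  \<comment> \<open>The Lipschitz bound, uniform in n, compares the Jacobian at the moving zero with
    the one at \<open>\<theta>s\<close>.\<close>
  have J: "?J \<longlonglongrightarrow> D"
  proof -
    have 1: "(\<lambda>n. jacobian (hn n) (at \<theta>s)) \<longlonglongrightarrow> D"
      unfolding D_def by (rule locally_uniform_limit_pointwise[OF i_Dlim])
    have 2: "(\<lambda>n. L * dist (\<theta>sn n) \<theta>s) \<longlonglongrightarrow> 0"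
      using tendsto_mult[OF tendsto_const tendsto_dist[OF z tendsto_const], of L \<theta>s] by simp
    have "(\<lambda>n. ?J n - jacobian (hn n) (at \<theta>s)) \<longlonglongrightarrow> 0"
      by (rule Lim_null_comparison[OF _ 2])
        (auto simp: eventually_sequentially dist_norm[symmetric] intro!: exI[of _ 1] lipschitz_onD[OF lip])
    from tendsto_add[OF this 1] show ?thesis by simp
  qed
  have Elim: "(\<lambda>n. (real n powr \<alpha>) *\<^sub>R hn n \<theta>s) \<longlonglongrightarrow> E"
  proof -
    have "scaled_error hn h \<alpha> \<theta>s \<longlonglongrightarrow> E"
      using i_exp unfolding convergent_LIMSEQ_iff E_def by blast
    then show ?thesis unfolding scaled_error_def[abs_def] by (simp add: h0)
  qed
  have clim: "(\<lambda>n. (real n powr \<alpha>) *\<^sub>R (\<theta>sn n - \<theta>s)) \<longlonglongrightarrow> c"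
    unfolding c_def B_def
    by (rule scaled_zeros_tendsto[where hn=hn and J="?J" and l=l and L=L]) (rule l zb taylor z J D Elim powr_ge_zero | assumption)+

  \<comment> \<open>Constants common to all rows\<close>
  obtain R where R: "R > 0" "\<And>n. norm (\<theta>sn n) \<le> R"
    using convergent_imp_Bseq[OF convergentI[OF z]] by (auto simp: Bseq_def)
  \<comment> \<open>All zeros lie in one ball, so the moment bound of (iv) holds at every
    \<open>\<theta>sn n\<close> with the same constant.\<close>
  obtain \<eta> C1 where \<eta>: "\<eta> > 0" and C1': "\<And>x n. norm x \<le> R \<Longrightarrow> n \<ge> 1 \<Longrightarrow> abs_moment M H (Useq n) (2 + \<eta>) x \<le> ennreal C1"
    using iv_mom R(1) by meson
  \<comment> \<open>\<open>ennreal\<close> sends negative reals to 0, so the maximum with 0 gives a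
    nonnegative constant without weakening the bound; \<open>C\<close> and \<open>C0\<close> are
    treated alike.\<close>
  define C2 where "C2 = max C1 0"
  have C2: "0 \<le> C2" "ennreal C1 \<le> ennreal C2" by (auto simp: C2_def intro: ennreal_leI)
  obtain b C3 where b: "0 < b" "b \<le> 1" and hol: "\<And>n x y. n \<ge> 1 \<Longrightarrow> x \<noteq> y \<Longrightarrow>
        (\<integral>\<^sup>+\<omega>. ennreal ((norm (H x (Useq n \<omega>) - H y (Useq n \<omega>)))\<^sup>2 / norm (x - y) powr (2 * b)) \<partial>M) \<le> ennreal C3"
    using iii by meson
  define C where "C = max C3 0"
  have C: "0 \<le> C" "ennreal C3 \<le> ennreal C" by (auto simp: C_def intro: ennreal_leI)
  obtain C0' where C0': "\<And>n. n \<ge> 1 \<Longrightarrow> (\<integral>\<^sup>+\<omega>. ennreal ((norm (\<theta> n 0 \<omega>))\<^sup>2) \<partial>M) \<le> ennreal C0'" using init_moment by blast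
  define C0 where "C0 = max C0' 0"
  have C0: "0 \<le> C0" "ennreal C0' \<le> ennreal C0" by (auto simp: C0_def intro: ennreal_leI)
  \<comment> \<open>\<open>l\<^sup>2\<close> keeps the coefficient in \<open>msq_bound\<close>
    nonnegative. The other entry bounds growth: H x is split into its value at the zero, with second
    moment at most 1 + C2, and the Hoelder difference, where y powr b \<le> 1 + y.\<close>
  define K where "K = max (l\<^sup>2) (2 * (1 + C2) + 2 * C)"
  define A0 where "A0 = 2 * C0 + 2 * R\<^sup>2"
  have K: "l\<^sup>2 \<le> K" "2 * (1 + C2) + 2 * C \<le> K" by (auto simp: K_def)
  define g where "g p = \<gamma> (real p)" for p :: nat
  define \<nu> where "\<nu> n = distr M borel (Useq n)" for n
  have Um [measurable]: "Useq n \<in> borel_measurable M" if "n \<ge> 1" for n using Useq_rv that by blast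
  have Hm: "(\<lambda>\<omega>. H x (X \<omega>)) \<in> borel_measurable N" if [measurable]: "X \<in> borel_measurable N" for x N and X :: "_ \<Rightarrow> real^'q"
    using measurable_compose[OF borel_measurable_Pair[OF borel_measurable_const that] H_borel, of x] by simp
  have Hm' [measurable]: "H x \<in> borel_measurable borel" for x using Hm[of "\<lambda>u. u" borel x] by simp
  have nuint: "(\<integral>\<^sup>+u. f u \<partial>\<nu> n) = (\<integral>\<^sup>+\<omega>. f (Useq n \<omega>) \<partial>M)" if "n \<ge> 1" "f \<in> borel_measurable borel" for n f
    unfolding \<nu>_def using that by (subst nn_integral_distr) auto
  have pnu: "prob_space (\<nu> n)" if "n \<ge> 1" for n unfolding \<nu>_def using that by (intro prob_space_distr) auto
  have snu [measurable_cong, simp]: "sets (\<nu> n) = sets borel" for n by (simp add: \<nu>_def)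
  have mom: "(\<integral>\<^sup>+u. ennreal (norm (H (\<theta>sn n) u) powr (2 + \<eta>)) \<partial>\<nu> n) \<le> ennreal C2" if n: "n \<ge> 1" for n
    using C1'[OF R(2) n] C2(2) n by (subst nuint) (auto simp: abs_moment_def intro: order_trans)
  have mom2: "(\<integral>\<^sup>+u. ennreal ((norm (H (\<theta>sn n) u))\<^sup>2) \<partial>\<nu> n) \<le> ennreal (1 + C2)" if n: "n \<ge> 1" for n
    by (rule prob_space.nn_integral_square_le_powr[OF pnu[OF n] _ mom[OF n] \<eta> C2(1)]) simp
  have holder: "(\<integral>\<^sup>+u. ennreal ((norm (H x u - H (\<theta>sn n) u))\<^sup>2) \<partial>\<nu> n) \<le> ennreal (C * ((norm (x - \<theta>sn n))\<^sup>2) powr b)" if n: "n \<ge> 1" for n x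
  proof (cases "x = \<theta>sn n")
    case False
    let ?r = "norm (x - \<theta>sn n) powr (2 * b)"
    have r: "0 < ?r" using False by simp
    have r2: "((norm (x - \<theta>sn n))\<^sup>2) powr b = ?r" using False by (simp add: powr_powr flip: powr_numeral)
    have m: "(\<lambda>\<omega>. ennreal ((norm (H x (Useq n \<omega>) - H (\<theta>sn n) (Useq n \<omega>)))\<^sup>2 / ?r)) \<in> borel_measurable M"
      using Hm[OF Um[OF n]] by measurable
    have "(\<integral>\<^sup>+u. ennreal ((norm (H x u - H (\<theta>sn n) u))\<^sup>2) \<partial>\<nu> n) = (\<integral>\<^sup>+\<omega>. ennreal ?r * ennreal ((norm (H x (Useq n \<omega>) - H (\<theta>sn n) (Useq n \<omega>)))\<^sup>2 / ?r) \<partial>M)"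
      using n r by (subst nuint) (auto simp: ennreal_mult'[symmetric])
    also have "\<dots> = ennreal ?r * (\<integral>\<^sup>+\<omega>. ennreal ((norm (H x (Useq n \<omega>) - H (\<theta>sn n) (Useq n \<omega>)))\<^sup>2 / ?r) \<partial>M)"
      by (rule nn_integral_cmult[OF m])
    also have "\<dots> \<le> ennreal ?r * ennreal C"
      by (intro mult_left_mono order_trans[OF hol[OF n False] C(2)]) simp
    also have "\<dots> = ennreal (C * ?r)" using C(1) by (simp add: ennreal_mult mult.commute)
    finally show ?thesis unfolding r2 .
  qed simp
  have growth: "(\<integral>\<^sup>+u. ennreal ((norm (H x u))\<^sup>2) \<partial>\<nu> n) \<le> ennreal (K * (1 + (norm (x - \<theta>sn n))\<^sup>2))" if n: "n \<ge> 1" for n x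
  proof -
    let ?y = "(norm (x - \<theta>sn n))\<^sup>2"
    have "(\<integral>\<^sup>+u. ennreal ((norm (H (\<theta>sn n) u + (H x u - H (\<theta>sn n) u)))\<^sup>2) \<partial>\<nu> n) \<le> ennreal (2 * (1 + C2) + 2 * (C * ?y powr b))"
      by (rule nn_integral_norm_add_le[OF _ _ mom2[OF n] holder[OF n]]) (use C C2 in auto)
    also have "\<dots> \<le> ennreal (K * (1 + ?y))"
    proof (rule ennreal_leI)
      have "?y powr b \<le> 1 + ?y" using powr_le_affine[of ?y 1 b] b by simp
      then have "C * ?y powr b \<le> C * (1 + ?y)" using C by (intro mult_left_mono) auto
      moreover have "(2 * (1 + C2) + 2 * C) * (1 + ?y) \<le> K * (1 + ?y)" using K(2) by (intro mult_right_mono) auto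
      moreover have "0 \<le> (1 + C2) * ?y" using C2(1) by simp
      ultimately show "2 * (1 + C2) + 2 * (C * ?y powr b) \<le> K * (1 + ?y)" by (simp add: algebra_simps)
    qed
    finally show ?thesis by simp
  qed
  have law: "distr M borel (V n p) = \<nu> n" if "n \<ge> 1" "p \<ge> 1" for n p using V_law that by (simp add: \<nu>_def)
  have g_pos: "0 < g p" for p unfolding g_def by (rule vii_pos[rule_format]) simp
  have g_dec: "g (Suc p) \<le> g p" for p unfolding g_def by (rule vii_dec[rule_format]) simp
  have th0: "\<theta> n 0 \<in> borel_measurable M" if "n \<ge> 1" for n using init_indep that unfolding indep_rv_def by blast
  have hn_nu: "hn n x = (\<integral>u. H x u \<partial>\<nu> n)" if n: "n \<ge> 1" for n x
    using hn_eq n unfolding mean_field_def \<nu>_def by (subst integral_distr) auto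
  have scheme: "sa_scheme M H (V n) (\<theta> n) (\<nu> n) (hn n) (\<theta>sn n) g l K A0 C b" if n: "n \<ge> 1" for n
  proof (intro sa_scheme.intro sa_scheme_axioms.intro)
    show "(\<integral>\<^sup>+\<omega>. ennreal ((norm (\<theta> n 0 \<omega> - \<theta>sn n))\<^sup>2) \<partial>M) \<le> ennreal A0"
    proof -
      have 1: "(\<integral>\<^sup>+\<omega>. ennreal ((norm (\<theta> n 0 \<omega>))\<^sup>2) \<partial>M) \<le> ennreal C0" using C0'[OF n] C0(2) by (rule order_trans)
      have 2: "(\<integral>\<^sup>+\<omega>. ennreal ((norm (- \<theta>sn n))\<^sup>2) \<partial>M) \<le> ennreal (R\<^sup>2)"
        using R by (simp add: emeasure_space_1 ennreal_leI power_mono)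
      show ?thesis
        using nn_integral_norm_add_le[OF th0[OF n] _ 1 2] C0 by (simp add: A0_def)
    qed
    show "\<theta> n (Suc p) \<omega> = \<theta> n p \<omega> - g (Suc p) *\<^sub>R H (\<theta> n p \<omega>) (V n (Suc p) \<omega>)" if "\<omega> \<in> space M" for p \<omega>
      using scheme n that by (simp add: g_def)
    show "indep_vars (\<lambda>_. borel) (V n) {1..}" using V_indep n by blast
    show "indep_rv M borel (\<theta> n 0) (PiM {1..} (\<lambda>_. borel)) (\<lambda>\<omega>. \<lambda>p\<in>{1..}. V n p \<omega>)" using init_indep n by blast
    show "0 \<le> A0" using C0 by (simp add: A0_def)
  qed (rule prob pnu[OF n] snu H_borel law[OF n] hn_nu[OF n] hz[OF n] growth[OF n] holder[OF n] mono[OF n] l K(1) C(1) b g_pos g_dec | simp)+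

  \<comment> \<open>A quarter of the smaller gap leaves s = a - \<epsilon> above 1/2 and gives a' -
    s/2 = (a + 3 \<epsilon>)/2 < 1/2.\<close>
  define \<epsilon> where "\<epsilon> = min (a - 1/2) (1 - a) / 4"
  have \<epsilon>: "0 < \<epsilon>" "\<epsilon> < a - 1/2" "3 * \<epsilon> < 1 - a" using vii_a by (auto simp: \<epsilon>_def min_def)
  define s where "s = a - \<epsilon>"
  define a' where "a' = a + \<epsilon>"
  have s: "1/2 < s" "s < a" "a < a'" "a' < 1" "a' - s / 2 < 1/2" 
  proof -
    have "a + \<epsilon> - (a - \<epsilon>) / 2 = (a + 3 * \<epsilon>) / 2" by (simp add: field_simps)
    then show "a' - s / 2 < 1/2" using \<epsilon> unfolding s_def a'_def by simp
  qed (use \<epsilon> vii_a in \<open>auto simp: s_def a'_def\<close>)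
  obtain c0 C4 where c0: "c0 > 0" and gb: "\<And>t. t \<ge> 1 \<Longrightarrow> c0 * t powr (- a') \<le> \<gamma> t \<and> \<gamma> t \<le> C4 * t powr (- s)"
    using regularly_varying_powr_bounds[of \<gamma> a s a'] vii_pos vii_dec vii_rv s by auto
  have glo: "c0 * real p powr (- a') \<le> g p" and ghi: "g p \<le> C4 * real p powr (- s)" if "p \<ge> 1" for p
    using gb[of "real p"] that by (auto simp: g_def)
  have A0: "0 \<le> A0" using C0 by (simp add: A0_def)
  have K0: "0 \<le> K" using K(1) by (meson order_trans zero_le_power2)
  obtain A' where A': "\<And>p. msq_bound g l K A0 p \<le> A' * (real p + 1) powr (- s)"
    using powr_decay_of_recursion[of "msq_bound g l K A0" l g K c0 a' C4 s] msq_bound_nonneg[OF A0 K(1)] l K0 glo ghi c0 s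
    by auto
  \<comment> \<open>The maximum with 1 provides the positive constant that
    \<open>linearization_L1\<close> asks for.\<close>
  define A where "A = max A' 1"
  have A: "0 < A" "msq_bound g l K A0 p \<le> A * (real p + 1) powr (- s)" for p
    by (auto simp: A_def intro!: order_trans[OF A'] mult_right_mono)

  define vq where "vq p = (real p + 1) powr (- (s / 2))" for p :: nat
  \<comment> \<open>The bound of \<open>linearization_L1\<close>, which depends on the row only
    through the number of steps.\<close>
  define r where "r N = sqrt A * (vq 0 / g 1 + vq (Suc N) / g (Suc N) + (\<Sum>p<N. (1 / g (Suc (Suc p)) - 1 / g (Suc p)) * vq (Suc p)))
    + L * A * (\<Sum>p<Suc N. (real p + 1) powr (- s))
    + sqrt (2 * C * A powr b * (\<Sum>p<Suc N. (real p + 1) powr (- (s * b))))" for N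
  have r0: "(\<lambda>N. r N / sqrt (real (Suc N))) \<longlonglongrightarrow> 0"
  proof -
    have 1: "(\<lambda>N. sqrt A * ((vq 0 / g 1 + vq (Suc N) / g (Suc N) + (\<Sum>p<N. (1 / g (Suc (Suc p)) - 1 / g (Suc p)) * vq (Suc p))) / sqrt (real (Suc N)))) \<longlonglongrightarrow> 0"
      unfolding vq_def using s by (intro tendsto_mult_right_zero step_weighted_decay_tendsto_0[where c=c0 and a'=a'] glo c0) auto
    have 2: "(\<lambda>N. L * A * ((\<Sum>p<Suc N. (real p + 1) powr (- s)) / sqrt (real (Suc N)))) \<longlonglongrightarrow> 0"
      using LIMSEQ_Suc[OF sum_powr_over_sqrt_tendsto_0[OF s(1)]] by (intro tendsto_mult_right_zero)
    \<comment> \<open>With the normalization moved under the square root, only the mean of the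
      powers has to vanish, so every Hoelder exponent b > 0 is enough.\<close>
    have "(\<lambda>N. sqrt (2 * C * A powr b * ((\<Sum>p<Suc N. (real p + 1) powr (- (s * b))) / real (Suc N)))) \<longlonglongrightarrow> sqrt (2 * C * A powr b * 0)"
      using LIMSEQ_Suc[OF mean_powr_tendsto_0[of "s * b"]] s b by (intro tendsto_intros) auto
    then have 3: "(\<lambda>N. sqrt (2 * C * A powr b * ((\<Sum>p<Suc N. (real p + 1) powr (- (s * b))) / real (Suc N)))) \<longlonglongrightarrow> 0" by simp
    have "r N / sqrt (real (Suc N)) = sqrt A * ((vq 0 / g 1 + vq (Suc N) / g (Suc N) + (\<Sum>p<N. (1 / g (Suc (Suc p)) - 1 / g (Suc p)) * vq (Suc p))) / sqrt (real (Suc N)))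
      + L * A * ((\<Sum>p<Suc N. (real p + 1) powr (- s)) / sqrt (real (Suc N)))
      + sqrt (2 * C * A powr b * ((\<Sum>p<Suc N. (real p + 1) powr (- (s * b))) / real (Suc N)))" for N
    proof -
      have "(x * y + u * w + sqrt (t * q)) / sqrt k = x * (y / sqrt k) + u * (w / sqrt k) + sqrt (t * (q / k))" for x y u w t q k :: real
        by (simp add: add_divide_distrib real_sqrt_divide)
      then show ?thesis unfolding r_def .
    qed
    with tendsto_add[OF tendsto_add[OF 1 2] 3] show ?thesis by (simp only: add_0_right)
  qed

  \<comment> \<open>The normalized averages and their linear approximation\<close>
  define N where "N n = nat \<lfloor>real n powr (2 * \<alpha>)\<rfloor>" for n
  \<comment> \<open>The empirical mean up to \<open>N n\<close> averages N n + 1 iterates, hence the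
    normalization by the square root of \<open>m n\<close>; \<open>\<kappa>\<close> corrects it to n
    powr \<alpha>.\<close>
  define m where "m n = Suc (N n)" for n
  define \<kappa> where "\<kappa> n = real n powr \<alpha> / sqrt (real (m n))" for n
  have \<kappa>: "\<kappa> \<longlonglongrightarrow> 1" unfolding \<kappa>_def m_def N_def by (rule powr_over_sqrt_floor_tendsto_1[OF \<alpha>_pos])
  have Nlim: "filterlim N at_top sequentially" unfolding N_def by (rule filterlim_floor_powr[OF \<alpha>_pos])
  have mlim: "filterlim m at_top sequentially" unfolding m_def using filterlim_compose[OF filterlim_Suc Nlim] by simp
  define Z where "Z n \<omega> = (1 / sqrt (real (m n))) *\<^sub>R (\<Sum>p<m n. H (\<theta>sn n) (V n (Suc p) \<omega>))" for n \<omega>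
  define G where "G n \<omega> = (1 / sqrt (real (m n))) *\<^sub>R (\<Sum>p<m n. \<theta> n p \<omega> - \<theta>sn n)" for n \<omega>
  define Q where "Q n \<omega> = (real n powr \<alpha>) *\<^sub>R (empirical_mean (\<theta> n) (N n) \<omega> - \<theta>s)" for n \<omega>
  \<comment> \<open>The approximating variable: the limiting bias plus the noise at the row's own
    zero, passed through - D^-1.\<close>
  define P where "P n \<omega> = c - B *v Z n \<omega>" for n \<omega>
  have Qeq: "Q n \<omega> = \<kappa> n *\<^sub>R G n \<omega> + (real n powr \<alpha>) *\<^sub>R (\<theta>sn n - \<theta>s)" for n \<omega>
  proof -
    have e: "(\<Sum>p<m n. \<theta> n p \<omega> - \<theta>sn n) = (\<Sum>k=0..N n. \<theta> n k \<omega>) - real (m n) *\<^sub>R \<theta>sn n"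
      by (simp add: sum_subtractf m_def lessThan_Suc_atMost atLeast0AtMost sum_constant_scaleR del: sum_constant)
    have "\<kappa> n *\<^sub>R G n \<omega> = (real n powr \<alpha> * (1 / real (m n))) *\<^sub>R (\<Sum>p<m n. \<theta> n p \<omega> - \<theta>sn n)"
      by (simp add: \<kappa>_def G_def m_def del: of_nat_Suc sum.lessThan_Suc)
    also have "\<dots> = (real n powr \<alpha>) *\<^sub>R (empirical_mean (\<theta> n) (N n) \<omega> - \<theta>sn n)"
      unfolding e by (simp add: empirical_mean_def m_def scaleR_diff_right)
    finally show ?thesis by (simp add: Q_def scaleR_diff_right)
  qed

  \<comment> \<open>The normalized quantity that \<open>linearization_L1\<close> controls; it tends
    to 0 in mean.\<close>
  define \<rho> where "\<rho> n \<omega> = ?J n *v G n \<omega> + Z n \<omega>" for n \<omega>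
  have rho_eq: "\<rho> n \<omega> = (1 / sqrt (real (m n))) *\<^sub>R (?J n *v (\<Sum>p<m n. \<theta> n p \<omega> - \<theta>sn n) + (\<Sum>p<m n. H (\<theta>sn n) (V n (Suc p) \<omega>)))" for n \<omega>
    by (simp add: \<rho>_def G_def Z_def matrix_vector_mult_scaleR scaleR_add_right)
  have rho: "integrable M (\<rho> n)" "expectation (\<lambda>\<omega>. norm (\<rho> n \<omega>)) \<le> r (N n) / sqrt (real (m n))"
    and Zint: "integrable M (Z n)" "expectation (\<lambda>\<omega>. norm (Z n \<omega>)) \<le> sqrt K"
    and \<theta>m: "\<And>p. \<theta> n p \<in> borel_measurable M" if n: "n \<ge> 1" for n
  proof -
    interpret sa: sa_scheme M H "V n" "\<theta> n" "\<nu> n" "hn n" "\<theta>sn n" g l K A0 C b by (rule scheme[OF n])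
    note lin = sa.linearization_L1[OF matrix_vector_mul_linear taylor[OF n] L A(2) A(1), of "N n", folded m_def vq_def]
    have i: "integrable M (\<lambda>\<omega>. ?J n *v (\<Sum>p<m n. \<theta> n p \<omega> - \<theta>sn n) + (\<Sum>p<m n. H (\<theta>sn n) (V n (Suc p) \<omega>)))"
      by (rule lin(2))
    then show "integrable M (\<rho> n)" unfolding rho_eq[abs_def] by (rule integrable_scaleR_right)
    have "expectation (\<lambda>\<omega>. norm (\<rho> n \<omega>)) = expectation (\<lambda>\<omega>. norm (?J n *v (\<Sum>p<m n. \<theta> n p \<omega> - \<theta>sn n) + (\<Sum>p<m n. H (\<theta>sn n) (V n (Suc p) \<omega>)))) / sqrt (real (m n))"
      unfolding rho_eq by simp
    also have "\<dots> \<le> r (N n) / sqrt (real (m n))"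
      using lin(1) unfolding r_def m_def[symmetric] by (intro divide_right_mono) auto
    finally show "expectation (\<lambda>\<omega>. norm (\<rho> n \<omega>)) \<le> r (N n) / sqrt (real (m n))" .
    show "integrable M (Z n)" unfolding Z_def[abs_def] by (intro integrable_scaleR_right sa.noise_L1)
    have "expectation (\<lambda>\<omega>. norm (Z n \<omega>)) = expectation (\<lambda>\<omega>. norm (\<Sum>p<m n. H (\<theta>sn n) (V n (Suc p) \<omega>))) / sqrt (real (m n))"
      unfolding Z_def by simp
    also have "\<dots> \<le> sqrt (real (m n) * K) / sqrt (real (m n))" by (intro divide_right_mono sa.noise_L1) simp
    also have "\<dots> = sqrt K" by (simp add: real_sqrt_mult m_def del: of_nat_Suc)
    finally show "expectation (\<lambda>\<omega>. norm (Z n \<omega>)) \<le> sqrt K" .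
    show "\<theta> n p \<in> borel_measurable M" for p by (rule sa.theta_measurable)
  qed

  \<comment> \<open>Collected from Q - P = \<kappa> (G + B Z) - (\<kappa> - 1) B Z + (scaled zero -
    c): \<open>perturbed_linear_solve\<close> bounds G + B Z, |\<kappa>| is at most |\<kappa> - 1| +
    1, and the mean norm of Z is at most sqrt K.\<close>
  define err where "err n = (\<bar>\<kappa> n - 1\<bar> + 1) * (2 * \<beta> * (r (N n) / sqrt (real (m n))) + 2 * \<beta>\<^sup>2 * norm (D - ?J n) * sqrt K)
     + \<bar>\<kappa> n - 1\<bar> * \<beta> * sqrt K + norm ((real n powr \<alpha>) *\<^sub>R (\<theta>sn n - \<theta>s) - c)" for n
  have err0: "err \<longlonglongrightarrow> 0"
  proof -
    have rN: "(\<lambda>n. r (N n) / sqrt (real (m n))) \<longlonglongrightarrow> 0"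
      using filterlim_compose[OF r0 Nlim] by (simp add: m_def)
    have "err \<longlonglongrightarrow> (\<bar>1 - 1\<bar> + 1) * (2 * \<beta> * 0 + 2 * \<beta>\<^sup>2 * norm (D - D) * sqrt K) + \<bar>1 - 1\<bar> * \<beta> * sqrt K + norm (c - c)"
      unfolding err_def by (intro tendsto_intros \<kappa> rN J clim)
    then show ?thesis by simp
  qed
  have small: "eventually (\<lambda>n. \<beta> * norm (D - ?J n) \<le> 1/2 \<and> n \<ge> 1) sequentially"
  proof (intro eventually_conj eventually_ge_at_top)
    have "(\<lambda>n. \<beta> * norm (D - ?J n)) \<longlonglongrightarrow> \<beta> * norm (D - D)" by (intro tendsto_intros J)
    then have "eventually (\<lambda>n. \<beta> * norm (D - ?J n) < 1/2) sequentially" by (rule order_tendstoD) simp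
    then show "eventually (\<lambda>n. \<beta> * norm (D - ?J n) \<le> 1/2) sequentially" by eventually_elim simp
  qed
  have Qm: "Q n \<in> borel_measurable M" if n: "n \<ge> 1" for n
    using \<theta>m[OF n] unfolding Q_def[abs_def] empirical_mean_def by measurable
  have BZm: "integrable M (\<lambda>\<omega>. B *v Z n \<omega>)" if n: "n \<ge> 1" for n
    by (rule integrable_bounded_linear[OF matrix_vector_mul_bounded_linear Zint(1)[OF n]])
  have Gint: "integrable M (G n)" if n: "n \<ge> 1" for n
  proof -
    interpret sa: sa_scheme M H "V n" "\<theta> n" "\<nu> n" "hn n" "\<theta>sn n" g l K A0 C b by (rule scheme[OF n])
    show ?thesis unfolding G_def[abs_def] by (intro integrable_scaleR_right Bochner_Integration.integrable_sum sa.deviation_L1)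
  qed
  have close: "integrable M (\<lambda>\<omega>. Q n \<omega> - P n \<omega>) \<and> expectation (\<lambda>\<omega>. norm (Q n \<omega> - P n \<omega>)) \<le> err n"
    if n: "\<beta> * norm (D - ?J n) \<le> 1/2 \<and> n \<ge> 1" for n
  proof -
    have n1: "n \<ge> 1" using n by simp
    let ?cn = "(real n powr \<alpha>) *\<^sub>R (\<theta>sn n - \<theta>s)" and ?\<delta> = "norm (D - ?J n)"
    have i: "integrable M (\<lambda>\<omega>. Q n \<omega> - P n \<omega>)"
      unfolding Qeq P_def using Gint[OF n1] BZm[OF n1] by auto
    have pt: "norm (Q n \<omega> - P n \<omega>) \<le> (\<bar>\<kappa> n - 1\<bar> + 1) * (2 * \<beta> * norm (\<rho> n \<omega>) + 2 * \<beta>\<^sup>2 * ?\<delta> * norm (Z n \<omega>))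
        + \<bar>\<kappa> n - 1\<bar> * \<beta> * norm (Z n \<omega>) + norm (?cn - c)" for \<omega>
    proof -
      have "Q n \<omega> - P n \<omega> = \<kappa> n *\<^sub>R (G n \<omega> + B *v Z n \<omega>) - (\<kappa> n - 1) *\<^sub>R (B *v Z n \<omega>) + (?cn - c)"
        unfolding Qeq P_def by (simp add: algebra_simps)
      also have "norm \<dots> \<le> \<bar>\<kappa> n\<bar> * norm (G n \<omega> + B *v Z n \<omega>) + \<bar>\<kappa> n - 1\<bar> * norm (B *v Z n \<omega>) + norm (?cn - c)"
        by (rule order_trans[OF norm_triangle_ineq]) (intro add_right_mono order_trans[OF norm_triangle_ineq4], simp)
      also have "\<dots> \<le> (\<bar>\<kappa> n - 1\<bar> + 1) * (2 * \<beta> * norm (\<rho> n \<omega>) + 2 * \<beta>\<^sup>2 * ?\<delta> * norm (Z n \<omega>))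
          + \<bar>\<kappa> n - 1\<bar> * (\<beta> * norm (Z n \<omega>)) + norm (?cn - c)"
        unfolding \<rho>_def \<beta>_def B_def
        using n by (intro add_mono mult_mono perturbed_linear_solve D norm_matrix_vector_mult_le order_refl)
          (auto simp: \<beta>_def B_def)
      finally show ?thesis by (simp add: mult.assoc)
    qed
    have "expectation (\<lambda>\<omega>. norm (Q n \<omega> - P n \<omega>)) \<le> expectation (\<lambda>\<omega>. (\<bar>\<kappa> n - 1\<bar> + 1) * (2 * \<beta> * norm (\<rho> n \<omega>) + 2 * \<beta>\<^sup>2 * ?\<delta> * norm (Z n \<omega>))
        + \<bar>\<kappa> n - 1\<bar> * \<beta> * norm (Z n \<omega>) + norm (?cn - c))"
      using i rho(1)[OF n1] Zint(1)[OF n1] by (intro integral_mono pt) auto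
    also have "\<dots> = (\<bar>\<kappa> n - 1\<bar> + 1) * (2 * \<beta> * expectation (\<lambda>\<omega>. norm (\<rho> n \<omega>)) + 2 * \<beta>\<^sup>2 * ?\<delta> * expectation (\<lambda>\<omega>. norm (Z n \<omega>)))
        + \<bar>\<kappa> n - 1\<bar> * \<beta> * expectation (\<lambda>\<omega>. norm (Z n \<omega>)) + norm (?cn - c)"
      using rho(1)[OF n1] Zint(1)[OF n1] by (simp add: prob_space)
    also have "\<dots> \<le> err n"
      unfolding err_def using rho(2)[OF n1] Zint(2)[OF n1]
      by (intro add_mono mult_left_mono order_refl) (auto simp: \<beta>_def)
    finally show ?thesis using i by blast
  qed

  \<comment> \<open>The covariance of row n is taken at its own zero, so the law and the point of
    evaluation move together; locally uniform convergence allows this.\<close>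
  have cov: "(\<lambda>n. \<integral>u. outer (H (\<theta>sn n) u) \<partial>\<nu> n) \<longlonglongrightarrow> S"
  proof -
    have "(\<lambda>n. second_moment M H (Useq n) (\<theta>sn n)) \<longlonglongrightarrow> S"
      unfolding S_def by (rule uniform_limit_diagonal[OF iv_lim _ z]) (use ii_cont in \<open>simp add: continuous_on_eq_continuous_at\<close>)
    moreover have "eventually (\<lambda>n. second_moment M H (Useq n) (\<theta>sn n) = (\<integral>u. outer (H (\<theta>sn n) u) \<partial>\<nu> n)) sequentially"
      using eventually_ge_at_top[of 1]
    proof eventually_elim
      case (elim n)
      have "(\<lambda>u. outer (H (\<theta>sn n) u)) \<in> borel_measurable borel"
        using measurable_compose[OF Hm' borel_measurable_continuous_onI[OF continuous_outer]] .
      then show ?case unfolding second_moment_def \<nu>_def using elim by (subst integral_distr) auto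
    qed
    ultimately show ?thesis by (rule Lim_transform_eventually)
  qed
  have charP: "(\<lambda>n. \<integral>\<omega>. iexp (t \<bullet> P n \<omega>) \<partial>M) \<longlonglongrightarrow>
      iexp (t \<bullet> c) * complex_of_real (exp (- ((transpose B *v t) \<bullet> (S *v (transpose B *v t))) / 2))" for t
  proof -
    \<comment> \<open>The minus sign comes from P = c - B Z and disappears in the quadratic
      form.\<close>
    let ?w = "- (transpose B *v t)"
    have tb: "t \<bullet> (B *v x) = (transpose B *v t) \<bullet> x" for x
      by (metis dot_lmul_matrix transpose_matrix_vector)
    have "(\<integral>\<omega>. iexp (t \<bullet> P n \<omega>) \<partial>M) = iexp (t \<bullet> c) * (\<integral>\<omega>. iexp (?w \<bullet> Z n \<omega>) \<partial>M)" for n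
    proof -
      have "t \<bullet> P n \<omega> = t \<bullet> c + ?w \<bullet> Z n \<omega>" for \<omega>
        unfolding P_def inner_diff_right tb inner_minus_left by simp
      then have "(\<integral>\<omega>. iexp (t \<bullet> P n \<omega>) \<partial>M) = (\<integral>\<omega>. iexp (t \<bullet> c) * iexp (?w \<bullet> Z n \<omega>) \<partial>M)"
        by (simp only: of_real_add distrib_left exp_add)
      then show ?thesis by (simp only: integral_mult_right_zero)
    qed
    moreover have "(\<lambda>n. \<integral>\<omega>. iexp (?w \<bullet> Z n \<omega>) \<partial>M) \<longlonglongrightarrow> complex_of_real (exp (- (?w \<bullet> (S *v ?w)) / 2))"
      unfolding Z_def
    proof (rule char_noise_tendsto[where \<nu>=\<nu> and \<eta>=\<eta> and C=C2])
      show "(\<integral>u. H (\<theta>sn n) u \<partial>\<nu> n) = 0" if "n \<ge> 1" for n using hn_nu[OF that] hz[OF that] by simp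
    qed (use V_indep law mom \<eta> C2 cov mlim in auto)
    moreover have "?w \<bullet> (S *v ?w) = (transpose B *v t) \<bullet> (S *v (transpose B *v t))"
      using matrix_vector_mult_scaleR[of S "-1" "transpose B *v t"] by simp
    ultimately show ?thesis by (simp only: tendsto_mult_left)
  qed

  \<comment> \<open>Identification of the limit law\<close>
  let ?\<Gamma> = "gaussian c (B ** S ** transpose B)"
  have iB: "invertible B"
    unfolding invertible_def B_def using matrix_inv_props[OF D] by blast
  have pd: "positive_definite S" using ii_pd by (simp add: S_def)
  have charQ: "(\<lambda>n. \<integral>\<omega>. iexp (t \<bullet> Q n \<omega>) \<partial>M) \<longlonglongrightarrow> (\<integral>x. iexp (t \<bullet> x) \<partial>?\<Gamma>)" for t
  proof -
    have 0: "(\<lambda>n. norm t * err n) \<longlonglongrightarrow> 0" using err0 by (rule tendsto_mult_right_zero)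
    have "(\<lambda>n. (\<integral>\<omega>. iexp (t \<bullet> Q n \<omega>) \<partial>M) - (\<integral>\<omega>. iexp (t \<bullet> P n \<omega>) \<partial>M)) \<longlonglongrightarrow> 0"
    proof (rule Lim_null_comparison[OF _ 0])
      show "eventually (\<lambda>n. norm ((\<integral>\<omega>. iexp (t \<bullet> Q n \<omega>) \<partial>M) - (\<integral>\<omega>. iexp (t \<bullet> P n \<omega>) \<partial>M)) \<le> norm t * err n) sequentially"
        using small
      proof eventually_elim
        case (elim n)
        then have n: "n \<ge> 1" by simp
        have Pm: "P n \<in> borel_measurable M" unfolding P_def[abs_def] using BZm[OF n] by auto
        note cl = close[OF elim]
        have "norm ((\<integral>\<omega>. iexp (t \<bullet> Q n \<omega>) \<partial>M) - (\<integral>\<omega>. iexp (t \<bullet> P n \<omega>) \<partial>M)) \<le> norm t * expectation (\<lambda>\<omega>. norm (Q n \<omega> - P n \<omega>))"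
          by (rule char_slutsky[OF Pm Qm[OF n]]) (use cl in blast)
        also have "\<dots> \<le> norm t * err n" using cl by (intro mult_left_mono) auto
        finally show ?case .
      qed
    qed
    from tendsto_add[OF this charP[of t]] show ?thesis unfolding char_gaussian[OF iB pd] by simp
  qed
  \<comment> \<open>The hypotheses start at n = 1, so \<open>Q 0\<close> is not known to be
    measurable; the continuity theorem is applied to the sequence shifted by one, which has the same
    limit.\<close>
  have WS: "weakly_converges (\<lambda>n. distr M borel (Q (Suc n))) ?\<Gamma>"
  proof (rule levy_continuity_euclidean)
    show "prob_space (distr M borel (Q (Suc n)))" for n by (rule prob_space_distr[OF Qm]) simp
    show "prob_space ?\<Gamma>" by (rule prob_space_gaussian[OF iB pd])
    show "sets ?\<Gamma> = sets borel" by (rule sets_gaussian[OF iB pd])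
    show "(\<lambda>n. \<integral>x. iexp (t \<bullet> x) \<partial>distr M borel (Q (Suc n))) \<longlonglongrightarrow> (\<integral>x. iexp (t \<bullet> x) \<partial>?\<Gamma>)" for t
    proof -
      have "(\<integral>x. iexp (t \<bullet> x) \<partial>distr M borel (Q (Suc n))) = (\<integral>\<omega>. iexp (t \<bullet> Q (Suc n) \<omega>) \<partial>M)" for n
        by (rule integral_distr[OF Qm]) auto
      then show ?thesis using LIMSEQ_Suc[OF charQ[of t]] by simp
    qed
  qed simp
  have "weakly_converges (\<lambda>n. distr M borel (Q n)) ?\<Gamma>"
    unfolding weakly_converges_def
  proof (intro allI impI)
    fix f :: "real^'d \<Rightarrow> real"
    assume f: "continuous_on UNIV f \<and> bounded (range f)"
    from WS[unfolded weakly_converges_def, rule_format, OF f]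
    show "(\<lambda>n. \<integral>x. f x \<partial>distr M borel (Q n)) \<longlonglongrightarrow> (\<integral>x. f x \<partial>?\<Gamma>)" by (rule LIMSEQ_imp_Suc)
  qed
  then show ?thesis
    unfolding converges_in_law_def Q_def[abs_def] N_def c_def B_def D_def S_def E_def .
qed

end
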